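(* Let $(X,d)$ be a discrete metric space of bounded geometry. Then $\dim_{\mathrm{nuc}}(UC_r^*(X))\le\mathrm{asdim}(X)$.
   Context: C.p. means completely positive; c.p.c. means completely positive and contractive. A c.p. map $\varphi:A\to B$ between $C^*$-algebras has order zero if for all $a,b\in A_+$, $ab=0$ implies $\varphi(a)\varphi(b)=0$. Nuclear dimension: a (not necessarily separable) $C^*$-algebra $A$ satisfies $\dim_{\mathrm{nuc}}A\le n$ if there is a net $(F_\lambda,\psi_\lambda,\varphi_\lambda)_{\lambda\in\Lambda}$ with $F_\lambda$ finite-dimensional $C^*$-algebras and $\psi_\lambda:A\to F_\lambda$, $\varphi_\lambda:F_\lambda\to A$ c.p. maps such that (i) $\varphi_\lambda\circ\psi_\lambda(a)\to a$ uniformly on finite subsets of $A$; (ii) $\|\psi_\lambda\|\le 1$; (iii) each $F_\lambda$ decomposes into $n+1$ ideals $F_\lambda=F_\lambda^{(0)}\oplus\dots\oplus F_\lambda^{(n)}$ such that $\varphi_\lambda|_{F_\lambda^{(i)}}$ is a c.p.c. order zero map for $i=0,\dots,n$. $\dim_{\mathrm{nuc}}A$ is the least such $n\in\{0,1,2,\dots\}$, and $\infty$ if there is none. Bounded geometry: a discrete metric space $(X,d)$ has bounded geometry if for every $r$, $\sup_{x\in X}|B_r(x)|<\infty$, where $B_r(x)=\{y\in X: d(x,y)\le r\}$. Uniform Roe algebra: consider complex matrices $[\alpha_{x,y}]_{x,y\in X}$ such that (i) there is $M\ge0$ with $|\alpha_{x,y}|\le M$ for all $x,y$; (ii) there is $r>0$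 with $\alpha_{x,y}=0$ whenever $d(x,y)>r$. Each such matrix defines a bounded operator on $\ell^2(X)$; $UC_r^*(X)\subseteq B(\ell^2(X))$ is the norm closure of the set of these operators (a $C^*$-algebra). Asymptotic dimension: a uniform cover of $X$ is a family $\mathcal{U}$ of subsets of $X$ with union $X$ whose diameters are uniformly bounded. A cover has order at most $n$ if any $n+2$ different members have empty intersection. $\mathrm{asdim}\,X\le n$ if for every uniform cover $\mathcal{U}$ there is a uniform cover $\mathcal{V}$ of order at most $n$ such that every $U\in\mathcal{U}$ is contained in some $V\in\mathcal{V}$; $\mathrm{asdim}\,X$ is the least such $n$, and $\infty$ if there is none. *)

theory Defs
  imports "HOL-Analysis.Analysis" "HOL-Library.Extended_Nat" "HOL-Algebra.Module"
begin

section \<open>C*-algebras\<close>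

definition complex_ring :: "complex ring" where
  "complex_ring = \<lparr>carrier = UNIV, monoid.mult = (*), one = 1, ring.zero = 0, add = (+)\<rparr>"

text \<open>
  C*-algebras are not assumed to be unital, and the axioms below never mention the field
  \<open>one\<close> inherited from the records of HOL-Algebra.
\<close>

record 'a cstar = "(complex, 'a) module" +
  star :: "'a \<Rightarrow> 'a"
  nrm :: "'a \<Rightarrow> real"

locale cstar_algebra = Module.module complex_ring A for A :: "('a, 'm) cstar_scheme" (structure) +
  assumes mult_closed: "\<lbrakk>x \<in> carrier A; y \<in> carrier A\<rbrakk> \<Longrightarrow> x \<otimes> y \<in> carrier A"
    and mult_assoc: "\<lbrakk>x \<in> carrier A; y \<in> carrier A; z \<in> carrier A\<rbrakk> \<Longrightarrow> (x \<otimes> y) \<otimes> z = x \<otimes> (y \<otimes> z)"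
    and mult_l_distr:
      "\<lbrakk>x \<in> carrier A; y \<in> carrier A; z \<in> carrier A\<rbrakk> \<Longrightarrow> (x \<oplus> y) \<otimes> z = x \<otimes> z \<oplus> y \<otimes> z"
    and mult_r_distr:
      "\<lbrakk>x \<in> carrier A; y \<in> carrier A; z \<in> carrier A\<rbrakk> \<Longrightarrow> z \<otimes> (x \<oplus> y) = z \<otimes> x \<oplus> z \<otimes> y"
    and smult_mult_l: "\<lbrakk>x \<in> carrier A; y \<in> carrier A\<rbrakk> \<Longrightarrow> (c \<odot> x) \<otimes> y = c \<odot> (x \<otimes> y)"
    and smult_mult_r: "\<lbrakk>x \<in> carrier A; y \<in> carrier A\<rbrakk> \<Longrightarrow> x \<otimes> (c \<odot> y) = c \<odot> (x \<otimes> y)"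
    and star_closed: "x \<in> carrier A \<Longrightarrow> star A x \<in> carrier A"
    and star_star: "x \<in> carrier A \<Longrightarrow> star A (star A x) = x"
    and star_add: "\<lbrakk>x \<in> carrier A; y \<in> carrier A\<rbrakk> \<Longrightarrow> star A (x \<oplus> y) = star A x \<oplus> star A y"
    and star_smult: "x \<in> carrier A \<Longrightarrow> star A (c \<odot> x) = cnj c \<odot> star A x"
    and star_mult: "\<lbrakk>x \<in> carrier A; y \<in> carrier A\<rbrakk> \<Longrightarrow> star A (x \<otimes> y) = star A y \<otimes> star A x"
    and nrm_nonneg: "x \<in> carrier A \<Longrightarrow> 0 \<le> nrm A x"
    and nrm_eq_0: "x \<in> carrier A \<Longrightarrow> nrm A x = 0 \<longleftrightarrow> x = \<zero>"
    and nrm_triangle: "\<lbrakk>x \<in> carrier A; y \<in> carrier A\<rbrakk> \<Longrightarrow> nrm A (x \<oplus> y) \<le> nrm A x + nrm A y"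
    and nrm_smult: "x \<in> carrier A \<Longrightarrow> nrm A (c \<odot> x) = cmod c * nrm A x"
    and nrm_mult: "\<lbrakk>x \<in> carrier A; y \<in> carrier A\<rbrakk> \<Longrightarrow> nrm A (x \<otimes> y) \<le> nrm A x * nrm A y"
    and cstar_identity: "x \<in> carrier A \<Longrightarrow> nrm A (star A x \<otimes> x) = (nrm A x)\<^sup>2"
    and complete:
      "\<lbrakk>range s \<subseteq> carrier A; \<forall>e>0. \<exists>N. \<forall>m\<ge>N. \<forall>n\<ge>N. nrm A (s m \<ominus> s n) < e\<rbrakk>
        \<Longrightarrow> \<exists>x\<in>carrier A. (\<lambda>n. nrm A (s n \<ominus> x)) \<longlonglongrightarrow> 0"

definition finite_dim_cstar :: "('a, 'm) cstar_scheme \<Rightarrow> bool" where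
  "finite_dim_cstar F \<longleftrightarrow> cstar_algebra F \<and>
     (\<exists>S. finite S \<and> S \<subseteq> carrier F \<and>
        (\<forall>x\<in>carrier F. \<exists>c. x = (\<Oplus>\<^bsub>F\<^esub>s\<in>S. c s \<odot>\<^bsub>F\<^esub> s)))"

text \<open>Two-sided ideals; in finite dimension they are automatically norm closed and self-adjoint.\<close>

definition cstar_ideal :: "'a set \<Rightarrow> ('a, 'm) cstar_scheme \<Rightarrow> bool" where
  "cstar_ideal I F \<longleftrightarrow> submodule I complex_ring F \<and>
     (\<forall>a\<in>carrier F. \<forall>x\<in>I. a \<otimes>\<^bsub>F\<^esub> x \<in> I \<and> x \<otimes>\<^bsub>F\<^esub> a \<in> I)"

text \<open>\<open>F\<close> is the internal direct sum of the ideals \<open>I 0, \<dots>, I n\<close>; summands may be zero.\<close>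

definition ideal_decomposition :: "('a, 'm) cstar_scheme \<Rightarrow> nat \<Rightarrow> (nat \<Rightarrow> 'a set) \<Rightarrow> bool" where
  "ideal_decomposition F n I \<longleftrightarrow> (\<forall>i\<le>n. cstar_ideal (I i) F) \<and>
     (\<forall>x\<in>carrier F. \<exists>!f. f \<in> (\<Pi>\<^sub>E i\<in>{..n}. I i) \<and> x = (\<Oplus>\<^bsub>F\<^esub>i\<in>{..n}. f i))"

section \<open>Completely positive and order zero maps\<close>

definition pos_cone :: "('a, 'm) cstar_scheme \<Rightarrow> 'a set" where
  "pos_cone A = {star A b \<otimes>\<^bsub>A\<^esub> b | b. b \<in> carrier A}"

text \<open>
  Positivity in the matrix algebra \<open>M\<^sub>n(A)\<close>: the matrix \<open>a\<close> has the form \<open>b\<^sup>* b\<close>, written out in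
  entries. Only the entries with indices below \<open>n\<close> are relevant.
\<close>

definition mat_pos :: "('a, 'm) cstar_scheme \<Rightarrow> nat \<Rightarrow> (nat \<Rightarrow> nat \<Rightarrow> 'a) \<Rightarrow> bool" where
  "mat_pos A n a \<longleftrightarrow>
     (\<exists>b. (\<forall>i<n. \<forall>j<n. b i j \<in> carrier A) \<and>
          (\<forall>i<n. \<forall>j<n. a i j = (\<Oplus>\<^bsub>A\<^esub>k\<in>{..<n}. star A (b k i) \<otimes>\<^bsub>A\<^esub> b k j)))"

definition linear_map :: "('a, 'm) cstar_scheme \<Rightarrow> ('b, 'k) cstar_scheme \<Rightarrow> ('a \<Rightarrow> 'b) \<Rightarrow> bool" where
  "linear_map A B f \<longleftrightarrow> f \<in> carrier A \<rightarrow> carrier B \<and>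
     (\<forall>x\<in>carrier A. \<forall>y\<in>carrier A. f (x \<oplus>\<^bsub>A\<^esub> y) = f x \<oplus>\<^bsub>B\<^esub> f y) \<and>
     (\<forall>c. \<forall>x\<in>carrier A. f (c \<odot>\<^bsub>A\<^esub> x) = c \<odot>\<^bsub>B\<^esub> f x)"

definition cp_map :: "('a, 'm) cstar_scheme \<Rightarrow> ('b, 'k) cstar_scheme \<Rightarrow> ('a \<Rightarrow> 'b) \<Rightarrow> bool" where
  "cp_map A B f \<longleftrightarrow> linear_map A B f \<and>
     (\<forall>n a. mat_pos A n a \<longrightarrow> mat_pos B n (\<lambda>i j. f (a i j)))"

definition contractive :: "('a, 'm) cstar_scheme \<Rightarrow> ('b, 'k) cstar_scheme \<Rightarrow> ('a \<Rightarrow> 'b) \<Rightarrow> bool" where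
  "contractive A B f \<longleftrightarrow> (\<forall>x\<in>carrier A. nrm B (f x) \<le> nrm A x)"

definition order_zero :: "('a, 'm) cstar_scheme \<Rightarrow> ('b, 'k) cstar_scheme \<Rightarrow> ('a \<Rightarrow> 'b) \<Rightarrow> bool" where
  "order_zero A B f \<longleftrightarrow>
     (\<forall>a\<in>pos_cone A. \<forall>b\<in>pos_cone A. a \<otimes>\<^bsub>A\<^esub> b = \<zero>\<^bsub>A\<^esub> \<longrightarrow> f a \<otimes>\<^bsub>B\<^esub> f b = \<zero>\<^bsub>B\<^esub>)"

section \<open>Nuclear dimension\<close>

definition nuc_triple ::
  "('a, 'm) cstar_scheme \<Rightarrow> nat \<Rightarrow> 'f cstar \<Rightarrow> ('a \<Rightarrow> 'f) \<Rightarrow> ('f \<Rightarrow> 'a) \<Rightarrow> bool" where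
  "nuc_triple A n F \<psi> \<phi> \<longleftrightarrow>
     finite_dim_cstar F \<and> cp_map A F \<psi> \<and> cp_map F A \<phi> \<and> contractive A F \<psi> \<and>
     (\<exists>I. ideal_decomposition F n I \<and>
        (\<forall>i\<le>n. cp_map (F\<lparr>carrier := I i\<rparr>) A \<phi> \<and> contractive (F\<lparr>carrier := I i\<rparr>) A \<phi> \<and>
                order_zero (F\<lparr>carrier := I i\<rparr>) A \<phi>))"

definition directed_by :: "'l set \<Rightarrow> ('l \<Rightarrow> 'l \<Rightarrow> bool) \<Rightarrow> bool" where
  "directed_by L R \<longleftrightarrow> L \<noteq> {} \<and> reflp_on L R \<and> transp_on L R \<and>
     (\<forall>x\<in>L. \<forall>y\<in>L. \<exists>z\<in>L. R x z \<and> R y z)"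

text \<open>
  HOL cannot quantify existentially over types, so the types of the index set and of the
  finite-dimensional algebras are fixed; neither choice loses generality.

  Every finite-dimensional C*-algebra is isomorphic to an algebra of (block diagonal) complex
  matrices, so it has an isomorphic copy whose carrier is a set of functions
  \<open>nat \<Rightarrow> nat \<Rightarrow> complex\<close>; its operations and norm are unconstrained apart from the axioms.

  If there is a net over any directed set, then choosing from it, for each finite \<open>G \<subseteq> A\<close> and each
  \<open>k\<close>, a triple that is accurate up to \<open>1/(k+1)\<close> on \<open>G\<close> gives a net indexed by pairs \<open>(G, k)\<close>.
\<close>

definition nuc_dim_le :: "('a, 'm) cstar_scheme \<Rightarrow> nat \<Rightarrow> bool" where
  "nuc_dim_le A n \<longleftrightarrow>
     (\<exists>(L :: ('a set \<times> nat) set) R (F :: _ \<Rightarrow> (nat \<Rightarrow> nat \<Rightarrow> complex) cstar) \<psi> \<phi>.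
        directed_by L R \<and>
        (\<forall>l\<in>L. nuc_triple A n (F l) (\<psi> l) (\<phi> l)) \<and>
        (\<forall>G e. finite G \<and> G \<subseteq> carrier A \<and> e > 0 \<longrightarrow>
           (\<exists>l0\<in>L. \<forall>l\<in>L. R l0 l \<longrightarrow> (\<forall>a\<in>G. nrm A (\<phi> l (\<psi> l a) \<ominus>\<^bsub>A\<^esub> a) < e))))"

definition nuc_dim :: "('a, 'm) cstar_scheme \<Rightarrow> enat" where
  "nuc_dim A = Inf {enat n | n. nuc_dim_le A n}"

section \<open>Bounded operators on the Hilbert space of square-summable functions\<close>

text \<open>Elements of \<open>\<ell>\<^sup>2(X)\<close> are represented by functions vanishing outside \<open>X\<close>.\<close>

definition ell2 :: "'x set \<Rightarrow> ('x \<Rightarrow> complex) set" where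
  "ell2 X = {f. (\<forall>x. x \<notin> X \<longrightarrow> f x = 0) \<and> (\<lambda>x. (cmod (f x))\<^sup>2) summable_on X}"

definition ell2_inner :: "'x set \<Rightarrow> ('x \<Rightarrow> complex) \<Rightarrow> ('x \<Rightarrow> complex) \<Rightarrow> complex" where
  "ell2_inner X f g = (\<Sum>\<^sub>\<infinity>x\<in>X. cnj (f x) * g x)"

definition ell2_norm :: "'x set \<Rightarrow> ('x \<Rightarrow> complex) \<Rightarrow> real" where
  "ell2_norm X f = sqrt (\<Sum>\<^sub>\<infinity>x\<in>X. (cmod (f x))\<^sup>2)"

text \<open>
  An operator on \<open>\<ell>\<^sup>2(X)\<close> is extended by zero to all functions, so that equal operators are equal
  as HOL functions and sums, multiples and composites need no restriction.
\<close>

definition bounded_operators :: "'x set \<Rightarrow> (('x \<Rightarrow> complex) \<Rightarrow> ('x \<Rightarrow> complex)) set" where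
  "bounded_operators X = {T.
     (\<forall>f\<in>ell2 X. T f \<in> ell2 X) \<and> (\<forall>f. f \<notin> ell2 X \<longrightarrow> T f = (\<lambda>x. 0)) \<and>
     (\<forall>f\<in>ell2 X. \<forall>g\<in>ell2 X. T (\<lambda>x. f x + g x) = (\<lambda>x. T f x + T g x)) \<and>
     (\<forall>c. \<forall>f\<in>ell2 X. T (\<lambda>x. c * f x) = (\<lambda>x. c * T f x)) \<and>
     (\<exists>K. \<forall>f\<in>ell2 X. ell2_norm X (T f) \<le> K * ell2_norm X f)}"

definition op_norm :: "'x set \<Rightarrow> (('x \<Rightarrow> complex) \<Rightarrow> ('x \<Rightarrow> complex)) \<Rightarrow> real" where
  "op_norm X T = Sup {ell2_norm X (T f) | f. f \<in> ell2 X \<and> ell2_norm X f \<le> 1}"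

definition op_adjoint ::
  "'x set \<Rightarrow> (('x \<Rightarrow> complex) \<Rightarrow> ('x \<Rightarrow> complex)) \<Rightarrow> ('x \<Rightarrow> complex) \<Rightarrow> ('x \<Rightarrow> complex)" where
  "op_adjoint X T = (THE S. S \<in> bounded_operators X \<and>
     (\<forall>f\<in>ell2 X. \<forall>g\<in>ell2 X. ell2_inner X (T f) g = ell2_inner X f (S g)))"

definition operator_algebra :: "'x set \<Rightarrow> (('x \<Rightarrow> complex) \<Rightarrow> ('x \<Rightarrow> complex)) cstar" where
  "operator_algebra X =
     \<lparr>carrier = bounded_operators X,
      monoid.mult = (\<circ>),
      one = (\<lambda>f. if f \<in> ell2 X then f else (\<lambda>x. 0)),
      ring.zero = (\<lambda>f x. 0),
      add = (\<lambda>S T f x. S f x + T f x),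
      smult = (\<lambda>c T f x. c * T f x),
      star = op_adjoint X,
      nrm = op_norm X\<rparr>"

section \<open>The uniform Roe algebra\<close>

definition bounded_geometry :: "'x set \<Rightarrow> ('x \<Rightarrow> 'x \<Rightarrow> real) \<Rightarrow> bool" where
  "bounded_geometry X d \<longleftrightarrow>
     (\<forall>r. \<exists>N. \<forall>x\<in>X. finite (Metric_space.mcball X d x r) \<and> card (Metric_space.mcball X d x r) \<le> N)"

definition finite_propagation :: "'x set \<Rightarrow> ('x \<Rightarrow> 'x \<Rightarrow> real) \<Rightarrow> ('x \<Rightarrow> 'x \<Rightarrow> complex) set" where
  "finite_propagation X d = {\<alpha>.
     (\<exists>M\<ge>0. \<forall>x\<in>X. \<forall>y\<in>X. cmod (\<alpha> x y) \<le> M) \<and>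
     (\<exists>r>0. \<forall>x\<in>X. \<forall>y\<in>X. d x y > r \<longrightarrow> \<alpha> x y = 0)}"

definition matrix_operator ::
  "'x set \<Rightarrow> ('x \<Rightarrow> 'x \<Rightarrow> complex) \<Rightarrow> ('x \<Rightarrow> complex) \<Rightarrow> ('x \<Rightarrow> complex)" where
  "matrix_operator X \<alpha> f =
     (\<lambda>x. if f \<in> ell2 X \<and> x \<in> X then (\<Sum>\<^sub>\<infinity>y\<in>X. \<alpha> x y * f y) else 0)"

definition uniform_roe_algebra ::
  "'x set \<Rightarrow> ('x \<Rightarrow> 'x \<Rightarrow> real) \<Rightarrow> (('x \<Rightarrow> complex) \<Rightarrow> ('x \<Rightarrow> complex)) cstar" where
  "uniform_roe_algebra X d = (operator_algebra X)\<lparr>carrier :=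
     {T \<in> bounded_operators X. \<forall>e>0. \<exists>\<alpha>\<in>finite_propagation X d.
        op_norm X (\<lambda>f x. T f x - matrix_operator X \<alpha> f x) < e}\<rparr>"

section \<open>Asymptotic dimension\<close>

definition uniform_cover :: "'x set \<Rightarrow> ('x \<Rightarrow> 'x \<Rightarrow> real) \<Rightarrow> 'x set set \<Rightarrow> bool" where
  "uniform_cover X d \<U> \<longleftrightarrow> \<Union>\<U> = X \<and> (\<exists>R. \<forall>U\<in>\<U>. \<forall>x\<in>U. \<forall>y\<in>U. d x y \<le> R)"

definition cover_order_le :: "'x set set \<Rightarrow> nat \<Rightarrow> bool" where
  "cover_order_le \<U> n \<longleftrightarrow> (\<forall>\<W>. \<W> \<subseteq> \<U> \<and> finite \<W> \<and> card \<W> = n + 2 \<longrightarrow> \<Inter>\<W> = {})"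

definition asdim_le :: "'x set \<Rightarrow> ('x \<Rightarrow> 'x \<Rightarrow> real) \<Rightarrow> nat \<Rightarrow> bool" where
  "asdim_le X d n \<longleftrightarrow>
     (\<forall>\<U>. uniform_cover X d \<U> \<longrightarrow>
        (\<exists>\<V>. uniform_cover X d \<V> \<and> cover_order_le \<V> n \<and> (\<forall>U\<in>\<U>. \<exists>V\<in>\<V>. U \<subseteq> V)))"

definition asdim :: "'x set \<Rightarrow> ('x \<Rightarrow> 'x \<Rightarrow> real) \<Rightarrow> enat" where
  "asdim X d = Inf {enat n | n. asdim_le X d n}"

end

theory Submission
  imports Defs
begin

text \<open>
  Asymptotic dimension at most \<open>n\<close> yields functions \<open>h\<^sub>0, \<dots>, h\<^sub>n\<close> with \<open>\<Sum>\<^sub>i h\<^sub>i\<^sup>2 = 1\<close> that vary slowly at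
  scale \<open>R\<close> and whose supports split into uniformly bounded, \<open>R\<close>-separated blocks. If \<open>a\<close> has propagation
  at most \<open>R\<close>, then every \<open>h\<^sub>i a h\<^sub>i\<close> is block diagonal, and \<open>\<Sum>\<^sub>i h\<^sub>i a h\<^sub>i\<close>, whose entries are
  \<open>a x y \<Sum>\<^sub>i h\<^sub>i x h\<^sub>i y\<close>, is close to \<open>a\<close>. The blocks have bounded size, so up to a small error only
  finitely many matrices \<open>h\<^sub>i a h\<^sub>i\<close> occur on them. The map \<open>\<psi>\<close> compresses \<open>a\<close> to one representative
  block for each type, and \<open>\<phi>\<close> copies a matrix to all blocks of its type, which is a *-homomorphism on
  each colour.

  For \<open>\<psi>\<close>, complete positivity is the Cholesky factorisation of Gram matrices; for \<open>\<phi>\<close>, it requires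
  that sums of squares in matrix algebras over the uniform Roe algebra are again squares.
\<close>

section \<open>The Hilbert space of square-summable functions\<close>

text \<open>The obstacle is that the block diagonal operators of one colour form an infinite product
  of matrix algebras of bounded size, which is not finite-dimensional in general. A triple only has
  to serve a finite set \<open>G\<close> up to an error, so finitely many types of blocks suffice;
  in return \<psi> sees nothing but the representative blocks, and the triple depends on
  \<open>G\<close>.

  The weights enter as \<open>h i x * h i y\<close>, one factor on either side of the operator. This
  makes the cut-off completely positive and contractive, and it is why the squares of the functions
  sum to 1. Images of different colours overlap, so the sum over the colours is only bounded by
  \<open>n + 1\<close>; contractivity is asked for on each ideal alone, and the factor is absorbed
  by the tolerances.

  Positivity in \<open>mat_pos\<close> asks for one square factor of the same size with entries in
  the algebra itself, so factorisations have to stay inside the algebra: Schur complements keep the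
  blocks, and the square root over the uniform Roe algebra is a norm limit of polynomials.\<close>

lemma ell2_outside: "f \<in> ell2 X \<Longrightarrow> x \<notin> X \<Longrightarrow> f x = 0"
  by (simp add: ell2_def)

lemma ell2_summable: "f \<in> ell2 X \<Longrightarrow> (\<lambda>x. (cmod (f x))\<^sup>2) summable_on X"
  by (simp add: ell2_def)

lemma ell2_norm_nonneg [simp]: "0 \<le> ell2_norm X f"
  by (simp add: ell2_norm_def infsum_nonneg)

lemma ell2_norm_sq: "(ell2_norm X f)\<^sup>2 = (\<Sum>\<^sub>\<infinity>x\<in>X. (cmod (f x))\<^sup>2)"
  by (simp add: ell2_norm_def infsum_nonneg)

lemma ell2_finite_sum_le:
  assumes "f \<in> ell2 X" "finite Z" "Z \<subseteq> X"
  shows "(\<Sum>x\<in>Z. (cmod (f x))\<^sup>2) \<le> (ell2_norm X f)\<^sup>2"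
  unfolding ell2_norm_sq using assms by (intro finite_sum_le_infsum ell2_summable) auto

text \<open>Finite partial sums decide membership and norm together. Many vectors below (adjoints,
  images under matrices, limits) are only known through their coordinates, and this is how they are
  shown to be square-summable.\<close>

lemma ell2_fatou:
  assumes out: "\<And>x. x \<notin> X \<Longrightarrow> f x = 0"
    and le: "\<And>Z. finite Z \<Longrightarrow> Z \<subseteq> X \<Longrightarrow> (\<Sum>x\<in>Z. (cmod (f x))\<^sup>2) \<le> K\<^sup>2"
    and K: "0 \<le> K"
  shows "f \<in> ell2 X" "ell2_norm X f \<le> K"
proof -
  have s: "(\<lambda>x. (cmod (f x))\<^sup>2) summable_on X"
    by (rule nonneg_bounded_partial_sums_imp_summable_on[where C="K\<^sup>2"])
       (auto intro!: eventually_finite_subsets_at_top_weakI le)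
  show "f \<in> ell2 X" using s out by (simp add: ell2_def)
  have "(ell2_norm X f)\<^sup>2 \<le> K\<^sup>2"
    unfolding ell2_norm_sq by (rule infsum_le_finite_sums[OF s]) (use le in auto)
  then show "ell2_norm X f \<le> K" using K by (rule power2_le_imp_le)
qed

lemma ell2_norm_le_L2_set:
  "ell2_norm X f \<le> K \<Longrightarrow> f \<in> ell2 X \<Longrightarrow> finite Z \<Longrightarrow> Z \<subseteq> X \<Longrightarrow> L2_set (\<lambda>x. cmod (f x)) Z \<le> K"
  unfolding L2_set_def ell2_norm_def[symmetric]
  by (rule order_trans[OF real_sqrt_le_mono[OF ell2_finite_sum_le]]) auto

text \<open>The same criterion phrased with \<open>L2_set\<close>, so that the finite Minkowski
  inequality carries over to infinite sums.\<close>

lemma ell2_fatou_L2_set: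
  assumes out: "\<And>x. x \<notin> X \<Longrightarrow> f x = 0"
    and le: "\<And>Z. finite Z \<Longrightarrow> Z \<subseteq> X \<Longrightarrow> L2_set (\<lambda>x. cmod (f x)) Z \<le> K"
  shows "f \<in> ell2 X" "ell2_norm X f \<le> K"
proof -
  have K: "0 \<le> K" using le[of "{}"] by simp
  have *: "(\<Sum>x\<in>Z. (cmod (f x))\<^sup>2) \<le> K\<^sup>2" if "finite Z" "Z \<subseteq> X" for Z
    using power_mono[OF le[OF that], of 2] by (simp add: L2_set_def sum_nonneg)
  show "f \<in> ell2 X" "ell2_norm X f \<le> K" using ell2_fatou[OF out * K] by auto
qed

lemma ell2_zero [simp]: "(\<lambda>x. 0) \<in> ell2 X"
  by (simp add: ell2_def)

lemma ell2_norm_zero [simp]: "ell2_norm X (\<lambda>x. 0) = 0"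
  by (simp add: ell2_norm_def)

lemma
  assumes f: "f \<in> ell2 X" and g: "g \<in> ell2 X"
  shows ell2_add: "(\<lambda>x. f x + g x) \<in> ell2 X"
    and ell2_norm_triangle: "ell2_norm X (\<lambda>x. f x + g x) \<le> ell2_norm X f + ell2_norm X g"
proof -
  have "L2_set (\<lambda>x. cmod (f x + g x)) Z \<le> ell2_norm X f + ell2_norm X g" if "finite Z" "Z \<subseteq> X" for Z
  proof -
    have "L2_set (\<lambda>x. cmod (f x + g x)) Z \<le> L2_set (\<lambda>x. cmod (f x) + cmod (g x)) Z"
      by (rule L2_set_mono) (auto intro: norm_triangle_ineq)
    also have "\<dots> \<le> L2_set (\<lambda>x. cmod (f x)) Z + L2_set (\<lambda>x. cmod (g x)) Z"
      by (rule L2_set_triangle_ineq)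
    also have "\<dots> \<le> ell2_norm X f + ell2_norm X g"
      by (intro add_mono ell2_norm_le_L2_set[OF order_refl] f g that)
    finally show ?thesis .
  qed
  note le = this
  have out: "f x + g x = 0" if "x \<notin> X" for x
    using ell2_outside[OF f that] ell2_outside[OF g that] by simp
  show "(\<lambda>x. f x + g x) \<in> ell2 X" by (rule ell2_fatou_L2_set(1)[OF out le])
  show "ell2_norm X (\<lambda>x. f x + g x) \<le> ell2_norm X f + ell2_norm X g"
    by (rule ell2_fatou_L2_set(2)[OF out le])
qed

lemma ell2_smult: "f \<in> ell2 X \<Longrightarrow> (\<lambda>x. c * f x) \<in> ell2 X"
  by (simp add: ell2_def norm_mult power_mult_distrib summable_on_cmult_right)

lemma ell2_norm_smult: "ell2_norm X (\<lambda>x. c * f x) = cmod c * ell2_norm X f"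
  by (simp add: ell2_norm_def norm_mult power_mult_distrib infsum_cmult_right' real_sqrt_mult)

lemma ell2_norm_minus: "ell2_norm X (\<lambda>x. - f x) = ell2_norm X f"
  by (simp add: ell2_norm_def)

lemma ell2_norm_minus_commute: "ell2_norm X (\<lambda>x. f x - g x) = ell2_norm X (\<lambda>x. g x - f x)"
  by (simp add: ell2_norm_def norm_minus_commute)

lemma ell2_minus: "f \<in> ell2 X \<Longrightarrow> (\<lambda>x. - f x) \<in> ell2 X"
  by (simp add: ell2_def)

lemma ell2_diff: "f \<in> ell2 X \<Longrightarrow> g \<in> ell2 X \<Longrightarrow> (\<lambda>x. f x - g x) \<in> ell2 X"
  using ell2_add[OF _ ell2_minus, of f X g] by simp

lemma ell2_norm_triangle_diff:
  assumes "f \<in> ell2 X" "g \<in> ell2 X"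
  shows "ell2_norm X (\<lambda>x. f x - g x) \<le> ell2_norm X f + ell2_norm X g"
  using ell2_norm_triangle[OF assms(1) ell2_minus[OF assms(2)]] by (simp add: ell2_norm_minus)

lemma ell2_sum:
  "(\<And>i. i \<in> I \<Longrightarrow> f i \<in> ell2 X) \<Longrightarrow> (\<lambda>x. \<Sum>i\<in>I. f i x) \<in> ell2 X"
  by (induction I rule: infinite_finite_induct) (auto intro: ell2_add)

lemma ell2_norm_sum_le:
  "(\<And>i. i \<in> I \<Longrightarrow> f i \<in> ell2 X) \<Longrightarrow> ell2_norm X (\<lambda>x. \<Sum>i\<in>I. f i x) \<le> (\<Sum>i\<in>I. ell2_norm X (f i))"
proof (induction I rule: infinite_finite_induct)
  case (insert i I)
  then have "ell2_norm X (\<lambda>x. f i x + (\<Sum>i\<in>I. f i x)) \<le> ell2_norm X (f i) + ell2_norm X (\<lambda>x. \<Sum>i\<in>I. f i x)"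
    by (intro ell2_norm_triangle ell2_sum) auto
  with insert show ?case by force
qed auto

lemma ell2_norm_eq_0: "f \<in> ell2 X \<Longrightarrow> ell2_norm X f = 0 \<longleftrightarrow> f = (\<lambda>x. 0)"
proof
  assume f: "f \<in> ell2 X" and "ell2_norm X f = 0"
  then have "(\<Sum>x\<in>{y}. (cmod (f x))\<^sup>2) \<le> 0" if "y \<in> X" for y
    using ell2_finite_sum_le[OF f, of "{y}"] that by simp
  then show "f = (\<lambda>x. 0)" using ell2_outside[OF f] by (intro ext) force
qed simp

lemma ell2_coord_le: "f \<in> ell2 X \<Longrightarrow> cmod (f x) \<le> ell2_norm X f"
proof (cases "x \<in> X")
  case True
  assume f: "f \<in> ell2 X"
  show ?thesis using ell2_finite_sum_le[OF f, of "{x}"] True by (auto intro: power2_le_imp_le)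
qed (simp add: ell2_outside)

lemma ell2_mult_summable:
  assumes f: "f \<in> ell2 X" and g: "g \<in> ell2 X"
  shows "(\<lambda>x. norm (cnj (f x) * g x)) summable_on X"
proof (rule Infinite_Sum.abs_summable_on_comparison_test')
  show "(\<lambda>x. (cmod (f x))\<^sup>2 + (cmod (g x))\<^sup>2) summable_on X"
    by (intro summable_on_add ell2_summable f g)
  show "norm (cnj (f x) * g x) \<le> (cmod (f x))\<^sup>2 + (cmod (g x))\<^sup>2" for x
  proof -
    have "2 * (cmod (f x) * cmod (g x)) \<le> (cmod (f x))\<^sup>2 + (cmod (g x))\<^sup>2"
      using sum_squares_bound[of "cmod (f x)" "cmod (g x)"] by simp
    moreover have "0 \<le> cmod (f x) * cmod (g x)" by simp
    ultimately show ?thesis unfolding norm_mult complex_mod_cnj by linarith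
  qed
qed

lemmas ell2_mult_summable' = abs_summable_summable[OF ell2_mult_summable]

lemma ell2_inner_add_right:
  "f \<in> ell2 X \<Longrightarrow> g \<in> ell2 X \<Longrightarrow> h \<in> ell2 X \<Longrightarrow>
    ell2_inner X f (\<lambda>x. g x + h x) = ell2_inner X f g + ell2_inner X f h"
  unfolding ell2_inner_def by (simp add: distrib_left infsum_add ell2_mult_summable')

lemma ell2_inner_smult_right: "ell2_inner X f (\<lambda>x. c * g x) = c * ell2_inner X f g"
proof -
  have "ell2_inner X f (\<lambda>x. c * g x) = (\<Sum>\<^sub>\<infinity>x\<in>X. c * (cnj (f x) * g x))"
    unfolding ell2_inner_def by (intro infsum_cong) simp
  then show ?thesis unfolding ell2_inner_def by (simp add: infsum_cmult_right')
qed

lemma ell2_inner_commute: "ell2_inner X f g = cnj (ell2_inner X g f)"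
proof -
  have "cnj (ell2_inner X g f) = (\<Sum>\<^sub>\<infinity>x\<in>X. cnj (cnj (g x) * f x))"
    unfolding ell2_inner_def by (rule infsum_cnj[symmetric])
  then show ?thesis unfolding ell2_inner_def by (simp add: mult.commute)
qed

lemma ell2_inner_add_left:
  "f \<in> ell2 X \<Longrightarrow> g \<in> ell2 X \<Longrightarrow> h \<in> ell2 X \<Longrightarrow>
    ell2_inner X (\<lambda>x. g x + h x) f = ell2_inner X g f + ell2_inner X h f"
  using ell2_inner_add_right[of f X g h] by (metis ell2_inner_commute complex_cnj_add)

lemma ell2_inner_smult_left: "ell2_inner X (\<lambda>x. c * g x) f = cnj c * ell2_inner X g f"
  using ell2_inner_smult_right[of X f c g] by (metis ell2_inner_commute complex_cnj_mult)

lemma ell2_inner_zero [simp]: "ell2_inner X f (\<lambda>x. 0) = 0" "ell2_inner X (\<lambda>x. 0) f = 0"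
  by (simp_all add: ell2_inner_def)

lemma ell2_inner_diff_right:
  "f \<in> ell2 X \<Longrightarrow> g \<in> ell2 X \<Longrightarrow> h \<in> ell2 X \<Longrightarrow>
    ell2_inner X f (\<lambda>x. g x - h x) = ell2_inner X f g - ell2_inner X f h"
  using ell2_inner_add_right[of f X g "\<lambda>x. (-1) * h x"] ell2_inner_smult_right[of X f "-1" h]
  by (simp add: ell2_minus)

lemma ell2_inner_diff_left:
  "f \<in> ell2 X \<Longrightarrow> g \<in> ell2 X \<Longrightarrow> h \<in> ell2 X \<Longrightarrow>
    ell2_inner X (\<lambda>x. g x - h x) f = ell2_inner X g f - ell2_inner X h f"
  using ell2_inner_diff_right[of f X g h] by (metis ell2_inner_commute complex_cnj_diff)

lemma ell2_inner_sum_right: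
  "f \<in> ell2 X \<Longrightarrow> (\<And>i. i \<in> I \<Longrightarrow> g i \<in> ell2 X) \<Longrightarrow>
    ell2_inner X f (\<lambda>x. \<Sum>i\<in>I. g i x) = (\<Sum>i\<in>I. ell2_inner X f (g i))"
proof (induction I rule: infinite_finite_induct)
  case (insert i I)
  have "ell2_inner X f (\<lambda>x. g i x + (\<Sum>i\<in>I. g i x)) =
      ell2_inner X f (g i) + ell2_inner X f (\<lambda>x. \<Sum>i\<in>I. g i x)"
    by (intro ell2_inner_add_right ell2_sum) (use insert in auto)
  then show ?case using insert by auto
qed auto

lemma ell2_inner_sum_left:
  assumes "f \<in> ell2 X" "\<And>i. i \<in> I \<Longrightarrow> g i \<in> ell2 X"
  shows "ell2_inner X (\<lambda>x. \<Sum>i\<in>I. g i x) f = (\<Sum>i\<in>I. ell2_inner X (g i) f)"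
proof -
  have "ell2_inner X (\<lambda>x. \<Sum>i\<in>I. g i x) f = cnj (\<Sum>i\<in>I. ell2_inner X f (g i))"
    by (subst ell2_inner_commute, subst ell2_inner_sum_right) (use assms in auto)
  also have "\<dots> = (\<Sum>i\<in>I. ell2_inner X (g i) f)"
    by (subst cnj_sum) (simp add: ell2_inner_commute[symmetric])
  finally show ?thesis .
qed

lemma ell2_inner_self: "f \<in> ell2 X \<Longrightarrow> ell2_inner X f f = complex_of_real ((ell2_norm X f)\<^sup>2)"
proof -
  assume f: "f \<in> ell2 X"
  have "cnj (f x) * f x = complex_of_real ((cmod (f x))\<^sup>2)" for x
    using complex_norm_square[of "f x"] by (simp add: mult.commute)
  then have "ell2_inner X f f = (\<Sum>\<^sub>\<infinity>x\<in>X. complex_of_real ((cmod (f x))\<^sup>2))"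
    unfolding ell2_inner_def by (simp only:)
  also have "\<dots> = complex_of_real ((ell2_norm X f)\<^sup>2)"
    unfolding ell2_norm_sq
    by (intro infsumI has_sum_of_real has_sum_infsum ell2_summable f)
  finally show ?thesis .
qed

lemma ell2_cauchy_schwarz:
  assumes f: "f \<in> ell2 X" and g: "g \<in> ell2 X"
  shows "cmod (ell2_inner X f g) \<le> ell2_norm X f * ell2_norm X g"
proof -
  have s: "(\<lambda>x. cmod (cnj (f x) * g x)) summable_on X"
    by (rule ell2_mult_summable[OF f g])
  have "cmod (ell2_inner X f g) \<le> (\<Sum>\<^sub>\<infinity>x\<in>X. cmod (cnj (f x) * g x))"
    unfolding ell2_inner_def by (rule norm_infsum_bound[OF s])
  also have "\<dots> \<le> ell2_norm X f * ell2_norm X g"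
  proof (rule infsum_le_finite_sums[OF s])
    fix Z assume Z: "finite Z" "Z \<subseteq> X"
    have "(\<Sum>x\<in>Z. cmod (cnj (f x) * g x)) = (\<Sum>x\<in>Z. \<bar>cmod (f x)\<bar> * \<bar>cmod (g x)\<bar>)"
      by (simp add: norm_mult)
    also have "\<dots> \<le> L2_set (\<lambda>x. cmod (f x)) Z * L2_set (\<lambda>x. cmod (g x)) Z"
      by (rule L2_set_mult_ineq)
    also have "\<dots> \<le> ell2_norm X f * ell2_norm X g"
      by (intro mult_mono ell2_norm_le_L2_set[OF order_refl] f g Z) auto
    finally show "(\<Sum>x\<in>Z. cmod (cnj (f x) * g x)) \<le> ell2_norm X f * ell2_norm X g" .
  qed
  finally show ?thesis .
qed

section \<open>Basis vectors and finitely supported vectors\<close>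

definition delta :: "'x \<Rightarrow> 'x \<Rightarrow> complex" where
  "delta y = (\<lambda>x. if x = y then 1 else 0)"

definition restr :: "'x set \<Rightarrow> ('x \<Rightarrow> complex) \<Rightarrow> 'x \<Rightarrow> complex" where
  "restr Z f = (\<lambda>x. if x \<in> Z then f x else 0)"

lemma ell2_finite_support:
  assumes "finite Z" "Z \<subseteq> X" "\<And>x. x \<notin> Z \<Longrightarrow> f x = 0"
  shows "f \<in> ell2 X" "(ell2_norm X f)\<^sup>2 = (\<Sum>x\<in>Z. (cmod (f x))\<^sup>2)"
    and "ell2_inner X f g = (\<Sum>x\<in>Z. cnj (f x) * g x)"
    and "ell2_inner X g f = (\<Sum>x\<in>Z. cnj (g x) * f x)"
proof -
  have "((\<lambda>x. (cmod (f x))\<^sup>2) has_sum (\<Sum>x\<in>Z. (cmod (f x))\<^sup>2)) X"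
    by (rule has_sum_finite_neutralI) (use assms in auto)
  then show "f \<in> ell2 X" "(ell2_norm X f)\<^sup>2 = (\<Sum>x\<in>Z. (cmod (f x))\<^sup>2)"
    using assms unfolding ell2_norm_sq
    by (auto simp: ell2_def has_sum_imp_summable infsumI)
  show "ell2_inner X f g = (\<Sum>x\<in>Z. cnj (f x) * g x)"
    unfolding ell2_inner_def
    by (rule infsumI, rule has_sum_finite_neutralI) (use assms in auto)
  show "ell2_inner X g f = (\<Sum>x\<in>Z. cnj (g x) * f x)"
    unfolding ell2_inner_def
    by (rule infsumI, rule has_sum_finite_neutralI) (use assms in auto)
qed

lemma delta_ell2 [simp]: "y \<in> X \<Longrightarrow> delta y \<in> ell2 X"
  by (rule ell2_finite_support(1)[of "{y}"]) (auto simp: delta_def)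

lemma delta_norm [simp]: "y \<in> X \<Longrightarrow> ell2_norm X (delta y) = 1"
proof -
  assume "y \<in> X"
  then have "(ell2_norm X (delta y))\<^sup>2 = 1"
    by (subst ell2_finite_support(2)[of "{y}"]) (auto simp: delta_def)
  then show ?thesis using ell2_norm_nonneg[of X "delta y"] by (auto simp: power2_eq_1_iff)
qed

lemma inner_delta_left: "y \<in> X \<Longrightarrow> ell2_inner X (delta y) f = f y"
  by (subst ell2_finite_support(3)[of "{y}"]) (auto simp: delta_def)

lemma inner_delta_right: "y \<in> X \<Longrightarrow> ell2_inner X f (delta y) = cnj (f y)"
  by (subst ell2_finite_support(4)[of "{y}"]) (auto simp: delta_def)

lemma restr_ell2: "finite Z \<Longrightarrow> Z \<subseteq> X \<Longrightarrow> restr Z f \<in> ell2 X"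
  by (rule ell2_finite_support(1)[of Z]) (auto simp: restr_def)

lemma restr_norm: "finite Z \<Longrightarrow> Z \<subseteq> X \<Longrightarrow> (ell2_norm X (restr Z f))\<^sup>2 = (\<Sum>x\<in>Z. (cmod (f x))\<^sup>2)"
  by (subst ell2_finite_support(2)[of Z]) (auto simp: restr_def)

lemma restr_eq_sum_delta: "finite Z \<Longrightarrow> restr Z f = (\<lambda>x. \<Sum>y\<in>Z. f y * delta y x)"
  by (rule ext) (simp add: restr_def delta_def if_distrib[of "(*) _"] sum.delta' cong: if_cong)

text \<open>Density of the finitely supported vectors: a finite set almost exhausts the squared
  norm, and what lies outside it is the squared norm of the difference.\<close>

lemma ell2_approx:
  assumes f: "f \<in> ell2 X" and e: "e > 0"
  obtains Z where "finite Z" "Z \<subseteq> X" "ell2_norm X (\<lambda>x. f x - restr Z f x) < e"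
proof -
  let ?q = "\<lambda>x. (cmod (f x))\<^sup>2"
  have "(?q has_sum (ell2_norm X f)\<^sup>2) X"
    unfolding ell2_norm_sq by (rule has_sum_infsum[OF ell2_summable[OF f]])
  then obtain Z where Z: "finite Z" "Z \<subseteq> X" "dist (sum ?q Z) ((ell2_norm X f)\<^sup>2) \<le> (e/2)\<^sup>2"
    using has_sum_finite_approximation[of ?q X _ "(e/2)\<^sup>2"] e by auto
  have "ell2_norm X (\<lambda>x. f x - restr Z f x) \<le> e/2"
  proof (rule ell2_fatou(2))
    fix x assume "x \<notin> X" then show "f x - restr Z f x = 0"
      using ell2_outside[OF f] Z by (auto simp: restr_def)
  next
    fix W assume W: "finite W" "W \<subseteq> X"
    have "(\<Sum>x\<in>W. (cmod (f x - restr Z f x))\<^sup>2) = (\<Sum>x\<in>W - Z. ?q x)"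
      by (rule sum.mono_neutral_cong_right) (use W in \<open>auto simp: restr_def\<close>)
    also have "\<dots> = sum ?q (Z \<union> (W - Z)) - sum ?q Z"
      using W Z by (subst sum.union_disjoint) auto
    also have "\<dots> \<le> (ell2_norm X f)\<^sup>2 - sum ?q Z"
      using ell2_finite_sum_le[OF f, of "Z \<union> (W - Z)"] W Z by auto
    also have "\<dots> \<le> (e/2)\<^sup>2" using Z(3) by (auto simp: dist_real_def)
    finally show "(\<Sum>x\<in>W. (cmod (f x - restr Z f x))\<^sup>2) \<le> (e/2)\<^sup>2" .
  qed (use e in auto)
  then show ?thesis using Z e by (intro that) auto
qed

section \<open>Bounded operators\<close>

lemma bop_ell2: "T \<in> bounded_operators X \<Longrightarrow> f \<in> ell2 X \<Longrightarrow> T f \<in> ell2 X"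
  and bop_outside: "T \<in> bounded_operators X \<Longrightarrow> f \<notin> ell2 X \<Longrightarrow> T f = (\<lambda>x. 0)"
  and bop_add: "T \<in> bounded_operators X \<Longrightarrow> f \<in> ell2 X \<Longrightarrow> g \<in> ell2 X \<Longrightarrow>
    T (\<lambda>x. f x + g x) = (\<lambda>x. T f x + T g x)"
  and bop_smult: "T \<in> bounded_operators X \<Longrightarrow> f \<in> ell2 X \<Longrightarrow> T (\<lambda>x. c * f x) = (\<lambda>x. c * T f x)"
  by (auto simp: bounded_operators_def)

lemma bop_zero: "T \<in> bounded_operators X \<Longrightarrow> T (\<lambda>x. 0) = (\<lambda>x. 0)"
  using bop_smult[of T X "\<lambda>x. 0" 0] by simp

lemma bop_diff: "T \<in> bounded_operators X \<Longrightarrow> f \<in> ell2 X \<Longrightarrow> g \<in> ell2 X \<Longrightarrow>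
    T (\<lambda>x. f x - g x) = (\<lambda>x. T f x - T g x)"
  using bop_add[of T X f "\<lambda>x. (-1) * g x"] bop_smult[of T X g "-1"] ell2_smult[of g X "-1"]
  by simp

lemma bop_sum: "T \<in> bounded_operators X \<Longrightarrow> (\<And>i. i \<in> I \<Longrightarrow> f i \<in> ell2 X) \<Longrightarrow>
    T (\<lambda>x. \<Sum>i\<in>I. f i x) = (\<lambda>x. \<Sum>i\<in>I. T (f i) x)"
proof (induction I rule: infinite_finite_induct)
  case (insert i I)
  then show ?case using bop_add[of T X "f i" "\<lambda>x. \<Sum>i\<in>I. f i x"] by (auto simp: ell2_sum)
qed (auto simp: bop_zero)

lemma op_norm_bdd:
  assumes "T \<in> bounded_operators X"
  shows "bdd_above {ell2_norm X (T f) | f. f \<in> ell2 X \<and> ell2_norm X f \<le> 1}"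
proof -
  obtain K where K: "\<And>f. f \<in> ell2 X \<Longrightarrow> ell2_norm X (T f) \<le> K * ell2_norm X f"
    using assms unfolding bounded_operators_def by blast
  \<comment> \<open>The bound \<open>K\<close> provided by the definition need not be nonnegative,
    hence the absolute value.\<close>
  have "ell2_norm X (T f) \<le> \<bar>K\<bar>" if "f \<in> ell2 X" "ell2_norm X f \<le> 1" for f
  proof -
    have "K * ell2_norm X f \<le> \<bar>K\<bar> * 1" by (rule mult_mono) (use that in auto)
    then show ?thesis using K[OF that(1)] by simp
  qed
  then show ?thesis by (auto intro!: bdd_aboveI)
qed

lemma op_norm_nonneg: "T \<in> bounded_operators X \<Longrightarrow> 0 \<le> op_norm X T"
proof -
  assume T: "T \<in> bounded_operators X"
  have "ell2_norm X (T (\<lambda>x. 0)) \<le> op_norm X T" unfolding op_norm_def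
    by (rule cSup_upper[OF _ op_norm_bdd[OF T]]) (auto intro!: exI[of _ "\<lambda>x. 0"])
  then show ?thesis by (simp add: bop_zero[OF T])
qed

lemma op_norm_bound:
  assumes T: "T \<in> bounded_operators X" and f: "f \<in> ell2 X"
  shows "ell2_norm X (T f) \<le> op_norm X T * ell2_norm X f"
proof (cases "ell2_norm X f = 0")
  case True
  then have "f = (\<lambda>x. 0)" using ell2_norm_eq_0[OF f] by simp
  then show ?thesis by (simp add: bop_zero[OF T])
next
  case False
  let ?c = "complex_of_real (1 / ell2_norm X f)"
  have c: "cmod ?c = 1 / ell2_norm X f" by (simp add: norm_divide)
  have "ell2_norm X (T (\<lambda>x. ?c * f x)) \<le> op_norm X T" unfolding op_norm_def
    by (rule cSup_upper[OF _ op_norm_bdd[OF T]])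
       (use False ell2_smult[OF f] in \<open>auto intro!: exI[of _ "\<lambda>x. ?c * f x"] simp del: of_real_divide simp: ell2_norm_smult c\<close>)
  also have "ell2_norm X (T (\<lambda>x. ?c * f x)) = ell2_norm X (T f) / ell2_norm X f"
    by (simp only: bop_smult[OF T f] ell2_norm_smult c) simp
  finally show ?thesis using False ell2_norm_nonneg[of X f] by (simp add: divide_le_eq less_le)
qed

lemma op_norm_le:
  assumes "\<And>f. f \<in> ell2 X \<Longrightarrow> ell2_norm X (T f) \<le> K * ell2_norm X f" "0 \<le> K"
  shows "op_norm X T \<le> K"
  unfolding op_norm_def
proof (rule cSup_least)
  show "{ell2_norm X (T f) |f. f \<in> ell2 X \<and> ell2_norm X f \<le> 1} \<noteq> {}"
    by (auto intro!: exI[of _ "\<lambda>x. 0"])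
  fix k assume "k \<in> {ell2_norm X (T f) |f. f \<in> ell2 X \<and> ell2_norm X f \<le> 1}"
  then obtain f where f: "k = ell2_norm X (T f)" "f \<in> ell2 X" "ell2_norm X f \<le> 1" by auto
  have "K * ell2_norm X f \<le> K * 1" by (rule mult_left_mono) (use f assms in auto)
  then show "k \<le> K" using f assms(1)[OF f(2)] by simp
qed

lemma bounded_operatorsI:
  assumes "\<And>f. f \<in> ell2 X \<Longrightarrow> T f \<in> ell2 X"
    and "\<And>f. f \<notin> ell2 X \<Longrightarrow> T f = (\<lambda>x. 0)"
    and "\<And>f g. f \<in> ell2 X \<Longrightarrow> g \<in> ell2 X \<Longrightarrow> T (\<lambda>x. f x + g x) = (\<lambda>x. T f x + T g x)"
    and "\<And>c f. f \<in> ell2 X \<Longrightarrow> T (\<lambda>x. c * f x) = (\<lambda>x. c * T f x)"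
    and "\<And>f. f \<in> ell2 X \<Longrightarrow> ell2_norm X (T f) \<le> K * ell2_norm X f"
  shows "T \<in> bounded_operators X"
  unfolding bounded_operators_def using assms by blast

lemma
  assumes S: "S \<in> bounded_operators X" and T: "T \<in> bounded_operators X"
  shows bop_plus: "(\<lambda>f x. S f x + T f x) \<in> bounded_operators X"
    and op_norm_plus: "op_norm X (\<lambda>f x. S f x + T f x) \<le> op_norm X S + op_norm X T"
proof -
  have *: "ell2_norm X (\<lambda>x. S f x + T f x) \<le> (op_norm X S + op_norm X T) * ell2_norm X f"
    if f: "f \<in> ell2 X" for f
    using ell2_norm_triangle[OF bop_ell2[OF S f] bop_ell2[OF T f]] op_norm_bound[OF S f]
      op_norm_bound[OF T f] by (simp add: distrib_right)
  show "(\<lambda>f x. S f x + T f x) \<in> bounded_operators X"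
    by (rule bounded_operatorsI[OF _ _ _ _ *])
       (simp_all add: ell2_add bop_ell2[OF S] bop_ell2[OF T] bop_outside[OF S] bop_outside[OF T]
         bop_add[OF S] bop_add[OF T] bop_smult[OF S] bop_smult[OF T] distrib_left add_ac)
  show "op_norm X (\<lambda>f x. S f x + T f x) \<le> op_norm X S + op_norm X T"
    by (rule op_norm_le[OF *]) (simp_all add: op_norm_nonneg[OF S] op_norm_nonneg[OF T])
qed

lemma
  assumes T: "T \<in> bounded_operators X"
  shows bop_scale: "(\<lambda>f x. c * T f x) \<in> bounded_operators X"
    and op_norm_scale_le: "op_norm X (\<lambda>f x. c * T f x) \<le> cmod c * op_norm X T"
proof -
  have *: "ell2_norm X (\<lambda>x. c * T f x) \<le> (cmod c * op_norm X T) * ell2_norm X f"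
    if f: "f \<in> ell2 X" for f
    unfolding ell2_norm_smult using mult_left_mono[OF op_norm_bound[OF T f], of "cmod c"]
    by (simp add: mult.assoc)
  show "(\<lambda>f x. c * T f x) \<in> bounded_operators X"
    by (rule bounded_operatorsI[OF _ _ _ _ *])
       (simp_all add: ell2_smult bop_ell2[OF T] bop_outside[OF T]
         bop_add[OF T] bop_smult[OF T] distrib_left ac_simps)
  show "op_norm X (\<lambda>f x. c * T f x) \<le> cmod c * op_norm X T"
    by (rule op_norm_le[OF *]) (simp_all add: op_norm_nonneg[OF T])
qed

lemma bop_uminus: "T \<in> bounded_operators X \<Longrightarrow> (\<lambda>f x. - T f x) \<in> bounded_operators X"
  using bop_scale[of T X "-1"] by simp

lemma bop_minus:
  "S \<in> bounded_operators X \<Longrightarrow> T \<in> bounded_operators X \<Longrightarrow> (\<lambda>f x. S f x - T f x) \<in> bounded_operators X"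
  using bop_plus[OF _ bop_uminus, of S X T] by simp

lemma op_norm_minus_commute: "op_norm X (\<lambda>f x. S f x - T f x) = op_norm X (\<lambda>f x. T f x - S f x)"
  unfolding op_norm_def by (subst ell2_norm_minus_commute) simp

lemma op_norm_scale:
  assumes T: "T \<in> bounded_operators X"
  shows "op_norm X (\<lambda>f x. c * T f x) = cmod c * op_norm X T"
proof (cases "c = 0")
  case True
  have "op_norm X (\<lambda>f x. c * T f x) \<le> 0" using op_norm_scale_le[OF T, of c] True by simp
  then show ?thesis using op_norm_nonneg[OF bop_scale[OF T], of c] True by simp
next
  case False
  have "op_norm X (\<lambda>f x. inverse c * (c * T f x)) \<le> cmod (inverse c) * op_norm X (\<lambda>f x. c * T f x)"
    by (rule op_norm_scale_le[OF bop_scale[OF T]])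
  then have "cmod c * op_norm X T \<le> op_norm X (\<lambda>f x. c * T f x)"
    using False by (simp add: mult.assoc[symmetric] norm_divide inverse_eq_divide pos_le_divide_eq mult.commute)
  then show ?thesis using op_norm_scale_le[OF T, of c] by simp
qed

lemma
  assumes S: "S \<in> bounded_operators X" and T: "T \<in> bounded_operators X"
  shows bop_comp: "S \<circ> T \<in> bounded_operators X"
    and op_norm_comp: "op_norm X (S \<circ> T) \<le> op_norm X S * op_norm X T"
proof -
  have *: "ell2_norm X ((S \<circ> T) f) \<le> (op_norm X S * op_norm X T) * ell2_norm X f"
    if f: "f \<in> ell2 X" for f
    using op_norm_bound[OF S bop_ell2[OF T f]]
      mult_left_mono[OF op_norm_bound[OF T f] op_norm_nonneg[OF S]] by (simp add: mult.assoc)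
  show "S \<circ> T \<in> bounded_operators X"
    by (rule bounded_operatorsI[OF _ _ _ _ *])
       (simp_all add: bop_ell2[OF S] bop_ell2[OF T] bop_outside[OF S] bop_outside[OF T]
         bop_add[OF S] bop_add[OF T] bop_smult[OF S] bop_smult[OF T] bop_zero[OF S])
  show "op_norm X (S \<circ> T) \<le> op_norm X S * op_norm X T"
    by (rule op_norm_le[OF *]) (simp_all add: op_norm_nonneg[OF S] op_norm_nonneg[OF T])
qed

lemma bop_0: "(\<lambda>f x. 0) \<in> bounded_operators X"
  by (rule bounded_operatorsI[where K=0]) auto

lemma bop_id: "(\<lambda>f. if f \<in> ell2 X then f else (\<lambda>x. 0)) \<in> bounded_operators X"
  by (rule bounded_operatorsI[where K=1]) (auto simp: ell2_add ell2_smult)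

lemma op_norm_0 [simp]: "op_norm X (\<lambda>f x. 0) = 0"
  using op_norm_le[of X "\<lambda>f x. 0" 0] op_norm_nonneg[OF bop_0, of X] by simp

lemma op_norm_eq_0: "T \<in> bounded_operators X \<Longrightarrow> op_norm X T = 0 \<longleftrightarrow> T = (\<lambda>f x. 0)"
proof
  assume T: "T \<in> bounded_operators X" and 0: "op_norm X T = 0"
  show "T = (\<lambda>f x. 0)"
  proof
    fix f show "T f = (\<lambda>x. 0)"
    proof (cases "f \<in> ell2 X")
      case True
      then have "ell2_norm X (T f) \<le> 0" using op_norm_bound[OF T True] 0 by simp
      then show ?thesis using ell2_norm_eq_0[OF bop_ell2[OF T True]] ell2_norm_nonneg[of X "T f"] by simp
    qed (simp add: bop_outside[OF T])
  qed
qed simp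

lemma bop_sum_ops: "(\<And>i. i \<in> I \<Longrightarrow> T i \<in> bounded_operators X) \<Longrightarrow>
    (\<lambda>f x. \<Sum>i\<in>I. T i f x) \<in> bounded_operators X"
  by (induction I rule: infinite_finite_induct) (simp_all add: bop_plus bop_0)

lemma op_norm_sum: "(\<And>i. i \<in> I \<Longrightarrow> T i \<in> bounded_operators X) \<Longrightarrow>
    op_norm X (\<lambda>f x. \<Sum>i\<in>I. T i f x) \<le> (\<Sum>i\<in>I. op_norm X (T i))"
proof (induction I rule: infinite_finite_induct)
  case (insert i I)
  have "op_norm X (\<lambda>f x. T i f x + (\<Sum>i\<in>I. T i f x)) \<le> op_norm X (T i) + op_norm X (\<lambda>f x. \<Sum>i\<in>I. T i f x)"
    by (rule op_norm_plus) (simp_all add: insert bop_sum_ops)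
  moreover have "op_norm X (\<lambda>f x. \<Sum>i\<in>I. T i f x) \<le> (\<Sum>i\<in>I. op_norm X (T i))"
    using insert by simp
  ultimately show ?case using insert(1,2) by simp
qed auto

text \<open>An operator vanishing on all basis vectors vanishes on finitely supported vectors by
  linearity and everywhere by continuity. This turns identities between operators into identities
  between matrix entries; outside \<open>ell2 X\<close> both sides are 0 by convention.\<close>

lemma bop_eqI:
  assumes S: "S \<in> bounded_operators X" and T: "T \<in> bounded_operators X"
    and eq: "\<And>x y. x \<in> X \<Longrightarrow> y \<in> X \<Longrightarrow> S (delta y) x = T (delta y) x"
  shows "S = T"
proof -
  define D where "D = (\<lambda>f x. S f x - T f x)"
  have D: "D \<in> bounded_operators X" unfolding D_def by (rule bop_minus[OF S T])
  have Dd: "D (delta y) = (\<lambda>x. 0)" if "y \<in> X" for y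
  proof
    fix x show "D (delta y) x = 0"
    proof (cases "x \<in> X")
      case False
      then show ?thesis using ell2_outside[OF bop_ell2[OF D delta_ell2[OF that]]] by simp
    qed (simp add: D_def eq that)
  qed
  have Dr: "D (restr Z f) = (\<lambda>x. 0)" if "finite Z" "Z \<subseteq> X" for Z f
  proof -
    have y: "y \<in> X" if "y \<in> Z" for y using \<open>Z \<subseteq> X\<close> that by blast
    have "D (restr Z f) = (\<lambda>x. \<Sum>y\<in>Z. D (\<lambda>x. f y * delta y x) x)"
      unfolding restr_eq_sum_delta[OF that(1)]
      by (rule bop_sum[OF D]) (rule ell2_smult[OF delta_ell2[OF y]])
    also have "\<dots> = (\<lambda>x. 0)"
      by (intro ext sum.neutral ballI) (simp add: bop_smult[OF D] y Dd)
    finally show ?thesis .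
  qed
  have D0: "D f = (\<lambda>x. 0)" if f: "f \<in> ell2 X" for f
  proof -
    have "ell2_norm X (D f) \<le> e" if e: "e > 0" for e
    proof -
      have K: "0 \<le> op_norm X D" by (rule op_norm_nonneg[OF D])
      \<comment> \<open>As \<open>D\<close> kills the truncation, \<open>D f\<close> equals
        \<open>D\<close> of the remainder. The summand 1 keeps the quotient meaningful when
        \<open>D\<close> has norm 0.\<close>
      obtain Z where Z: "finite Z" "Z \<subseteq> X" "ell2_norm X (\<lambda>x. f x - restr Z f x) < e / (op_norm X D + 1)"
        using ell2_approx[OF f, of "e / (op_norm X D + 1)"] e K by auto
      have "D (\<lambda>x. f x - restr Z f x) = D f"
        using bop_diff[OF D f restr_ell2[OF Z(1,2)], of f] Dr[OF Z(1,2)] by simp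
      then have "ell2_norm X (D f) \<le> op_norm X D * ell2_norm X (\<lambda>x. f x - restr Z f x)"
        using op_norm_bound[OF D ell2_diff[OF f restr_ell2[OF Z(1,2)]], of f] by simp
      also have "\<dots> \<le> (op_norm X D + 1) * (e / (op_norm X D + 1))"
        by (intro mult_mono) (use Z K in auto)
      also have "\<dots> = e" using K by simp
      finally show ?thesis .
    qed
    then have "ell2_norm X (D f) \<le> 0" by (rule field_le_epsilon) simp
    then show ?thesis using ell2_norm_eq_0[OF bop_ell2[OF D f]] ell2_norm_nonneg[of X "D f"] by simp
  qed
  have *: "S f x - T f x = 0" if "f \<in> ell2 X" for f x
    using fun_cong[OF D0[OF that], of x] unfolding D_def .
  show "S = T"
  proof (intro ext)
    fix f x show "S f x = T f x"
    proof (cases "f \<in> ell2 X")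
      case True
      then show ?thesis using *[of f x] by simp
    next
      case False
      then show ?thesis by (simp add: bop_outside[OF S False] bop_outside[OF T False])
    qed
  qed
qed

subsection \<open>Adjoints\<close>

text \<open>Coordinates of the adjoint read off from the basis vectors: the value at
  \<open>y\<close> has to be the inner product of \<open>delta y\<close> with it. This explicit
  candidate shows that the description defining \<open>op_adjoint\<close> denotes.\<close>

definition adj :: "'x set \<Rightarrow> (('x \<Rightarrow> complex) \<Rightarrow> ('x \<Rightarrow> complex)) \<Rightarrow> ('x \<Rightarrow> complex) \<Rightarrow> ('x \<Rightarrow> complex)" where
  "adj X T = (\<lambda>g y. if g \<in> ell2 X \<and> y \<in> X then ell2_inner X (T (delta y)) g else 0)"

lemma adj_inner_restr:
  assumes T: "T \<in> bounded_operators X" and g: "g \<in> ell2 X" and Z: "finite Z" "Z \<subseteq> X"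
  shows "ell2_inner X (T (restr Z f)) g = ell2_inner X (restr Z f) (adj X T g)"
proof -
  have y: "y \<in> X" if "y \<in> Z" for y using Z that by blast
  have "T (restr Z f) = (\<lambda>x. \<Sum>y\<in>Z. T (\<lambda>x. f y * delta y x) x)"
    unfolding restr_eq_sum_delta[OF Z(1)]
    by (rule bop_sum[OF T]) (rule ell2_smult[OF delta_ell2[OF y]])
  then have *: "T (restr Z f) = (\<lambda>x. \<Sum>y\<in>Z. f y * T (delta y) x)"
    by (simp add: bop_smult[OF T delta_ell2] y cong: sum.cong)
  have "ell2_inner X (T (restr Z f)) g = (\<Sum>y\<in>Z. ell2_inner X (\<lambda>x. f y * T (delta y) x) g)"
    unfolding * by (rule ell2_inner_sum_left[OF g]) (rule ell2_smult[OF bop_ell2[OF T delta_ell2[OF y]]])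
  also have "\<dots> = (\<Sum>y\<in>Z. cnj (f y) * adj X T g y)"
    by (intro sum.cong refl) (simp add: ell2_inner_smult_left adj_def g y)
  also have "\<dots> = ell2_inner X (restr Z f) (adj X T g)"
    by (subst ell2_finite_support(3)[OF Z]) (auto simp: restr_def)
  finally show ?thesis .
qed

text \<open>Testing against the truncation \<open>c\<close> of the candidate to a finite set gives
  \<open>||c||^2 = <T c, g>\<close>, which is at most \<open>||T|| ||c|| ||g||\<close>; cancelling
  one factor bounds all finite partial sums.\<close>

lemma
  assumes T: "T \<in> bounded_operators X" and g: "g \<in> ell2 X"
  shows adj_ell2: "adj X T g \<in> ell2 X"
    and adj_norm_le: "ell2_norm X (adj X T g) \<le> op_norm X T * ell2_norm X g"
proof -
  let ?K = "op_norm X T * ell2_norm X g"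
  have K: "0 \<le> ?K" by (simp add: op_norm_nonneg[OF T])
  have out: "adj X T g x = 0" if "x \<notin> X" for x using that by (simp add: adj_def)
  have le: "(\<Sum>x\<in>Z. (cmod (adj X T g x))\<^sup>2) \<le> ?K\<^sup>2" if Z: "finite Z" "Z \<subseteq> X" for Z
  proof -
    define c where "c = restr Z (adj X T g)"
    have c: "c \<in> ell2 X" "(ell2_norm X c)\<^sup>2 = (\<Sum>x\<in>Z. (cmod (adj X T g x))\<^sup>2)"
      unfolding c_def by (rule restr_ell2[OF Z], rule restr_norm[OF Z])
    have "ell2_inner X (T c) g = (\<Sum>x\<in>Z. cnj (c x) * adj X T g x)"
      unfolding c_def adj_inner_restr[OF T g Z]
      by (rule ell2_finite_support(3)[OF Z]) (simp add: restr_def)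
    also have "\<dots> = (\<Sum>x\<in>Z. complex_of_real ((cmod (adj X T g x))\<^sup>2))"
      by (intro sum.cong refl) (simp add: c_def restr_def complex_norm_square mult.commute del: of_real_power)
    also have "\<dots> = complex_of_real ((ell2_norm X c)\<^sup>2)" by (simp only: c(2) of_real_sum)
    finally have "(ell2_norm X c)\<^sup>2 = cmod (ell2_inner X (T c) g)"
      by (simp only: norm_of_real) simp
    also have "\<dots> \<le> ell2_norm X (T c) * ell2_norm X g"
      by (rule ell2_cauchy_schwarz[OF bop_ell2[OF T c(1)] g])
    also have "\<dots> \<le> (op_norm X T * ell2_norm X c) * ell2_norm X g"
      by (rule mult_right_mono[OF op_norm_bound[OF T c(1)]]) simp
    finally have "ell2_norm X c * ell2_norm X c \<le> ?K * ell2_norm X c"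
      by (simp add: power2_eq_square ac_simps)
    then have "ell2_norm X c \<le> ?K"
      using K ell2_norm_nonneg[of X c] by (cases "ell2_norm X c = 0") (auto simp: less_le)
    then show ?thesis unfolding c(2)[symmetric] by (rule power_mono) simp
  qed
  show "adj X T g \<in> ell2 X" "ell2_norm X (adj X T g) \<le> ?K"
    by (rule ell2_fatou[OF out le K]; assumption)+
qed

text \<open>Both sides are continuous in \<open>f\<close> and agree on truncations by
  \<open>adj_inner_restr\<close>; \<open>?C\<close> collects the constants of the two continuity
  estimates.\<close>

lemma adj_inner:
  assumes T: "T \<in> bounded_operators X" and f: "f \<in> ell2 X" and g: "g \<in> ell2 X"
  shows "ell2_inner X (T f) g = ell2_inner X f (adj X T g)"
proof -
  let ?C = "op_norm X T * ell2_norm X g + ell2_norm X (adj X T g) + 1"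
  have C: "0 < ?C" by (simp add: add_nonneg_pos op_norm_nonneg[OF T])
  have "cmod (ell2_inner X (T f) g - ell2_inner X f (adj X T g)) \<le> e" if e: "e > 0" for e
  proof -
    obtain Z where Z: "finite Z" "Z \<subseteq> X" "ell2_norm X (\<lambda>x. f x - restr Z f x) < e / ?C"
      using ell2_approx[OF f, of "e / ?C"] e C by auto
    define h where "h = (\<lambda>x. f x - restr Z f x)"
    note r = restr_ell2[OF Z(1,2), of f]
    have h: "h \<in> ell2 X" unfolding h_def by (rule ell2_diff[OF f r])
    have "ell2_inner X (T h) g - ell2_inner X h (adj X T g) =
        ell2_inner X (T f) g - ell2_inner X f (adj X T g)"
      unfolding h_def bop_diff[OF T f r]
        ell2_inner_diff_left[OF g bop_ell2[OF T f] bop_ell2[OF T r]]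
        ell2_inner_diff_left[OF adj_ell2[OF T g] f r] adj_inner_restr[OF T g Z(1,2)] by simp
    then have "cmod (ell2_inner X (T f) g - ell2_inner X f (adj X T g)) \<le>
        cmod (ell2_inner X (T h) g) + cmod (ell2_inner X h (adj X T g))"
      by (metis norm_triangle_ineq4)
    also have "\<dots> \<le> ell2_norm X (T h) * ell2_norm X g + ell2_norm X h * ell2_norm X (adj X T g)"
      by (intro add_mono ell2_cauchy_schwarz bop_ell2[OF T] adj_ell2[OF T] h g)
    also have "\<dots> \<le> (op_norm X T * ell2_norm X h) * ell2_norm X g + ell2_norm X h * ell2_norm X (adj X T g)"
      by (intro add_right_mono mult_right_mono op_norm_bound[OF T h]) simp
    also have "\<dots> \<le> ?C * ell2_norm X h" by (simp add: algebra_simps)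
    also have "\<dots> \<le> ?C * (e / ?C)"
      by (rule mult_left_mono) (use Z(3) C in \<open>auto simp: h_def\<close>)
    also have "\<dots> = e" using C by simp
    finally show ?thesis .
  qed
  then have "cmod (ell2_inner X (T f) g - ell2_inner X f (adj X T g)) \<le> 0"
    by (rule field_le_epsilon) simp
  then show ?thesis by simp
qed

lemma adj_bop:
  assumes T: "T \<in> bounded_operators X"
  shows "adj X T \<in> bounded_operators X"
proof (rule bounded_operatorsI[OF adj_ell2[OF T] _ _ _ adj_norm_le[OF T]])
  show "adj X T f = (\<lambda>x. 0)" if "f \<notin> ell2 X" for f using that by (auto simp: adj_def)
  show "adj X T (\<lambda>x. f x + g x) = (\<lambda>x. adj X T f x + adj X T g x)"
    if "f \<in> ell2 X" "g \<in> ell2 X" for f g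
    using that by (auto simp: adj_def ell2_add ell2_inner_add_right bop_ell2[OF T])
  show "adj X T (\<lambda>x. c * f x) = (\<lambda>x. c * adj X T f x)" if "f \<in> ell2 X" for f c
    using that by (auto simp: adj_def ell2_smult ell2_inner_smult_right)
qed

text \<open>Existence is the given candidate, and uniqueness follows since inner products with basis
  vectors determine the entries. Most rules for adjoints below consist in guessing the adjoint and
  checking this identity.\<close>

lemma op_adjoint_eqI:
  assumes T: "T \<in> bounded_operators X" and S: "S \<in> bounded_operators X"
    and eq: "\<And>f g. f \<in> ell2 X \<Longrightarrow> g \<in> ell2 X \<Longrightarrow> ell2_inner X (T f) g = ell2_inner X f (S g)"
  shows "op_adjoint X T = S"
  unfolding op_adjoint_def
proof (rule the_equality)
  show "S \<in> bounded_operators X \<and> (\<forall>f\<in>ell2 X. \<forall>g\<in>ell2 X. ell2_inner X (T f) g = ell2_inner X f (S g))"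
    using S eq by blast
next
  fix S' assume S': "S' \<in> bounded_operators X \<and> (\<forall>f\<in>ell2 X. \<forall>g\<in>ell2 X. ell2_inner X (T f) g = ell2_inner X f (S' g))"
  show "S' = S"
  proof (rule bop_eqI[OF _ S])
    show "S' \<in> bounded_operators X" using S' by simp
    fix x y assume xy: "x \<in> X" "y \<in> X"
    have "ell2_inner X (delta x) (S' (delta y)) = ell2_inner X (T (delta x)) (delta y)"
      using S' delta_ell2[OF xy(1)] delta_ell2[OF xy(2)] by simp
    also have "\<dots> = ell2_inner X (delta x) (S (delta y))"
      by (rule eq[OF delta_ell2[OF xy(1)] delta_ell2[OF xy(2)]])
    finally show "S' (delta y) x = S (delta y) x" by (simp add: inner_delta_left xy)
  qed
qed

lemma op_adjoint_eq_adj: "T \<in> bounded_operators X \<Longrightarrow> op_adjoint X T = adj X T"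
  by (rule op_adjoint_eqI[OF _ adj_bop]) (simp_all add: adj_inner)

lemma op_adjoint_bop: "T \<in> bounded_operators X \<Longrightarrow> op_adjoint X T \<in> bounded_operators X"
  by (simp add: op_adjoint_eq_adj adj_bop)

lemma op_adjoint_inner:
  "T \<in> bounded_operators X \<Longrightarrow> f \<in> ell2 X \<Longrightarrow> g \<in> ell2 X \<Longrightarrow>
    ell2_inner X (T f) g = ell2_inner X f (op_adjoint X T g)"
  by (simp add: op_adjoint_eq_adj adj_inner)

lemma op_adjoint_inner':
  assumes T: "T \<in> bounded_operators X" and f: "f \<in> ell2 X" and g: "g \<in> ell2 X"
  shows "ell2_inner X (op_adjoint X T f) g = ell2_inner X f (T g)"
  by (subst ell2_inner_commute, subst op_adjoint_inner[OF T g f, symmetric])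
     (rule ell2_inner_commute[symmetric])

lemma op_adjoint_adjoint: "T \<in> bounded_operators X \<Longrightarrow> op_adjoint X (op_adjoint X T) = T"
  by (rule op_adjoint_eqI[OF op_adjoint_bop]) (simp_all add: op_adjoint_inner')

lemma op_adjoint_entry:
  assumes T: "T \<in> bounded_operators X" and xy: "x \<in> X" "y \<in> X"
  shows "op_adjoint X T (delta y) x = cnj (T (delta x) y)"
  using xy by (simp add: op_adjoint_eq_adj[OF T] adj_def inner_delta_right)

lemma op_norm_adjoint_le: "T \<in> bounded_operators X \<Longrightarrow> op_norm X (op_adjoint X T) \<le> op_norm X T"
  by (simp add: op_adjoint_eq_adj op_norm_le adj_norm_le op_norm_nonneg)

lemma op_norm_adjoint: "T \<in> bounded_operators X \<Longrightarrow> op_norm X (op_adjoint X T) = op_norm X T"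
  using op_norm_adjoint_le[of T X] op_norm_adjoint_le[OF op_adjoint_bop, of T X]
  by (simp add: op_adjoint_adjoint)

lemma op_adjoint_plus:
  assumes S: "S \<in> bounded_operators X" and T: "T \<in> bounded_operators X"
  shows "op_adjoint X (\<lambda>f x. S f x + T f x) = (\<lambda>f x. op_adjoint X S f x + op_adjoint X T f x)"
  by (rule op_adjoint_eqI[OF bop_plus[OF S T] bop_plus[OF op_adjoint_bop[OF S] op_adjoint_bop[OF T]]])
     (simp add: ell2_inner_add_left ell2_inner_add_right bop_ell2 S T op_adjoint_bop op_adjoint_inner)

lemma op_adjoint_scale:
  assumes T: "T \<in> bounded_operators X"
  shows "op_adjoint X (\<lambda>f x. c * T f x) = (\<lambda>f x. cnj c * op_adjoint X T f x)"
  by (rule op_adjoint_eqI[OF bop_scale[OF T] bop_scale[OF op_adjoint_bop[OF T]]])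
     (simp add: ell2_inner_smult_left ell2_inner_smult_right op_adjoint_inner T)

lemma op_adjoint_comp:
  assumes S: "S \<in> bounded_operators X" and T: "T \<in> bounded_operators X"
  shows "op_adjoint X (S \<circ> T) = op_adjoint X T \<circ> op_adjoint X S"
  by (rule op_adjoint_eqI[OF bop_comp[OF S T] bop_comp[OF op_adjoint_bop[OF T] op_adjoint_bop[OF S]]])
     (simp add: op_adjoint_inner S T bop_ell2 op_adjoint_bop)

lemma op_adjoint_0: "op_adjoint X (\<lambda>f x. 0) = (\<lambda>f x. 0)"
  by (rule op_adjoint_eqI[OF bop_0 bop_0]) simp

lemma op_adjoint_id:
  "op_adjoint X (\<lambda>f. if f \<in> ell2 X then f else (\<lambda>x. 0)) = (\<lambda>f. if f \<in> ell2 X then f else (\<lambda>x. 0))"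
  by (rule op_adjoint_eqI[OF bop_id bop_id]) simp

lemma op_adjoint_sum:
  "(\<And>i. i \<in> I \<Longrightarrow> T i \<in> bounded_operators X) \<Longrightarrow>
    op_adjoint X (\<lambda>f x. \<Sum>i\<in>I. T i f x) = (\<lambda>f x. \<Sum>i\<in>I. op_adjoint X (T i) f x)"
  by (induction I rule: infinite_finite_induct)
     (simp_all add: op_adjoint_0 op_adjoint_plus bop_sum_ops)

text \<open>The lower bound comes from \<open>||T f||^2 = <f, T^* T f>\<close> and
  Cauchy-Schwarz.\<close>

lemma op_norm_cstar:
  assumes T: "T \<in> bounded_operators X"
  shows "op_norm X (op_adjoint X T \<circ> T) = (op_norm X T)\<^sup>2"
proof (rule antisym)
  let ?S = "op_adjoint X T \<circ> T"
  have S: "?S \<in> bounded_operators X" by (rule bop_comp[OF op_adjoint_bop[OF T] T])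
  show "op_norm X ?S \<le> (op_norm X T)\<^sup>2"
    using op_norm_comp[OF op_adjoint_bop[OF T] T] by (simp add: op_norm_adjoint[OF T] power2_eq_square)
  have "op_norm X T \<le> sqrt (op_norm X ?S)"
  proof (rule op_norm_le)
    fix f assume f: "f \<in> ell2 X"
    have "(ell2_norm X (T f))\<^sup>2 = cmod (ell2_inner X (T f) (T f))"
      unfolding ell2_inner_self[OF bop_ell2[OF T f]] norm_of_real by simp
    also have "\<dots> = cmod (ell2_inner X f (?S f))"
      by (simp add: op_adjoint_inner[OF T f bop_ell2[OF T f]])
    also have "\<dots> \<le> ell2_norm X f * ell2_norm X (?S f)"
      by (rule ell2_cauchy_schwarz[OF f bop_ell2[OF S f]])
    also have "\<dots> \<le> ell2_norm X f * (op_norm X ?S * ell2_norm X f)"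
      by (rule mult_left_mono[OF op_norm_bound[OF S f]]) simp
    also have "\<dots> = (sqrt (op_norm X ?S) * ell2_norm X f)\<^sup>2"
      by (simp add: power_mult_distrib op_norm_nonneg[OF S] power2_eq_square)
    finally show "ell2_norm X (T f) \<le> sqrt (op_norm X ?S) * ell2_norm X f"
      by (rule power2_le_imp_le) (simp add: op_norm_nonneg[OF S])
  qed (simp add: op_norm_nonneg[OF S])
  then have "(op_norm X T)\<^sup>2 \<le> (sqrt (op_norm X ?S))\<^sup>2"
    by (rule power_mono) (rule op_norm_nonneg[OF T])
  then show "(op_norm X T)\<^sup>2 \<le> op_norm X ?S" by (simp add: op_norm_nonneg[OF S])
qed

text \<open>The limit is taken coordinate by coordinate. Norm convergence is recovered by letting
  \<open>m\<close> tend to infinity inside finite partial sums, where the uniform bound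
  survives.\<close>

lemma bounded_operators_complete:
  fixes s :: "nat \<Rightarrow> ('x \<Rightarrow> complex) \<Rightarrow> ('x \<Rightarrow> complex)"
  assumes s: "\<And>n. s n \<in> bounded_operators X"
    and cauchy: "\<And>e. e > 0 \<Longrightarrow> \<exists>N. \<forall>m\<ge>N. \<forall>n\<ge>N. op_norm X (\<lambda>f x. s m f x - s n f x) < e"
  shows "\<exists>T\<in>bounded_operators X. \<forall>e>0. \<exists>N. \<forall>n\<ge>N. op_norm X (\<lambda>f x. s n f x - T f x) \<le> e"
proof -
  define T where "T = (\<lambda>f x. lim (\<lambda>n. s n f x))"
  have D: "(\<lambda>f x. s m f x - s n f x) \<in> bounded_operators X" for m n by (rule bop_minus[OF s s])
  have lim: "(\<lambda>n. s n f x) \<longlonglongrightarrow> T f x" for f x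
  proof (cases "f \<in> ell2 X")
    case f: True
    have "Cauchy (\<lambda>n. s n f x)"
    proof (rule metric_CauchyI)
      fix e :: real assume e: "e > 0"
      let ?e = "e / (ell2_norm X f + 1)"
      have e': "?e > 0" using e by (simp add: add_nonneg_pos)
      obtain N where N: "\<And>m n. m \<ge> N \<Longrightarrow> n \<ge> N \<Longrightarrow> op_norm X (\<lambda>f x. s m f x - s n f x) < ?e"
        using cauchy[OF e'] by blast
      have "dist (s m f x) (s n f x) < e" if mn: "m \<ge> N" "n \<ge> N" for m n
      proof -
        have "dist (s m f x) (s n f x) \<le> ell2_norm X (\<lambda>x. s m f x - s n f x)"
          using ell2_coord_le[OF bop_ell2[OF D[of m n] f], of x] by (simp add: dist_norm)
        also have "\<dots> \<le> op_norm X (\<lambda>f x. s m f x - s n f x) * ell2_norm X f" by (rule op_norm_bound[OF D f])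
        also have "\<dots> \<le> ?e * ell2_norm X f" using N[OF mn] by (intro mult_right_mono) auto
        also have "\<dots> < ?e * (ell2_norm X f + 1)" using e' by (intro mult_strict_left_mono) auto
        also have "\<dots> = e" using ell2_norm_nonneg[of X f] by (simp add: add_nonneg_eq_0_iff)
        finally show ?thesis .
      qed
      then show "\<exists>N. \<forall>m\<ge>N. \<forall>n\<ge>N. dist (s m f x) (s n f x) < e" by blast
    qed
    then show ?thesis unfolding T_def
      by (simp add: Cauchy_convergent_iff convergent_LIMSEQ_iff)
  next
    case False
    then show ?thesis by (simp add: T_def bop_outside[OF s])
  qed
  have close: "(\<lambda>x. s n f x - T f x) \<in> ell2 X \<and> ell2_norm X (\<lambda>x. s n f x - T f x) \<le> e * ell2_norm X f"
    if N: "\<And>m n. m \<ge> N \<Longrightarrow> n \<ge> N \<Longrightarrow> op_norm X (\<lambda>f x. s m f x - s n f x) < e"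
      and n: "n \<ge> N" and f: "f \<in> ell2 X" and e: "e > 0" for N n e f
  proof -
    have out: "s n f x - T f x = 0" if "x \<notin> X" for x
    proof -
      have "s n f x = 0" for n by (rule ell2_outside[OF bop_ell2[OF s f] that])
      then show ?thesis by (simp add: T_def)
    qed
    have le: "(\<Sum>x\<in>Z. (cmod (s n f x - T f x))\<^sup>2) \<le> (e * ell2_norm X f)\<^sup>2" if Z: "finite Z" "Z \<subseteq> X" for Z
    proof (rule LIMSEQ_le_const2)
      show "(\<lambda>m. \<Sum>x\<in>Z. (cmod (s n f x - s m f x))\<^sup>2) \<longlonglongrightarrow> (\<Sum>x\<in>Z. (cmod (s n f x - T f x))\<^sup>2)"
        by (intro tendsto_intros lim)
      have "(\<Sum>x\<in>Z. (cmod (s n f x - s m f x))\<^sup>2) \<le> (e * ell2_norm X f)\<^sup>2" if m: "m \<ge> N" for m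
      proof -
        have "(\<Sum>x\<in>Z. (cmod (s n f x - s m f x))\<^sup>2) \<le> (ell2_norm X (\<lambda>x. s n f x - s m f x))\<^sup>2"
          by (rule ell2_finite_sum_le[OF bop_ell2[OF D f] Z])
        also have "\<dots> \<le> (e * ell2_norm X f)\<^sup>2"
          by (intro power_mono order_trans[OF op_norm_bound[OF D f]] mult_right_mono)
             (use N[OF n m] in auto)
        finally show ?thesis .
      qed
      then show "\<exists>N. \<forall>m\<ge>N. (\<Sum>x\<in>Z. (cmod (s n f x - s m f x))\<^sup>2) \<le> (e * ell2_norm X f)\<^sup>2" by blast
    qed
    have K: "0 \<le> e * ell2_norm X f" using e by simp
    show ?thesis using ell2_fatou[OF out le K] by simp
  qed
  obtain N1 where N1: "\<And>m n. m \<ge> N1 \<Longrightarrow> n \<ge> N1 \<Longrightarrow> op_norm X (\<lambda>f x. s m f x - s n f x) < 1"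
    using cauchy[of 1] by auto
  \<comment> \<open>\<open>T\<close> is a bounded operator minus a bounded difference, so membership
    in \<open>ell2 X\<close> and boundedness are inherited.\<close>
  have T2: "T f = (\<lambda>x. s N1 f x - (s N1 f x - T f x))" for f by simp
  have T: "T \<in> bounded_operators X"
  proof (rule bounded_operatorsI)
    fix f assume f: "f \<in> ell2 X"
    note c = close[OF N1 order_refl f zero_less_one]
    show "T f \<in> ell2 X"
      by (subst T2) (rule ell2_diff[OF bop_ell2[OF s f]], use c in simp)
    have "ell2_norm X (T f) \<le> ell2_norm X (s N1 f) + ell2_norm X (\<lambda>x. s N1 f x - T f x)"
      by (subst T2) (rule ell2_norm_triangle_diff[OF bop_ell2[OF s f]], use c in simp)
    also have "\<dots> \<le> op_norm X (s N1) * ell2_norm X f + 1 * ell2_norm X f"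
      by (rule add_mono[OF op_norm_bound[OF s f]]) (use c in simp)
    finally show "ell2_norm X (T f) \<le> (op_norm X (s N1) + 1) * ell2_norm X f"
      by (simp add: distrib_right)
  next
    fix f g assume f: "f \<in> ell2 X" and g: "g \<in> ell2 X"
    show "T (\<lambda>x. f x + g x) = (\<lambda>x. T f x + T g x)"
    proof
      fix x have "(\<lambda>n. s n (\<lambda>x. f x + g x) x) \<longlonglongrightarrow> T f x + T g x"
        unfolding bop_add[OF s f g] by (intro tendsto_intros lim)
      then show "T (\<lambda>x. f x + g x) x = T f x + T g x" by (rule LIMSEQ_unique[OF lim])
    qed
  next
    fix c f assume f: "f \<in> ell2 X"
    show "T (\<lambda>x. c * f x) = (\<lambda>x. c * T f x)"
    proof
      fix x have "(\<lambda>n. s n (\<lambda>x. c * f x) x) \<longlonglongrightarrow> c * T f x"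
        unfolding bop_smult[OF s f] by (intro tendsto_intros lim)
      then show "T (\<lambda>x. c * f x) x = c * T f x" by (rule LIMSEQ_unique[OF lim])
    qed
  qed (simp add: T_def bop_outside[OF s])
  have "\<exists>N. \<forall>n\<ge>N. op_norm X (\<lambda>f x. s n f x - T f x) \<le> e" if e: "e > 0" for e
  proof -
    obtain N where N: "\<And>m n. m \<ge> N \<Longrightarrow> n \<ge> N \<Longrightarrow> op_norm X (\<lambda>f x. s m f x - s n f x) < e"
      using cauchy[OF e] by blast
    have "op_norm X (\<lambda>f x. s n f x - T f x) \<le> e" if "n \<ge> N" for n
      by (rule op_norm_le) (use close[OF N that _ e] e in auto)
    then show ?thesis by blast
  qed
  then show ?thesis using T by blast
qed

section \<open>Operators given by row- and column-finite matrices\<close>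

text \<open>Both rows and columns are counted, since the norm estimate uses both. Finite propagation
  matrices and all matrices over a finite index set are instances.\<close>

definition band :: "'x set \<Rightarrow> nat \<Rightarrow> real \<Rightarrow> ('x \<Rightarrow> 'x \<Rightarrow> complex) \<Rightarrow> bool" where
  "band X N M \<alpha> \<longleftrightarrow> 0 \<le> M \<and> (\<forall>x\<in>X. \<forall>y\<in>X. cmod (\<alpha> x y) \<le> M) \<and>
     (\<forall>x\<in>X. finite {y\<in>X. \<alpha> x y \<noteq> 0} \<and> card {y\<in>X. \<alpha> x y \<noteq> 0} \<le> N) \<and>
     (\<forall>y\<in>X. finite {x\<in>X. \<alpha> x y \<noteq> 0} \<and> card {x\<in>X. \<alpha> x y \<noteq> 0} \<le> N)"

lemma matrix_operator_finite_row:
  assumes "f \<in> ell2 X" "x \<in> X" "finite R" "R \<subseteq> X" "\<And>y. y \<in> X \<Longrightarrow> y \<notin> R \<Longrightarrow> \<alpha> x y = 0"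
  shows "matrix_operator X \<alpha> f x = (\<Sum>y\<in>R. \<alpha> x y * f y)"
proof -
  have "(\<Sum>\<^sub>\<infinity>y\<in>X. \<alpha> x y * f y) = (\<Sum>y\<in>R. \<alpha> x y * f y)"
    by (rule infsumI, rule has_sum_finite_neutralI) (use assms in auto)
  then show ?thesis using assms by (simp add: matrix_operator_def)
qed

lemma matrix_operator_entry:
  assumes "x \<in> X" "y \<in> X"
  shows "matrix_operator X \<alpha> (delta y) x = \<alpha> x y"
proof -
  have "(\<Sum>\<^sub>\<infinity>z\<in>X. \<alpha> x z * delta y z) = \<alpha> x y"
    by (rule infsumI, rule has_sum_finite_neutralI[of "{y}"]) (use assms in \<open>auto simp: delta_def\<close>)
  then show ?thesis using assms by (simp add: matrix_operator_def)
qed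

text \<open>A Schur-type estimate: Cauchy-Schwarz in each row costs a factor \<open>N * M^2\<close>,
  and each coordinate of \<open>f\<close> enters at most \<open>N\<close> rows, so the squared norm
  grows at most by the factor \<open>N^2 * M^2\<close>.\<close>

lemma
  assumes b: "band X N M \<alpha>"
  shows band_bop: "matrix_operator X \<alpha> \<in> bounded_operators X"
    and band_norm: "op_norm X (matrix_operator X \<alpha>) \<le> real N * M"
proof -
  let ?T = "matrix_operator X \<alpha>"
  define R where "R x = {y\<in>X. \<alpha> x y \<noteq> 0}" for x
  have M: "0 \<le> M" and bd: "\<And>x y. x \<in> X \<Longrightarrow> y \<in> X \<Longrightarrow> cmod (\<alpha> x y) \<le> M"
    and R: "\<And>x. x \<in> X \<Longrightarrow> finite (R x)" "\<And>x. x \<in> X \<Longrightarrow> card (R x) \<le> N"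
    and C: "\<And>y. y \<in> X \<Longrightarrow> finite {x\<in>X. \<alpha> x y \<noteq> 0}" "\<And>y. y \<in> X \<Longrightarrow> card {x\<in>X. \<alpha> x y \<noteq> 0} \<le> N"
    using b unfolding band_def R_def by blast+
  have RX: "R x \<subseteq> X" for x by (auto simp: R_def)
  have Tf: "?T f x = (\<Sum>y\<in>R x. \<alpha> x y * f y)" if "f \<in> ell2 X" "x \<in> X" for f x
    by (rule matrix_operator_finite_row) (use that R RX in \<open>auto simp: R_def\<close>)
  have out: "?T f x = 0" if "x \<notin> X" for f x using that by (simp add: matrix_operator_def)
  have row: "(cmod (?T f x))\<^sup>2 \<le> (real N * M\<^sup>2) * (\<Sum>y\<in>R x. (cmod (f y))\<^sup>2)"
    if f: "f \<in> ell2 X" and x: "x \<in> X" for f x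
  proof -
    have "cmod (?T f x) \<le> (\<Sum>y\<in>R x. M * cmod (f y))"
      unfolding Tf[OF f x]
      by (rule sum_norm_le) (use bd x RX in \<open>auto simp: norm_mult intro!: mult_right_mono\<close>)
    then have "(cmod (?T f x))\<^sup>2 \<le> (\<Sum>y\<in>R x. M * cmod (f y))\<^sup>2" by (rule power_mono) simp
    also have "\<dots> \<le> (\<Sum>y\<in>R x. (M * cmod (f y))\<^sup>2) * real (card (R x))"
      by (rule sum_squared_le_sum_of_squares)
    also have "\<dots> \<le> (\<Sum>y\<in>R x. (M * cmod (f y))\<^sup>2) * real N"
      by (rule mult_left_mono) (use R(2)[OF x] in \<open>auto intro: sum_nonneg\<close>)
    also have "\<dots> = (real N * M\<^sup>2) * (\<Sum>y\<in>R x. (cmod (f y))\<^sup>2)"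
      by (simp add: power_mult_distrib sum_distrib_left[symmetric])
    finally show ?thesis .
  qed
  have le: "(\<Sum>x\<in>Z. (cmod (?T f x))\<^sup>2) \<le> (real N * M * ell2_norm X f)\<^sup>2"
    if f: "f \<in> ell2 X" and Z: "finite Z" "Z \<subseteq> X" for f Z
  proof -
    define W where "W = (\<Union>x\<in>Z. R x)"
    have W: "finite W" "W \<subseteq> X" unfolding W_def using Z R(1) RX by blast+
    have "(\<Sum>x\<in>Z. \<Sum>y\<in>R x. (cmod (f y))\<^sup>2) = (\<Sum>x\<in>Z. \<Sum>y\<in>W. if y \<in> R x then (cmod (f y))\<^sup>2 else 0)"
    proof (rule sum.cong[OF refl])
      fix x assume "x \<in> Z"
      then have "W \<inter> R x = R x" by (auto simp: W_def)
      then show "(\<Sum>y\<in>R x. (cmod (f y))\<^sup>2) = (\<Sum>y\<in>W. if y \<in> R x then (cmod (f y))\<^sup>2 else 0)"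
        by (simp add: sum.inter_restrict[OF W(1), symmetric])
    qed
    \<comment> \<open>After exchanging the sums, each \<open>y\<close> is counted once for every row
      that meets it, hence at most \<open>N\<close> times.\<close>
    also have "\<dots> = (\<Sum>y\<in>W. \<Sum>x\<in>Z. if y \<in> R x then (cmod (f y))\<^sup>2 else 0)" by (rule sum.swap)
    also have "\<dots> = (\<Sum>y\<in>W. real (card {x\<in>Z. y \<in> R x}) * (cmod (f y))\<^sup>2)"
      by (simp add: sum.inter_filter[OF Z(1), symmetric])
    also have "\<dots> \<le> (\<Sum>y\<in>W. real N * (cmod (f y))\<^sup>2)"
    proof (intro sum_mono mult_right_mono)
      fix y assume "y \<in> W"
      then have y: "y \<in> X" using W by blast
      have "card {x\<in>Z. y \<in> R x} \<le> card {x\<in>X. \<alpha> x y \<noteq> 0}"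
        by (rule card_mono[OF C(1)[OF y]]) (use Z in \<open>auto simp: R_def\<close>)
      then show "real (card {x\<in>Z. y \<in> R x}) \<le> real N" using C(2)[OF y] by simp
    qed simp
    also have "\<dots> \<le> real N * (ell2_norm X f)\<^sup>2"
      unfolding sum_distrib_left[symmetric] by (rule mult_left_mono[OF ell2_finite_sum_le[OF f W]]) simp
    finally have *: "(\<Sum>x\<in>Z. \<Sum>y\<in>R x. (cmod (f y))\<^sup>2) \<le> real N * (ell2_norm X f)\<^sup>2" .
    have "(\<Sum>x\<in>Z. (cmod (?T f x))\<^sup>2) \<le> (\<Sum>x\<in>Z. (real N * M\<^sup>2) * (\<Sum>y\<in>R x. (cmod (f y))\<^sup>2))"
      by (rule sum_mono) (use row[OF f] Z in auto)
    also have "\<dots> \<le> (real N * M\<^sup>2) * (real N * (ell2_norm X f)\<^sup>2)"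
      unfolding sum_distrib_left[symmetric] by (rule mult_left_mono[OF *]) simp
    also have "\<dots> = (real N * M * ell2_norm X f)\<^sup>2" by (simp add: power2_eq_square)
    finally show ?thesis .
  qed
  have K: "0 \<le> real N * M * ell2_norm X f" for f using M by simp
  have fat: "?T f \<in> ell2 X" "ell2_norm X (?T f) \<le> real N * M * ell2_norm X f" if f: "f \<in> ell2 X" for f
    by (rule ell2_fatou[OF out le[OF f] K]; assumption)+
  show "?T \<in> bounded_operators X"
  proof (rule bounded_operatorsI)
    fix f assume f: "f \<in> ell2 X"
    show "?T f \<in> ell2 X" by (rule fat(1)[OF f])
    show "ell2_norm X (?T f) \<le> (real N * M) * ell2_norm X f" by (rule fat(2)[OF f])
  next
    fix f g assume f: "f \<in> ell2 X" and g: "g \<in> ell2 X"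
    show "?T (\<lambda>x. f x + g x) = (\<lambda>x. ?T f x + ?T g x)"
    proof
      fix x show "?T (\<lambda>x. f x + g x) x = ?T f x + ?T g x"
        by (cases "x \<in> X") (simp_all add: out Tf f g ell2_add distrib_left sum.distrib)
    qed
  next
    fix c f assume f: "f \<in> ell2 X"
    show "?T (\<lambda>x. c * f x) = (\<lambda>x. c * ?T f x)"
    proof
      fix x show "?T (\<lambda>x. c * f x) x = c * ?T f x"
        by (cases "x \<in> X") (simp_all add: out Tf f ell2_smult sum_distrib_left mult.left_commute)
    qed
  qed (simp add: matrix_operator_def)
  show "op_norm X ?T \<le> real N * M"
    by (rule op_norm_le) (use fat(2) M in auto)
qed

lemma matrix_operator_plus:
  assumes "matrix_operator X \<alpha> \<in> bounded_operators X" "matrix_operator X \<beta> \<in> bounded_operators X"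
    "matrix_operator X \<gamma> \<in> bounded_operators X"
    and "\<And>x y. x \<in> X \<Longrightarrow> y \<in> X \<Longrightarrow> \<gamma> x y = \<alpha> x y + \<beta> x y"
  shows "matrix_operator X \<gamma> = (\<lambda>f x. matrix_operator X \<alpha> f x + matrix_operator X \<beta> f x)"
  by (rule bop_eqI[OF assms(3) bop_plus[OF assms(1,2)]]) (simp add: matrix_operator_entry assms)

lemma matrix_operator_scale:
  assumes "matrix_operator X \<alpha> \<in> bounded_operators X"
    "matrix_operator X \<gamma> \<in> bounded_operators X"
    and "\<And>x y. x \<in> X \<Longrightarrow> y \<in> X \<Longrightarrow> \<gamma> x y = c * \<alpha> x y"
  shows "matrix_operator X \<gamma> = (\<lambda>f x. c * matrix_operator X \<alpha> f x)"
  by (rule bop_eqI[OF assms(2) bop_scale[OF assms(1)]]) (simp add: matrix_operator_entry assms)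

lemma matrix_operator_adjoint:
  assumes "matrix_operator X \<alpha> \<in> bounded_operators X" "matrix_operator X \<gamma> \<in> bounded_operators X"
    and "\<And>x y. x \<in> X \<Longrightarrow> y \<in> X \<Longrightarrow> \<gamma> x y = cnj (\<alpha> y x)"
  shows "op_adjoint X (matrix_operator X \<alpha>) = matrix_operator X \<gamma>"
  by (rule bop_eqI[OF op_adjoint_bop[OF assms(1)] assms(2)])
     (simp add: matrix_operator_entry assms op_adjoint_entry)

text \<open>\<open>R x\<close> is any finite set containing the support of row \<open>x\<close>, so
  the entries of the product are finite sums.\<close>

lemma matrix_operator_comp:
  assumes "matrix_operator X \<alpha> \<in> bounded_operators X" "matrix_operator X \<beta> \<in> bounded_operators X"
    "matrix_operator X \<gamma> \<in> bounded_operators X"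
    and R: "\<And>x. x \<in> X \<Longrightarrow> finite (R x)" "\<And>x. x \<in> X \<Longrightarrow> R x \<subseteq> X"
      "\<And>x y. x \<in> X \<Longrightarrow> y \<in> X \<Longrightarrow> y \<notin> R x \<Longrightarrow> \<alpha> x y = 0"
    and \<gamma>: "\<And>x y. x \<in> X \<Longrightarrow> y \<in> X \<Longrightarrow> \<gamma> x y = (\<Sum>z\<in>R x. \<alpha> x z * \<beta> z y)"
  shows "matrix_operator X \<alpha> \<circ> matrix_operator X \<beta> = matrix_operator X \<gamma>"
proof (rule bop_eqI[OF bop_comp[OF assms(1,2)] assms(3)])
  fix x y assume xy: "x \<in> X" "y \<in> X"
  have "(matrix_operator X \<alpha> \<circ> matrix_operator X \<beta>) (delta y) x =
      (\<Sum>z\<in>R x. \<alpha> x z * matrix_operator X \<beta> (delta y) z)"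
    unfolding o_def
    by (rule matrix_operator_finite_row[OF bop_ell2[OF assms(2)]]) (use xy R in auto)
  also have "\<dots> = (\<Sum>z\<in>R x. \<alpha> x z * \<beta> z y)"
    by (intro sum.cong refl) (use xy R(2)[OF xy(1)] in \<open>auto simp: matrix_operator_entry subset_iff\<close>)
  finally show "(matrix_operator X \<alpha> \<circ> matrix_operator X \<beta>) (delta y) x = matrix_operator X \<gamma> (delta y) x"
    by (simp add: matrix_operator_entry xy \<gamma>)
qed

lemma op_entry_le:
  assumes "T \<in> bounded_operators X" "x \<in> X" "y \<in> X"
  shows "cmod (T (delta y) x) \<le> op_norm X T"
  using ell2_coord_le[OF bop_ell2[OF assms(1) delta_ell2[OF assms(3)]], of x]
    op_norm_bound[OF assms(1) delta_ell2[OF assms(3)]] assms(3) by simp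

section \<open>The uniform Roe algebra\<close>

locale bg_space = Metric_space X d for X :: "'x set" and d :: "'x \<Rightarrow> 'x \<Rightarrow> real" +
  assumes bg: "bounded_geometry X d"
begin

abbreviation A where "A \<equiv> uniform_roe_algebra X d"

text \<open>The carrier under a name of its own: \<open>roe_simps\<close> can then unfold the record
  without exposing the approximation property.\<close>

definition Roe :: "(('x \<Rightarrow> complex) \<Rightarrow> ('x \<Rightarrow> complex)) set" where
  "Roe = {T \<in> bounded_operators X. \<forall>e>0. \<exists>\<alpha>\<in>finite_propagation X d.
        op_norm X (\<lambda>f x. T f x - matrix_operator X \<alpha> f x) < e}"

lemma roe_simps [simp]:
  "carrier A = Roe"
  "S \<otimes>\<^bsub>A\<^esub> T = S \<circ> T"
  "S \<oplus>\<^bsub>A\<^esub> T = (\<lambda>f x. S f x + T f x)"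
  "c \<odot>\<^bsub>A\<^esub> T = (\<lambda>f x. c * T f x)"
  "\<zero>\<^bsub>A\<^esub> = (\<lambda>f x. 0)"
  "star A T = op_adjoint X T"
  "nrm A T = op_norm X T"
  by (simp_all add: uniform_roe_algebra_def operator_algebra_def Roe_def)

lemma roe_bop: "T \<in> Roe \<Longrightarrow> T \<in> bounded_operators X"
  by (simp add: Roe_def)

lemma ball_bound:
  obtains N where "\<And>x. x \<in> X \<Longrightarrow> finite {y\<in>X. d x y \<le> r}" "\<And>x. x \<in> X \<Longrightarrow> card {y\<in>X. d x y \<le> r} \<le> N"
proof -
  have *: "mcball x r = {y\<in>X. d x y \<le> r}" if "x \<in> X" for x using that by (auto simp: mcball_def)
  obtain N where "\<forall>x\<in>X. finite (mcball x r) \<and> card (mcball x r) \<le> N"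
    using bg unfolding bounded_geometry_def by blast
  then show ?thesis by (intro that[of N]) (simp_all add: *)
qed

text \<open>Column supports lie in balls as well, by the symmetry of \<open>d\<close>, so one bound
  on the balls serves rows and columns.\<close>

lemma band_of_propagation:
  assumes "0 \<le> M" "\<And>x y. x \<in> X \<Longrightarrow> y \<in> X \<Longrightarrow> cmod (\<alpha> x y) \<le> M"
    and r: "\<And>x y. x \<in> X \<Longrightarrow> y \<in> X \<Longrightarrow> d x y > r \<Longrightarrow> \<alpha> x y = 0"
    and N: "\<And>x. x \<in> X \<Longrightarrow> finite {y\<in>X. d x y \<le> r}" "\<And>x. x \<in> X \<Longrightarrow> card {y\<in>X. d x y \<le> r} \<le> N"
  shows "band X N M \<alpha>"
proof -
  have row: "{y\<in>X. \<alpha> x y \<noteq> 0} \<subseteq> {y\<in>X. d x y \<le> r}" if "x \<in> X" for x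
    using r[OF that] by force
  have col: "{x\<in>X. \<alpha> x y \<noteq> 0} \<subseteq> {x\<in>X. d y x \<le> r}" if "y \<in> X" for y
    using r[OF _ that] commute by force
  show ?thesis unfolding band_def
    using assms(1,2) finite_subset[OF row N(1)] finite_subset[OF col N(1)]
      order_trans[OF card_mono[OF N(1) row] N(2)] order_trans[OF card_mono[OF N(1) col] N(2)]
    by simp
qed

lemma fp_I:
  assumes "0 \<le> M" "\<And>x y. x \<in> X \<Longrightarrow> y \<in> X \<Longrightarrow> cmod (\<alpha> x y) \<le> M"
    and r: "\<And>x y. x \<in> X \<Longrightarrow> y \<in> X \<Longrightarrow> d x y > r \<Longrightarrow> \<alpha> x y = 0"
  shows "\<alpha> \<in> finite_propagation X d"
proof -
  \<comment> \<open>The definition asks for a positive radius, while \<open>r\<close> may be any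
    real number.\<close>
  have "\<forall>x\<in>X. \<forall>y\<in>X. d x y > max r 1 \<longrightarrow> \<alpha> x y = 0" using r by auto
  moreover have "max r 1 > 0" by simp
  ultimately show ?thesis unfolding finite_propagation_def using assms(1,2) by blast
qed

lemma fp_E:
  assumes "\<alpha> \<in> finite_propagation X d"
  obtains M r where "0 \<le> M" "0 < r" "\<And>x y. x \<in> X \<Longrightarrow> y \<in> X \<Longrightarrow> cmod (\<alpha> x y) \<le> M"
    "\<And>x y. x \<in> X \<Longrightarrow> y \<in> X \<Longrightarrow> d x y > r \<Longrightarrow> \<alpha> x y = 0"
  using assms unfolding finite_propagation_def by blast

lemma fp_bop: "\<alpha> \<in> finite_propagation X d \<Longrightarrow> matrix_operator X \<alpha> \<in> bounded_operators X"
proof -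
  assume "\<alpha> \<in> finite_propagation X d"
  then obtain M r where *: "0 \<le> M" "\<And>x y. x \<in> X \<Longrightarrow> y \<in> X \<Longrightarrow> cmod (\<alpha> x y) \<le> M"
    "\<And>x y. x \<in> X \<Longrightarrow> y \<in> X \<Longrightarrow> d x y > r \<Longrightarrow> \<alpha> x y = 0" by (rule fp_E) blast
  obtain N where N: "\<And>x. x \<in> X \<Longrightarrow> finite {y\<in>X. d x y \<le> r}" "\<And>x. x \<in> X \<Longrightarrow> card {y\<in>X. d x y \<le> r} \<le> N"
    using ball_bound[of r] by blast
  show ?thesis by (rule band_bop[OF band_of_propagation[OF * N]])
qed

lemma fp_roe: "\<alpha> \<in> finite_propagation X d \<Longrightarrow> matrix_operator X \<alpha> \<in> Roe"
  unfolding Roe_def by (auto simp: fp_bop intro!: bexI[of _ \<alpha>])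

lemma fp_plus:
  assumes "\<alpha> \<in> finite_propagation X d" "\<beta> \<in> finite_propagation X d"
  shows "(\<lambda>x y. \<alpha> x y + \<beta> x y) \<in> finite_propagation X d"
    and "matrix_operator X (\<lambda>x y. \<alpha> x y + \<beta> x y) = (\<lambda>f x. matrix_operator X \<alpha> f x + matrix_operator X \<beta> f x)"
proof -
  obtain M r where a: "0 \<le> M" "0 < r" "\<And>x y. x \<in> X \<Longrightarrow> y \<in> X \<Longrightarrow> cmod (\<alpha> x y) \<le> M"
    "\<And>x y. x \<in> X \<Longrightarrow> y \<in> X \<Longrightarrow> d x y > r \<Longrightarrow> \<alpha> x y = 0" using fp_E[OF assms(1)] by blast
  obtain M' r' where b: "0 \<le> M'" "0 < r'" "\<And>x y. x \<in> X \<Longrightarrow> y \<in> X \<Longrightarrow> cmod (\<beta> x y) \<le> M'"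
    "\<And>x y. x \<in> X \<Longrightarrow> y \<in> X \<Longrightarrow> d x y > r' \<Longrightarrow> \<beta> x y = 0" using fp_E[OF assms(2)] by blast
  show *: "(\<lambda>x y. \<alpha> x y + \<beta> x y) \<in> finite_propagation X d"
    by (rule fp_I[of "M + M'" _ "max r r'"])
       (use a b in \<open>auto intro!: order_trans[OF norm_triangle_ineq] add_mono\<close>)
  show "matrix_operator X (\<lambda>x y. \<alpha> x y + \<beta> x y) = (\<lambda>f x. matrix_operator X \<alpha> f x + matrix_operator X \<beta> f x)"
    by (rule matrix_operator_plus[OF fp_bop[OF assms(1)] fp_bop[OF assms(2)] fp_bop[OF *]]) simp
qed

lemma fp_scale:
  assumes "\<alpha> \<in> finite_propagation X d"
  shows "(\<lambda>x y. c * \<alpha> x y) \<in> finite_propagation X d"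
    and "matrix_operator X (\<lambda>x y. c * \<alpha> x y) = (\<lambda>f x. c * matrix_operator X \<alpha> f x)"
proof -
  obtain M r where a: "0 \<le> M" "0 < r" "\<And>x y. x \<in> X \<Longrightarrow> y \<in> X \<Longrightarrow> cmod (\<alpha> x y) \<le> M"
    "\<And>x y. x \<in> X \<Longrightarrow> y \<in> X \<Longrightarrow> d x y > r \<Longrightarrow> \<alpha> x y = 0" using fp_E[OF assms(1)] by blast
  show *: "(\<lambda>x y. c * \<alpha> x y) \<in> finite_propagation X d"
    by (rule fp_I[of "cmod c * M" _ r]) (use a in \<open>auto simp: norm_mult intro!: mult_left_mono\<close>)
  show "matrix_operator X (\<lambda>x y. c * \<alpha> x y) = (\<lambda>f x. c * matrix_operator X \<alpha> f x)"
    by (rule matrix_operator_scale[OF fp_bop[OF assms(1)] fp_bop[OF *]]) simp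
qed

lemma fp_adjoint:
  assumes "\<alpha> \<in> finite_propagation X d"
  shows "(\<lambda>x y. cnj (\<alpha> y x)) \<in> finite_propagation X d"
    and "op_adjoint X (matrix_operator X \<alpha>) = matrix_operator X (\<lambda>x y. cnj (\<alpha> y x))"
proof -
  obtain M r where a: "0 \<le> M" "0 < r" "\<And>x y. x \<in> X \<Longrightarrow> y \<in> X \<Longrightarrow> cmod (\<alpha> x y) \<le> M"
    "\<And>x y. x \<in> X \<Longrightarrow> y \<in> X \<Longrightarrow> d x y > r \<Longrightarrow> \<alpha> x y = 0" using fp_E[OF assms(1)] by blast
  show *: "(\<lambda>x y. cnj (\<alpha> y x)) \<in> finite_propagation X d"
    by (rule fp_I[of M _ r]) (use a commute in auto)
  show "op_adjoint X (matrix_operator X \<alpha>) = matrix_operator X (\<lambda>x y. cnj (\<alpha> y x))"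
    by (rule matrix_operator_adjoint[OF fp_bop[OF assms(1)] fp_bop[OF *]]) simp
qed

lemma fp_comp:
  assumes "\<alpha> \<in> finite_propagation X d" "\<beta> \<in> finite_propagation X d"
  obtains \<gamma> where "\<gamma> \<in> finite_propagation X d"
    "matrix_operator X \<alpha> \<circ> matrix_operator X \<beta> = matrix_operator X \<gamma>"
proof -
  obtain M r where a: "0 \<le> M" "0 < r" "\<And>x y. x \<in> X \<Longrightarrow> y \<in> X \<Longrightarrow> cmod (\<alpha> x y) \<le> M"
    "\<And>x y. x \<in> X \<Longrightarrow> y \<in> X \<Longrightarrow> d x y > r \<Longrightarrow> \<alpha> x y = 0" using fp_E[OF assms(1)] by blast
  obtain M' r' where b: "0 \<le> M'" "0 < r'" "\<And>x y. x \<in> X \<Longrightarrow> y \<in> X \<Longrightarrow> cmod (\<beta> x y) \<le> M'"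
    "\<And>x y. x \<in> X \<Longrightarrow> y \<in> X \<Longrightarrow> d x y > r' \<Longrightarrow> \<beta> x y = 0" using fp_E[OF assms(2)] by blast
  obtain N where N: "\<And>x. x \<in> X \<Longrightarrow> finite {y\<in>X. d x y \<le> r}" "\<And>x. x \<in> X \<Longrightarrow> card {y\<in>X. d x y \<le> r} \<le> N"
    using ball_bound[of r] by blast
  define R where "R x = {y\<in>X. d x y \<le> r}" for x
  define \<gamma> where "\<gamma> x y = (\<Sum>z\<in>R x. \<alpha> x z * \<beta> z y)" for x y
  have \<gamma>: "\<gamma> \<in> finite_propagation X d"
  proof (rule fp_I[of "real N * (M * M')" _ "r + r'"])
    show "0 \<le> real N * (M * M')" using a b by simp
    fix x y assume xy: "x \<in> X" "y \<in> X"
    have "cmod (\<gamma> x y) \<le> real (card (R x)) * (M * M')"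
      unfolding \<gamma>_def by (rule sum_norm_bound) (use a b xy in \<open>auto simp: R_def norm_mult intro!: mult_mono\<close>)
    also have "\<dots> \<le> real N * (M * M')"
      by (rule mult_right_mono) (use N(2)[OF xy(1)] a b in \<open>auto simp: R_def\<close>)
    finally show "cmod (\<gamma> x y) \<le> real N * (M * M')" .
    assume "d x y > r + r'"
    then have "\<beta> z y = 0" if "z \<in> R x" for z
      using that triangle[of x z y] xy by (intro b(4)) (auto simp: R_def)
    then show "\<gamma> x y = 0" unfolding \<gamma>_def by simp
  qed
  have "matrix_operator X \<alpha> \<circ> matrix_operator X \<beta> = matrix_operator X \<gamma>"
    by (rule matrix_operator_comp[OF fp_bop[OF assms(1)] fp_bop[OF assms(2)] fp_bop[OF \<gamma>], where R=R])
       (simp_all add: N R_def \<gamma>_def a(4))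
  with \<gamma> that show ?thesis by blast
qed

section \<open>The norm closure and its algebraic operations\<close>

lemma roe_approx:
  assumes "T \<in> Roe" "e > 0"
  obtains \<alpha> where "\<alpha> \<in> finite_propagation X d" "op_norm X (\<lambda>f x. T f x - matrix_operator X \<alpha> f x) < e"
  using assms unfolding Roe_def by blast

text \<open>A norm closure is closed. To show that an operation stays in \<open>Roe\<close> it
  therefore suffices to approximate its result by elements of \<open>Roe\<close>, with a non-strict
  bound.\<close>

lemma roe_closed:
  assumes T: "T \<in> bounded_operators X"
    and S: "\<And>e. e > 0 \<Longrightarrow> \<exists>S\<in>Roe. op_norm X (\<lambda>f x. T f x - S f x) \<le> e"
  shows "T \<in> Roe"
  unfolding Roe_def
proof (intro CollectI conjI T allI impI)
  fix e :: real assume e: "e > 0"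
  obtain S where S: "S \<in> Roe" "op_norm X (\<lambda>f x. T f x - S f x) \<le> e/2" using S[of "e/2"] e by auto
  obtain \<alpha> where \<alpha>: "\<alpha> \<in> finite_propagation X d" "op_norm X (\<lambda>f x. S f x - matrix_operator X \<alpha> f x) < e/2"
    using roe_approx[OF S(1), of "e/2"] e by auto
  have "op_norm X (\<lambda>f x. (T f x - S f x) + (S f x - matrix_operator X \<alpha> f x)) < e"
    using op_norm_plus[OF bop_minus[OF T roe_bop[OF S(1)]] bop_minus[OF roe_bop[OF S(1)] fp_bop[OF \<alpha>(1)]]]
      S(2) \<alpha>(2) by linarith
  then show "\<exists>\<alpha>\<in>finite_propagation X d. op_norm X (\<lambda>f x. T f x - matrix_operator X \<alpha> f x) < e"
    using \<alpha>(1) by (intro bexI[of _ \<alpha>]) simp_all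
qed

lemma roe_plus:
  assumes S: "S \<in> Roe" and T: "T \<in> Roe"
  shows "(\<lambda>f x. S f x + T f x) \<in> Roe"
proof (rule roe_closed[OF bop_plus[OF roe_bop[OF S] roe_bop[OF T]]])
  fix e :: real assume e: "e > 0"
  obtain \<alpha> where a: "\<alpha> \<in> finite_propagation X d" "op_norm X (\<lambda>f x. S f x - matrix_operator X \<alpha> f x) < e/2"
    using roe_approx[OF S, of "e/2"] e by auto
  obtain \<beta> where b: "\<beta> \<in> finite_propagation X d" "op_norm X (\<lambda>f x. T f x - matrix_operator X \<beta> f x) < e/2"
    using roe_approx[OF T, of "e/2"] e by auto
  let ?g = "matrix_operator X (\<lambda>x y. \<alpha> x y + \<beta> x y)"
  have "(\<lambda>f x. S f x + T f x - ?g f x) =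
      (\<lambda>f x. (S f x - matrix_operator X \<alpha> f x) + (T f x - matrix_operator X \<beta> f x))"
    unfolding fp_plus(2)[OF a(1) b(1)] by (simp add: algebra_simps)
  then have "op_norm X (\<lambda>f x. S f x + T f x - ?g f x) \<le> e"
    using op_norm_plus[OF bop_minus[OF roe_bop[OF S] fp_bop[OF a(1)]] bop_minus[OF roe_bop[OF T] fp_bop[OF b(1)]]]
      a(2) b(2) by simp
  then show "\<exists>U\<in>Roe. op_norm X (\<lambda>f x. S f x + T f x - U f x) \<le> e"
    using fp_roe[OF fp_plus(1)[OF a(1) b(1)]] by blast
qed

lemma roe_scale:
  assumes T: "T \<in> Roe"
  shows "(\<lambda>f x. c * T f x) \<in> Roe"
proof (rule roe_closed[OF bop_scale[OF roe_bop[OF T]]])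
  fix e :: real assume e: "e > 0"
  have c: "cmod c + 1 > 0" by (simp add: add_nonneg_pos)
  obtain \<alpha> where a: "\<alpha> \<in> finite_propagation X d"
      "op_norm X (\<lambda>f x. T f x - matrix_operator X \<alpha> f x) < e / (cmod c + 1)"
    using roe_approx[OF T, of "e / (cmod c + 1)"] e c by auto
  let ?g = "matrix_operator X (\<lambda>x y. c * \<alpha> x y)"
  have "(\<lambda>f x. c * T f x - ?g f x) = (\<lambda>f x. c * (T f x - matrix_operator X \<alpha> f x))"
    unfolding fp_scale(2)[OF a(1)] by (simp add: algebra_simps)
  then have "op_norm X (\<lambda>f x. c * T f x - ?g f x) \<le> cmod c * op_norm X (\<lambda>f x. T f x - matrix_operator X \<alpha> f x)"
    using op_norm_scale_le[OF bop_minus[OF roe_bop[OF T] fp_bop[OF a(1)]], of c] by simp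
  also have "\<dots> \<le> (cmod c + 1) * (e / (cmod c + 1))"
    by (rule mult_mono) (use a(2) op_norm_nonneg[OF bop_minus[OF roe_bop[OF T] fp_bop[OF a(1)]]] in auto)
  also have "\<dots> = e" using c by simp
  finally show "\<exists>U\<in>Roe. op_norm X (\<lambda>f x. c * T f x - U f x) \<le> e"
    using fp_roe[OF fp_scale(1)[OF a(1)]] by blast
qed

lemma roe_uminus: "T \<in> Roe \<Longrightarrow> (\<lambda>f x. - T f x) \<in> Roe"
  using roe_scale[of T "-1"] by simp

lemma roe_minus: "S \<in> Roe \<Longrightarrow> T \<in> Roe \<Longrightarrow> (\<lambda>f x. S f x - T f x) \<in> Roe"
  using roe_plus[OF _ roe_uminus, of S T] by simp

lemma fp_0: "(\<lambda>x y. 0) \<in> finite_propagation X d"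
  by (rule fp_I[of 0 _ 1]) auto

lemma roe_0: "(\<lambda>f x. 0) \<in> Roe"
  using roe_scale[OF fp_roe[OF fp_0], of 0] by simp

lemma roe_id: "(\<lambda>f. if f \<in> ell2 X then f else (\<lambda>x. 0)) \<in> Roe"
proof -
  let ?i = "\<lambda>x y. if x = y then 1 else (0::complex)"
  have i: "?i \<in> finite_propagation X d" by (rule fp_I[of 1 _ 1]) auto
  have "(\<lambda>f. if f \<in> ell2 X then f else (\<lambda>x. 0)) = matrix_operator X ?i"
    by (rule bop_eqI[OF bop_id fp_bop[OF i]]) (simp add: matrix_operator_entry delta_def[symmetric], simp add: delta_def)
  then show ?thesis using fp_roe[OF i] by simp
qed

lemma roe_sum: "(\<And>i. i \<in> I \<Longrightarrow> T i \<in> Roe) \<Longrightarrow> (\<lambda>f x. \<Sum>i\<in>I. T i f x) \<in> Roe"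
  by (induction I rule: infinite_finite_induct) (simp_all add: roe_plus roe_0)

lemma roe_adjoint:
  assumes T: "T \<in> Roe"
  shows "op_adjoint X T \<in> Roe"
proof (rule roe_closed[OF op_adjoint_bop[OF roe_bop[OF T]]])
  fix e :: real assume e: "e > 0"
  obtain \<alpha> where a: "\<alpha> \<in> finite_propagation X d" "op_norm X (\<lambda>f x. T f x - matrix_operator X \<alpha> f x) < e"
    using roe_approx[OF T e] by auto
  let ?m = "matrix_operator X \<alpha>"
  have m: "(\<lambda>f x. - 1 * ?m f x) \<in> bounded_operators X" by (rule bop_scale[OF fp_bop[OF a(1)]])
  have "(\<lambda>f x. op_adjoint X T f x - op_adjoint X ?m f x) = op_adjoint X (\<lambda>f x. T f x + (- 1 * ?m f x))"
    unfolding op_adjoint_plus[OF roe_bop[OF T] m] op_adjoint_scale[OF fp_bop[OF a(1)]] by simp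
  also have "\<dots> = op_adjoint X (\<lambda>f x. T f x - ?m f x)" by simp
  finally have "op_norm X (\<lambda>f x. op_adjoint X T f x - op_adjoint X ?m f x) \<le> e"
    using op_norm_adjoint_le[OF bop_minus[OF roe_bop[OF T] fp_bop[OF a(1)]]] a(2) by simp
  moreover have "op_adjoint X ?m \<in> Roe"
    unfolding fp_adjoint(2)[OF a(1)] by (rule fp_roe[OF fp_adjoint(1)[OF a(1)]])
  ultimately show "\<exists>S\<in>Roe. op_norm X (\<lambda>f x. op_adjoint X T f x - S f x) \<le> e"
    by (rule bexI)
qed

lemma roe_comp:
  assumes S: "S \<in> Roe" and T: "T \<in> Roe"
  shows "S \<circ> T \<in> Roe"
proof (rule roe_closed[OF bop_comp[OF roe_bop[OF S] roe_bop[OF T]]])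
  fix e :: real assume e: "e > 0"
  note Sb = roe_bop[OF S] and Tb = roe_bop[OF T]
  let ?a = "op_norm X S" and ?b = "op_norm X T"
  have ab: "0 \<le> ?a" "0 \<le> ?b" by (simp_all add: op_norm_nonneg Sb Tb)
  have half: "(t + 1) * (e / (2 * (t + 1))) = e / 2" if "0 \<le> t" for t :: real
    using that by (simp add: field_simps)
  \<comment> \<open>The error of the product is
    \<open>S (T - \<beta>) + (S - \<alpha>) \<beta>\<close>. Hence \<beta> is chosen first, against
    the norm of \<open>S\<close>, and \<alpha> afterwards, against the norm of the operator of
    \<beta>.\<close>
  obtain \<beta> where b: "\<beta> \<in> finite_propagation X d"
      "op_norm X (\<lambda>f x. T f x - matrix_operator X \<beta> f x) < e / (2 * (?a + 1))"
    using roe_approx[OF T, of "e / (2 * (?a + 1))"] e ab by auto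
  let ?\<beta> = "matrix_operator X \<beta>"
  note \<beta> = fp_bop[OF b(1)]
  have bn: "0 \<le> op_norm X ?\<beta>" by (rule op_norm_nonneg[OF \<beta>])
  obtain \<alpha> where a: "\<alpha> \<in> finite_propagation X d"
      "op_norm X (\<lambda>f x. S f x - matrix_operator X \<alpha> f x) < e / (2 * (op_norm X ?\<beta> + 1))"
    using roe_approx[OF S, of "e / (2 * (op_norm X ?\<beta> + 1))"] e bn by auto
  let ?\<alpha> = "matrix_operator X \<alpha>"
  note \<alpha> = fp_bop[OF a(1)]
  let ?D = "\<lambda>f x. T f x - ?\<beta> f x" and ?E = "\<lambda>f x. S f x - ?\<alpha> f x"
  have D: "?D \<in> bounded_operators X" and E: "?E \<in> bounded_operators X" by (rule bop_minus[OF Tb \<beta>], rule bop_minus[OF Sb \<alpha>])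
  have "(\<lambda>f x. (S \<circ> T) f x - (?\<alpha> \<circ> ?\<beta>) f x) = (\<lambda>f x. (S \<circ> ?D) f x + (?E \<circ> ?\<beta>) f x)"
  proof (intro ext)
    fix f x show "(S \<circ> T) f x - (?\<alpha> \<circ> ?\<beta>) f x = (S \<circ> ?D) f x + (?E \<circ> ?\<beta>) f x"
    proof (cases "f \<in> ell2 X")
      case True
      show ?thesis using fun_cong[OF bop_diff[OF Sb bop_ell2[OF Tb True] bop_ell2[OF \<beta> True]], of x] by simp
    next
      case False
      then show ?thesis by (simp add: bop_outside[OF Tb] bop_outside[OF \<beta>] bop_zero[OF Sb])
    qed
  qed
  then have "op_norm X (\<lambda>f x. (S \<circ> T) f x - (?\<alpha> \<circ> ?\<beta>) f x) \<le> op_norm X (S \<circ> ?D) + op_norm X (?E \<circ> ?\<beta>)"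
    using op_norm_plus[OF bop_comp[OF Sb D] bop_comp[OF E \<beta>]] by (simp only:)
  also have "\<dots> \<le> ?a * op_norm X ?D + op_norm X ?E * op_norm X ?\<beta>"
    by (intro add_mono op_norm_comp Sb D E \<beta>)
  also have "\<dots> \<le> (?a + 1) * (e / (2 * (?a + 1))) + (e / (2 * (op_norm X ?\<beta> + 1))) * (op_norm X ?\<beta> + 1)"
    by (intro add_mono mult_mono less_imp_le[OF a(2)] less_imp_le[OF b(2)])
       (use ab bn e op_norm_nonneg[OF D] op_norm_nonneg[OF E] in \<open>simp_all del: of_real_add\<close>)
  also have "\<dots> = e"
    using half[OF ab(1)] half[OF bn] by (simp only: mult.commute[of _ "op_norm X ?\<beta> + 1"])
  finally have le: "op_norm X (\<lambda>f x. (S \<circ> T) f x - (?\<alpha> \<circ> ?\<beta>) f x) \<le> e" .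
  obtain \<gamma> where \<gamma>: "\<gamma> \<in> finite_propagation X d" "?\<alpha> \<circ> ?\<beta> = matrix_operator X \<gamma>"
    using fp_comp[OF a(1) b(1)] by blast
  show "\<exists>U\<in>Roe. op_norm X (\<lambda>f x. (S \<circ> T) f x - U f x) \<le> e"
  proof (rule bexI)
    show "op_norm X (\<lambda>f x. (S \<circ> T) f x - matrix_operator X \<gamma> f x) \<le> e" using le \<gamma>(2) by simp
    show "matrix_operator X \<gamma> \<in> Roe" by (rule fp_roe[OF \<gamma>(1)])
  qed
qed

section \<open>Addition, subtraction and finite sums in the record\<close>

lemma roe_abelian_group: "abelian_group A"
proof (rule abelian_groupI)
  fix T assume "T \<in> carrier A"
  then show "\<exists>S\<in>carrier A. S \<oplus>\<^bsub>A\<^esub> T = \<zero>\<^bsub>A\<^esub>"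
    by (intro bexI[of _ "\<lambda>f x. - T f x"]) (auto intro: roe_uminus)
qed (simp_all add: roe_plus roe_0 ac_simps)

lemma roe_a_minus:
  assumes "S \<in> Roe" "T \<in> Roe"
  shows "S \<ominus>\<^bsub>A\<^esub> T = (\<lambda>f x. S f x - T f x)"
proof -
  interpret abelian_group A by (rule roe_abelian_group)
  have "\<ominus>\<^bsub>A\<^esub> T = (\<lambda>f x. - T f x)"
    by (rule minus_equality) (use assms roe_uminus in auto)
  then show ?thesis by (simp add: a_minus_def)
qed

lemma roe_finsum:
  assumes "finite I" "\<And>i. i \<in> I \<Longrightarrow> T i \<in> Roe"
  shows "finsum A T I = (\<lambda>f x. \<Sum>i\<in>I. T i f x)"
proof -
  interpret abelian_group A by (rule roe_abelian_group)
  show ?thesis using assms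
    by (induction I rule: finite_induct) (simp_all add: finsum_insert Pi_def)
qed

end

section \<open>Sums of squares in matrix algebras over the uniform Roe algebra\<close>

text \<open>The action of an \<open>n\<close> by \<open>n\<close> operator matrix on columns of
  vectors, that is, on the direct sum of \<open>n\<close> copies of the Hilbert space;
  \<open>cnorm\<close> is the norm of that direct sum.\<close>

definition mapp :: "nat \<Rightarrow> (nat \<Rightarrow> nat \<Rightarrow> ('x \<Rightarrow> complex) \<Rightarrow> ('x \<Rightarrow> complex)) \<Rightarrow>
    (nat \<Rightarrow> 'x \<Rightarrow> complex) \<Rightarrow> nat \<Rightarrow> 'x \<Rightarrow> complex" where
  "mapp n b u i = (\<lambda>x. \<Sum>j<n. b i j (u j) x)"

definition cnorm :: "'x set \<Rightarrow> nat \<Rightarrow> (nat \<Rightarrow> 'x \<Rightarrow> complex) \<Rightarrow> real" where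
  "cnorm X n u = L2_set (\<lambda>j. ell2_norm X (u j)) {..<n}"

lemma cnorm_nonneg [simp]: "0 \<le> cnorm X n u"
  by (simp add: cnorm_def L2_set_nonneg)

lemma cnorm_sq: "(cnorm X n u)\<^sup>2 = (\<Sum>j<n. (ell2_norm X (u j))\<^sup>2)"
  by (simp add: cnorm_def L2_set_def sum_nonneg)

lemma cnorm_cong: "(\<And>j. j < n \<Longrightarrow> u j = v j) \<Longrightarrow> cnorm X n u = cnorm X n v"
  by (auto simp: cnorm_def intro!: L2_set_cong)

lemma cnorm_triangle:
  assumes "\<And>j. j < n \<Longrightarrow> u j \<in> ell2 X" "\<And>j. j < n \<Longrightarrow> v j \<in> ell2 X"
  shows "cnorm X n (\<lambda>i x. u i x + v i x) \<le> cnorm X n u + cnorm X n v"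
proof -
  have "cnorm X n (\<lambda>i x. u i x + v i x) \<le> L2_set (\<lambda>j. ell2_norm X (u j) + ell2_norm X (v j)) {..<n}"
    unfolding cnorm_def by (rule L2_set_mono) (simp_all add: ell2_norm_triangle assms)
  also have "\<dots> \<le> cnorm X n u + cnorm X n v" unfolding cnorm_def by (rule L2_set_triangle_ineq)
  finally show ?thesis .
qed

lemma cnorm_scale: "cnorm X n (\<lambda>i x. c * u i x) = cmod c * cnorm X n u"
  unfolding cnorm_def by (simp add: ell2_norm_smult L2_set_right_distrib)

lemma cnorm_coord: "i < n \<Longrightarrow> ell2_norm X (u i) \<le> cnorm X n u"
  unfolding cnorm_def by (rule member_le_L2_set) auto

lemma cnorm_single:
  assumes "j < n"
  shows "cnorm X n (\<lambda>l. if l = j then f else (\<lambda>x. 0)) = ell2_norm X f"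
proof -
  have "(cnorm X n (\<lambda>l. if l = j then f else (\<lambda>x. 0)))\<^sup>2 = (\<Sum>l<n. if l = j then (ell2_norm X f)\<^sup>2 else 0)"
    unfolding cnorm_sq by (intro sum.cong) auto
  also have "\<dots> = (ell2_norm X f)\<^sup>2" using assms by simp
  finally show ?thesis by (simp add: power2_eq_iff_nonneg)
qed

lemma mapp_ell2:
  assumes "\<And>j. j < n \<Longrightarrow> b i j \<in> bounded_operators X" "\<And>j. j < n \<Longrightarrow> u j \<in> ell2 X"
  shows "mapp n b u i \<in> ell2 X"
  unfolding mapp_def by (rule ell2_sum) (simp add: bop_ell2[OF assms(1) assms(2)])

lemma mapp_diff:
  assumes "\<And>j. j < n \<Longrightarrow> b i j \<in> bounded_operators X" "\<And>j. j < n \<Longrightarrow> u j \<in> ell2 X"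
    "\<And>j. j < n \<Longrightarrow> v j \<in> ell2 X"
  shows "mapp n b (\<lambda>j x. u j x - v j x) i = (\<lambda>x. mapp n b u i x - mapp n b v i x)"
  unfolding mapp_def by (simp add: bop_diff[OF assms(1) assms(2) assms(3)] sum_subtractf)

lemma mapp_mapp:
  assumes b: "\<And>j. j < n \<Longrightarrow> b i j \<in> bounded_operators X"
    and c: "\<And>i j. i < n \<Longrightarrow> j < n \<Longrightarrow> c i j \<in> bounded_operators X" and u: "\<And>j. j < n \<Longrightarrow> u j \<in> ell2 X"
  shows "mapp n b (mapp n c u) i = (\<lambda>x. \<Sum>j<n. \<Sum>l<n. b i l (c l j (u j)) x)"
proof
  fix x
  have "b i l (mapp n c u l) x = (\<Sum>j<n. b i l (c l j (u j)) x)" if "l < n" for l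
    unfolding mapp_def by (subst bop_sum[OF b[OF that]]) (simp_all add: bop_ell2[OF c u] that)
  then have "mapp n b (mapp n c u) i x = (\<Sum>l<n. \<Sum>j<n. b i l (c l j (u j)) x)"
    unfolding mapp_def[of n b] by simp
  also have "\<dots> = (\<Sum>j<n. \<Sum>l<n. b i l (c l j (u j)) x)" by (rule sum.swap)
  finally show "mapp n b (mapp n c u) i x = (\<Sum>j<n. \<Sum>l<n. b i l (c l j (u j)) x)" .
qed

text \<open>Norms of operator matrices enter only through upper bounds, so a predicate takes the
  place of a norm.\<close>

definition mbound :: "'x set \<Rightarrow> nat \<Rightarrow> real \<Rightarrow> (nat \<Rightarrow> nat \<Rightarrow> ('x \<Rightarrow> complex) \<Rightarrow> ('x \<Rightarrow> complex)) \<Rightarrow> bool" where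
  "mbound X n K b \<longleftrightarrow> (\<forall>u. (\<forall>j<n. u j \<in> ell2 X) \<longrightarrow> cnorm X n (mapp n b u) \<le> K * cnorm X n u)"

lemma mboundD: "mbound X n K b \<Longrightarrow> (\<And>j. j < n \<Longrightarrow> u j \<in> ell2 X) \<Longrightarrow> cnorm X n (mapp n b u) \<le> K * cnorm X n u"
  unfolding mbound_def by blast

text \<open>Test columns with a single nonzero component. Bounds for matrices thus become bounds for
  entries, so that completeness of the bounded operators on \<open>ell2 X\<close> yields limits of
  matrices.\<close>

lemma mbound_entry:
  assumes K: "mbound X n K b" "0 \<le> K" and ij: "i < n" "j < n"
    and b: "\<And>j. j < n \<Longrightarrow> b i j \<in> bounded_operators X"
  shows "op_norm X (b i j) \<le> K"
proof (rule op_norm_le[OF _ K(2)])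
  fix f assume f: "f \<in> ell2 X"
  let ?u = "\<lambda>l. if l = j then f else (\<lambda>x. 0)"
  have "mapp n b ?u i = (\<lambda>x. \<Sum>l<n. if l = j then b i j f x else 0)"
    unfolding mapp_def by (intro ext sum.cong refl) (simp add: bop_zero[OF b])
  then have "b i j f = mapp n b ?u i" using ij by simp
  then have "ell2_norm X (b i j f) \<le> cnorm X n (mapp n b ?u)" using cnorm_coord[OF ij(1)] by simp
  also have "\<dots> \<le> K * cnorm X n ?u" by (rule mboundD[OF K(1)]) (simp add: f)
  finally show "ell2_norm X (b i j f) \<le> K * ell2_norm X f" by (simp add: cnorm_single[OF ij(2)])
qed

subsection \<open>The square root iteration\<close>

text \<open>
  The limit of \<open>y \<mapsto> (s + y\<^sup>2) / 2\<close> satisfies \<open>(1 - y)\<^sup>2 = 1 - s\<close>. Starting from \<open>0\<close>, the norms of the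
  increments are bounded by the increments of the same iteration for the number \<open>s = 1\<close>, which
  converges monotonically; no functional calculus is needed.
\<close>

primrec sqrt_iter :: "nat \<Rightarrow> (nat \<Rightarrow> nat \<Rightarrow> ('x \<Rightarrow> complex) \<Rightarrow> ('x \<Rightarrow> complex)) \<Rightarrow> nat \<Rightarrow>
    nat \<Rightarrow> nat \<Rightarrow> ('x \<Rightarrow> complex) \<Rightarrow> ('x \<Rightarrow> complex)" where
  "sqrt_iter n s 0 = (\<lambda>i j f x. 0)"
| "sqrt_iter n s (Suc k) = (\<lambda>i j f x. 1/2 * (s i j f x + (\<Sum>l<n. (sqrt_iter n s k i l \<circ> sqrt_iter n s k l j) f x)))"

primrec sqrt_real_iter :: "nat \<Rightarrow> real" where
  "sqrt_real_iter 0 = 0"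
| "sqrt_real_iter (Suc k) = (1 + (sqrt_real_iter k)\<^sup>2) / 2"

lemma sqrt_real_iter_bounds: "0 \<le> sqrt_real_iter k \<and> sqrt_real_iter k \<le> 1"
  by (induction k) (auto simp: power_le_one)

lemma sqrt_real_iter_mono: "sqrt_real_iter k \<le> sqrt_real_iter (Suc k)"
proof -
  have "0 \<le> (1 - sqrt_real_iter k)\<^sup>2" by simp
  then show ?thesis by (simp add: power2_eq_square algebra_simps)
qed

lemma sqrt_real_iter_incseq: "incseq sqrt_real_iter"
  using sqrt_real_iter_mono by (rule incseq_SucI)

lemma sqrt_real_iter_Cauchy: "Cauchy sqrt_real_iter"
proof -
  have "Bseq sqrt_real_iter"
    by (rule BseqI'[where K=1]) (simp add: sqrt_real_iter_bounds)
  then have "convergent sqrt_real_iter"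
    by (rule Bseq_mono_convergent) (use sqrt_real_iter_incseq in \<open>auto simp: incseq_def\<close>)
  then show ?thesis by (simp add: Cauchy_convergent_iff)
qed

context
  fixes X :: "'x set" and n :: nat and s :: "nat \<Rightarrow> nat \<Rightarrow> ('x \<Rightarrow> complex) \<Rightarrow> ('x \<Rightarrow> complex)"
  assumes s: "\<And>i j. i < n \<Longrightarrow> j < n \<Longrightarrow> s i j \<in> bounded_operators X"
    and s_adj: "\<And>i j. i < n \<Longrightarrow> j < n \<Longrightarrow> op_adjoint X (s i j) = s j i"
    and s_bound: "mbound X n 1 s"
begin

lemma iter_bop: "i < n \<Longrightarrow> j < n \<Longrightarrow> sqrt_iter n s k i j \<in> bounded_operators X"
proof (induction k arbitrary: i j)
  case (Suc k)
  show ?case unfolding sqrt_iter.simps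
    by (intro bop_scale bop_plus bop_sum_ops bop_comp s) (use Suc in auto)
qed (simp add: bop_0)

text \<open>The square of a self-adjoint matrix is self-adjoint: taking adjoints reverses each
  product of entries and swaps its outer indices.\<close>

lemma iter_adjoint: "i < n \<Longrightarrow> j < n \<Longrightarrow> op_adjoint X (sqrt_iter n s k i j) = sqrt_iter n s k j i"
proof (induction k arbitrary: i j)
  case (Suc k)
  have c: "sqrt_iter n s k i l \<circ> sqrt_iter n s k l j \<in> bounded_operators X" if "l \<in> {..<n}" for l
    using that Suc.prems by (intro bop_comp iter_bop) auto
  have "op_adjoint X (sqrt_iter n s k i l \<circ> sqrt_iter n s k l j) = sqrt_iter n s k j l \<circ> sqrt_iter n s k l i" if "l < n" for l
    using that Suc.prems by (subst op_adjoint_comp) (simp_all add: iter_bop Suc.IH)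
  then have "(\<lambda>f x. \<Sum>l<n. op_adjoint X (sqrt_iter n s k i l \<circ> sqrt_iter n s k l j) f x) = (\<lambda>f x. \<Sum>l<n. (sqrt_iter n s k j l \<circ> sqrt_iter n s k l i) f x)"
    by (intro ext sum.cong refl) (simp del: o_apply)
  note sm = this
  let ?S = "\<lambda>f x. \<Sum>l<n. (sqrt_iter n s k i l \<circ> sqrt_iter n s k l j) f x"
  have S: "?S \<in> bounded_operators X" by (rule bop_sum_ops) (rule c)
  have aS: "op_adjoint X ?S = (\<lambda>f x. \<Sum>l<n. (sqrt_iter n s k j l \<circ> sqrt_iter n s k l i) f x)"
    unfolding sm[symmetric] by (rule op_adjoint_sum) (rule c)
  have "op_adjoint X (\<lambda>f x. 1/2 * (s i j f x + ?S f x)) =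
      (\<lambda>f x. cnj (1/2) * op_adjoint X (\<lambda>f x. s i j f x + ?S f x) f x)"
    by (rule op_adjoint_scale[OF bop_plus[OF s[OF Suc.prems] S]])
  also have "\<dots> = (\<lambda>f x. 1/2 * (s j i f x + (\<Sum>l<n. (sqrt_iter n s k j l \<circ> sqrt_iter n s k l i) f x)))"
    by (simp only: op_adjoint_plus[OF s[OF Suc.prems] S] aS s_adj[OF Suc.prems]) simp
  finally show ?case unfolding sqrt_iter.simps .
qed (simp add: op_adjoint_0)

lemma mapp_iter_ell2: "i < n \<Longrightarrow> (\<And>j. j < n \<Longrightarrow> u j \<in> ell2 X) \<Longrightarrow> mapp n (sqrt_iter n s k) u i \<in> ell2 X"
  by (rule mapp_ell2) (simp_all add: iter_bop)

lemma mapp_iter_Suc: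
  assumes i: "i < n" and u: "\<And>j. j < n \<Longrightarrow> u j \<in> ell2 X"
  shows "mapp n (sqrt_iter n s (Suc k)) u i = (\<lambda>x. 1/2 * (mapp n s u i x + mapp n (sqrt_iter n s k) (mapp n (sqrt_iter n s k) u) i x))"
proof -
  have *: "mapp n (sqrt_iter n s k) (mapp n (sqrt_iter n s k) u) i = (\<lambda>x. \<Sum>j<n. \<Sum>l<n. sqrt_iter n s k i l (sqrt_iter n s k l j (u j)) x)"
    by (rule mapp_mapp[where X=X]) (simp_all add: iter_bop i u)
  show ?thesis unfolding * unfolding mapp_def
    by (simp add: sum.distrib sum_distrib_left[symmetric] sum_divide_distrib[symmetric])
qed

text \<open>From \<open>y\<close> to \<open>(s + y^2) / 2\<close> the norm obeys the scalar
  recursion, because \<open>s\<close> has norm at most 1.\<close>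

lemma iter_bound: "mbound X n (sqrt_real_iter k) (sqrt_iter n s k)"
proof (induction k)
  case 0
  have "cnorm X n (mapp n (sqrt_iter n s 0) u) = 0" for u
    by (simp add: mapp_def cnorm_def L2_set_def)
  then show ?case unfolding mbound_def by simp
next
  case (Suc k)
  show ?case unfolding mbound_def
  proof (intro allI impI)
    fix u assume "\<forall>j<n. u j \<in> ell2 X"
    then have u: "\<And>j. j < n \<Longrightarrow> u j \<in> ell2 X" by blast
    have m: "mapp n (sqrt_iter n s k) u i \<in> ell2 X" if "i < n" for i by (rule mapp_iter_ell2[OF that u])
    have "cnorm X n (mapp n (sqrt_iter n s (Suc k)) u) =
        cnorm X n (\<lambda>i x. 1/2 * (mapp n s u i x + mapp n (sqrt_iter n s k) (mapp n (sqrt_iter n s k) u) i x))"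
      by (rule cnorm_cong) (rule mapp_iter_Suc[OF _ u])
    also have "\<dots> = 1/2 * cnorm X n (\<lambda>i x. mapp n s u i x + mapp n (sqrt_iter n s k) (mapp n (sqrt_iter n s k) u) i x)"
      by (subst cnorm_scale) simp
    also have "\<dots> \<le> 1/2 * (cnorm X n (mapp n s u) + cnorm X n (mapp n (sqrt_iter n s k) (mapp n (sqrt_iter n s k) u)))"
      by (intro mult_left_mono cnorm_triangle mapp_ell2 iter_bop s u m) auto
    also have "\<dots> \<le> 1/2 * (1 * cnorm X n u + sqrt_real_iter k * (sqrt_real_iter k * cnorm X n u))"
      by (intro mult_left_mono add_mono mboundD[OF s_bound u]
          order_trans[OF mboundD[OF Suc.IH m]] mboundD[OF Suc.IH u])
         (use sqrt_real_iter_bounds in auto)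
    also have "\<dots> = sqrt_real_iter (Suc k) * cnorm X n u" by (simp add: algebra_simps power2_eq_square)
    finally show "cnorm X n (mapp n (sqrt_iter n s (Suc k)) u) \<le> sqrt_real_iter (Suc k) * cnorm X n u" .
  qed
qed

text \<open>For consecutive iterates \<open>y\<close> and \<open>z\<close>, the identity
  \<open>z^2 - y^2 = z (z - y) + (z - y) y\<close> holds without commutativity. Taking norms gives
  the same factorisation of the scalar increment, so the scalar sequence dominates.\<close>

lemma iter_diff_step:
  assumes u: "\<And>j. j < n \<Longrightarrow> u j \<in> ell2 X"
  shows "cnorm X n (\<lambda>i x. mapp n (sqrt_iter n s (Suc k)) u i x - mapp n (sqrt_iter n s k) u i x) \<le> (sqrt_real_iter (Suc k) - sqrt_real_iter k) * cnorm X n u"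
  using u
proof (induction k arbitrary: u)
  case 0
  have "cnorm X n (\<lambda>i x. mapp n (sqrt_iter n s (Suc 0)) u i x - mapp n (sqrt_iter n s 0) u i x) = cnorm X n (\<lambda>i x. 1/2 * mapp n s u i x)"
    by (rule cnorm_cong) (simp add: mapp_def sum_divide_distrib)
  also have "\<dots> = 1/2 * cnorm X n (mapp n s u)" by (subst cnorm_scale) simp
  also have "\<dots> \<le> 1/2 * (1 * cnorm X n u)" by (intro mult_left_mono mboundD[OF s_bound 0]) auto
  finally show ?case by simp
next
  case (Suc k)
  let ?a = "mapp n (sqrt_iter n s (Suc k))" and ?b = "mapp n (sqrt_iter n s k)"
  have a: "?a u i \<in> ell2 X" and b: "?b u i \<in> ell2 X" if "i < n" for i
    by (rule mapp_iter_ell2[OF that Suc.prems], assumption)+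
  let ?w = "\<lambda>i x. ?a u i x - ?b u i x"
  have w: "\<And>i. i < n \<Longrightarrow> ?w i \<in> ell2 X" by (intro ell2_diff a b)
  have "cnorm X n (\<lambda>i x. mapp n (sqrt_iter n s (Suc (Suc k))) u i x - ?a u i x) =
      cnorm X n (\<lambda>i x. 1/2 * (?a ?w i x + (?a (?b u) i x - ?b (?b u) i x)))"
  proof (rule cnorm_cong)
    fix i assume i: "i < n"
    have "?a ?w i = (\<lambda>x. ?a (?a u) i x - ?a (?b u) i x)"
      by (rule mapp_diff[where X=X]) (simp_all only: iter_bop[OF i] a b)
    then show "(\<lambda>x. mapp n (sqrt_iter n s (Suc (Suc k))) u i x - ?a u i x) =
        (\<lambda>x. 1/2 * (?a ?w i x + (?a (?b u) i x - ?b (?b u) i x)))"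
      by (simp only: mapp_iter_Suc[OF i Suc.prems]) (simp add: algebra_simps)
  qed
  also have "\<dots> = 1/2 * cnorm X n (\<lambda>i x. ?a ?w i x + (?a (?b u) i x - ?b (?b u) i x))"
    by (subst cnorm_scale) simp
  also have "\<dots> \<le> 1/2 * (cnorm X n (?a ?w) + cnorm X n (\<lambda>i x. ?a (?b u) i x - ?b (?b u) i x))"
    by (intro mult_left_mono cnorm_triangle mapp_iter_ell2 ell2_diff w b) auto
  also have "\<dots> \<le> 1/2 * (sqrt_real_iter (Suc k) * ((sqrt_real_iter (Suc k) - sqrt_real_iter k) * cnorm X n u) + (sqrt_real_iter (Suc k) - sqrt_real_iter k) * (sqrt_real_iter k * cnorm X n u))"
    by (intro mult_left_mono add_mono order_trans[OF mboundD[OF iter_bound w]]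
        order_trans[OF Suc.IH[OF b]] Suc.IH[OF Suc.prems] mboundD[OF iter_bound Suc.prems])
       (use sqrt_real_iter_bounds[of "Suc k"] sqrt_real_iter_mono[of k] in auto)
  also have "\<dots> = (sqrt_real_iter (Suc (Suc k)) - sqrt_real_iter (Suc k)) * cnorm X n u"
    by (simp only: sqrt_real_iter.simps(2)[of "Suc k"]) (simp add: algebra_simps power2_eq_square add_divide_distrib)
  finally show ?case .
qed

lemma iter_diff:
  assumes km: "k \<le> m" and u: "\<And>j. j < n \<Longrightarrow> u j \<in> ell2 X"
  shows "cnorm X n (\<lambda>i x. mapp n (sqrt_iter n s m) u i x - mapp n (sqrt_iter n s k) u i x) \<le> (sqrt_real_iter m - sqrt_real_iter k) * cnorm X n u"
  using km
proof (induction m rule: dec_induct)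
  case base
  show ?case by (simp add: cnorm_def L2_set_def)
next
  case (step m)
  have "cnorm X n (\<lambda>i x. (mapp n (sqrt_iter n s (Suc m)) u i x - mapp n (sqrt_iter n s m) u i x) + (mapp n (sqrt_iter n s m) u i x - mapp n (sqrt_iter n s k) u i x)) \<le>
     cnorm X n (\<lambda>i x. mapp n (sqrt_iter n s (Suc m)) u i x - mapp n (sqrt_iter n s m) u i x) + cnorm X n (\<lambda>i x. mapp n (sqrt_iter n s m) u i x - mapp n (sqrt_iter n s k) u i x)"
    by (intro cnorm_triangle ell2_diff mapp_iter_ell2 u)
  also have "\<dots> \<le> (sqrt_real_iter (Suc m) - sqrt_real_iter m) * cnorm X n u + (sqrt_real_iter m - sqrt_real_iter k) * cnorm X n u"
    by (intro add_mono iter_diff_step u step.IH)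
  finally show ?case by (simp add: left_diff_distrib)
qed

lemma iter_diff_norm:
  assumes km: "k \<le> m" and ij: "i < n" "j < n"
  shows "op_norm X (\<lambda>f x. sqrt_iter n s m i j f x - sqrt_iter n s k i j f x) \<le> sqrt_real_iter m - sqrt_real_iter k"
proof -
  have "mbound X n (sqrt_real_iter m - sqrt_real_iter k) (\<lambda>i j f x. sqrt_iter n s m i j f x - sqrt_iter n s k i j f x)"
    unfolding mbound_def
  proof (intro allI impI)
    fix u assume u: "\<forall>j<n. u j \<in> ell2 X"
    have "mapp n (\<lambda>i j f x. sqrt_iter n s m i j f x - sqrt_iter n s k i j f x) u = (\<lambda>i x. mapp n (sqrt_iter n s m) u i x - mapp n (sqrt_iter n s k) u i x)"
      by (simp add: mapp_def fun_eq_iff sum_subtractf)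
    then show "cnorm X n (mapp n (\<lambda>i j f x. sqrt_iter n s m i j f x - sqrt_iter n s k i j f x) u) \<le> (sqrt_real_iter m - sqrt_real_iter k) * cnorm X n u"
      using iter_diff[OF km, of u] u by simp
  qed
  then show ?thesis
    by (rule mbound_entry[where b="\<lambda>i j f x. sqrt_iter n s m i j f x - sqrt_iter n s k i j f x"])
       (use ij km sqrt_real_iter_incseq in \<open>auto simp: incseq_def intro!: bop_minus iter_bop\<close>)
qed

end

section \<open>Passing to the limit in the iteration\<close>

lemma op_norm_tendsto_pointwise:
  assumes T: "\<And>k. T k \<in> bounded_operators X" "T' \<in> bounded_operators X"
    and lim: "(\<lambda>k. op_norm X (\<lambda>f x. T k f x - T' f x)) \<longlonglongrightarrow> 0"
  shows "(\<lambda>k. T k f x) \<longlonglongrightarrow> T' f x"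
proof (cases "f \<in> ell2 X")
  case True
  have D: "(\<lambda>f x. T k f x - T' f x) \<in> bounded_operators X" for k by (rule bop_minus[OF T])
  have "norm (T k f x - T' f x) \<le> op_norm X (\<lambda>f x. T k f x - T' f x) * ell2_norm X f" for k
    using ell2_coord_le[OF bop_ell2[OF D[of k] True], of x] op_norm_bound[OF D[of k] True] by linarith
  moreover have "(\<lambda>k. op_norm X (\<lambda>f x. T k f x - T' f x) * ell2_norm X f) \<longlonglongrightarrow> 0"
    using tendsto_mult_right[OF lim, of "ell2_norm X f"] by simp
  ultimately have "(\<lambda>k. T k f x - T' f x) \<longlonglongrightarrow> 0"
    by (rule Lim_null_comparison[OF always_eventually[OF allI]])
  then show ?thesis by (simp add: LIM_zero_iff)
next
  case False
  then show ?thesis by (simp add: bop_outside[OF T(1)] bop_outside[OF T(2)])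
qed

text \<open>Both factors vary, so the error is split into \<open>S k (T k f - T' f)\<close>,
  controlled by the uniform bound 1, and \<open>S k (T' f) - S' (T' f)\<close>.\<close>

lemma op_norm_tendsto_comp_pointwise:
  assumes S: "\<And>k. S k \<in> bounded_operators X" "S' \<in> bounded_operators X"
    and T: "\<And>k. T k \<in> bounded_operators X" "T' \<in> bounded_operators X"
    and limS: "(\<lambda>k. op_norm X (\<lambda>f x. S k f x - S' f x)) \<longlonglongrightarrow> 0"
    and limT: "(\<lambda>k. op_norm X (\<lambda>f x. T k f x - T' f x)) \<longlonglongrightarrow> 0"
    and one: "\<And>k. op_norm X (S k) \<le> 1" and f: "f \<in> ell2 X"
  shows "(\<lambda>k. S k (T k f) x) \<longlonglongrightarrow> S' (T' f) x"
proof -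
  have D: "(\<lambda>f x. T k f x - T' f x) \<in> bounded_operators X" for k by (rule bop_minus[OF T])
  have "norm (S k (T k f) x - S k (T' f) x) \<le> op_norm X (\<lambda>f x. T k f x - T' f x) * ell2_norm X f" for k
  proof -
    let ?g = "\<lambda>x. T k f x - T' f x"
    have g: "?g \<in> ell2 X" by (rule bop_ell2[OF D f])
    have "S k (T k f) x - S k (T' f) x = S k ?g x"
      by (simp add: bop_diff[OF S(1) bop_ell2[OF T(1) f] bop_ell2[OF T(2) f]])
    then have "norm (S k (T k f) x - S k (T' f) x) \<le> ell2_norm X (S k ?g)"
      using ell2_coord_le[OF bop_ell2[OF S(1) g], of k x] by simp
    also have "\<dots> \<le> op_norm X (S k) * ell2_norm X ?g" by (rule op_norm_bound[OF S(1) g])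
    also have "\<dots> \<le> 1 * ell2_norm X ?g" by (rule mult_right_mono[OF one]) simp
    also have "\<dots> \<le> op_norm X (\<lambda>f x. T k f x - T' f x) * ell2_norm X f" using op_norm_bound[OF D f] by simp
    finally show ?thesis .
  qed
  moreover have "(\<lambda>k. op_norm X (\<lambda>f x. T k f x - T' f x) * ell2_norm X f) \<longlonglongrightarrow> 0"
    using tendsto_mult_right[OF limT, of "ell2_norm X f"] by simp
  ultimately have "(\<lambda>k. S k (T k f) x - S k (T' f) x) \<longlonglongrightarrow> 0"
    by (rule Lim_null_comparison[OF always_eventually[OF allI]])
  from tendsto_add[OF this op_norm_tendsto_pointwise[OF S limS, of "T' f" x]] show ?thesis by simp
qed

context bg_space
begin

text \<open>The equation says \<open>(1 - t)^2 = 1 - s\<close>. All iterates are polynomials in the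
  entries of \<open>s\<close>, hence lie in \<open>Roe\<close>; their entries are Cauchy along with
  the scalar sequence, and the limit stays in \<open>Roe\<close> because \<open>Roe\<close> is norm
  closed.\<close>

lemma roe_matrix_sqrt:
  assumes s: "\<And>i j. i < n \<Longrightarrow> j < n \<Longrightarrow> s i j \<in> Roe"
    and s_adj: "\<And>i j. i < n \<Longrightarrow> j < n \<Longrightarrow> op_adjoint X (s i j) = s j i"
    and s_bound: "mbound X n 1 s"
  shows "\<exists>t. \<forall>i<n. \<forall>j<n. t i j \<in> Roe \<and> op_adjoint X (t i j) = t j i \<and>
    (\<forall>f\<in>ell2 X. \<forall>x. 2 * t i j f x = s i j f x + (\<Sum>l<n. t i l (t l j f) x))"
proof -
  let ?y = "sqrt_iter n s" and ?r = sqrt_real_iter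
  note sb = roe_bop[OF s]
  have yb: "?y k i j \<in> bounded_operators X" if "i < n" "j < n" for k i j
    by (rule iter_bop[OF sb s_adj s_bound that])
  have yR: "?y k i j \<in> Roe" if "i < n" "j < n" for k i j
    using that
  proof (induction k arbitrary: i j)
    case (Suc k)
    show ?case unfolding sqrt_iter.simps
      by (intro roe_scale roe_plus roe_sum roe_comp s Suc) (use Suc.prems in auto)
  qed (simp add: roe_0)
  have y_adj: "op_adjoint X (?y k i j) = ?y k j i" if "i < n" "j < n" for k i j
    by (rule iter_adjoint[OF sb s_adj s_bound that])
  have y_diff: "op_norm X (\<lambda>f x. ?y m i j f x - ?y k i j f x) \<le> \<bar>?r m - ?r k\<bar>" if "i < n" "j < n" for m k i j
  proof (cases "k \<le> m")
    case True
    then show ?thesis using iter_diff_norm[OF sb s_adj s_bound True that] by simp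
  next
    case False
    then have "m \<le> k" by simp
    then show ?thesis using iter_diff_norm[OF sb s_adj s_bound \<open>m \<le> k\<close> that]
      by (subst op_norm_minus_commute) simp
  qed
  \<comment> \<open>Iterate 0 is the zero matrix, so its distance from \<open>?y k\<close> is the
    norm of \<open>?y k\<close>.\<close>
  have y_one: "op_norm X (?y k i j) \<le> 1" if "i < n" "j < n" for k i j
    using y_diff[OF that, of k 0] sqrt_real_iter_bounds[of k] by simp
  have ex: "\<exists>T\<in>bounded_operators X. (\<lambda>k. op_norm X (\<lambda>f x. ?y k i j f x - T f x)) \<longlonglongrightarrow> 0" if ij: "i < n" "j < n" for i j
  proof -
    have "\<exists>N. \<forall>m\<ge>N. \<forall>k\<ge>N. op_norm X (\<lambda>f x. ?y m i j f x - ?y k i j f x) < e" if e: "e > 0" for e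
    proof -
      obtain N where N: "\<forall>m\<ge>N. \<forall>k\<ge>N. norm (?r m - ?r k) < e"
        using CauchyD[OF sqrt_real_iter_Cauchy e] by blast
      show ?thesis
        by (intro exI[of _ N] allI impI, rule le_less_trans[OF y_diff[OF ij]]) (use N in simp)
    qed
    note cau = this
    obtain T where T: "T \<in> bounded_operators X"
      "\<forall>e>0. \<exists>N. \<forall>k\<ge>N. op_norm X (\<lambda>f x. ?y k i j f x - T f x) \<le> e"
    proof -
      have "\<exists>T\<in>bounded_operators X. \<forall>e>0. \<exists>N. \<forall>k\<ge>N. op_norm X (\<lambda>f x. ?y k i j f x - T f x) \<le> e"
        by (rule bounded_operators_complete[of "\<lambda>k. ?y k i j" X, OF yb[OF ij]]) (rule cau)
      then show ?thesis using that by (elim bexE)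
    qed
    have "(\<lambda>k. op_norm X (\<lambda>f x. ?y k i j f x - T f x)) \<longlonglongrightarrow> 0"
    proof (rule LIMSEQ_I)
      fix e :: real assume e: "e > 0"
      obtain N where N: "\<forall>k\<ge>N. op_norm X (\<lambda>f x. ?y k i j f x - T f x) \<le> e/2" using T(2)[rule_format, of "e/2"] e by auto
      have "norm (op_norm X (\<lambda>f x. ?y k i j f x - T f x) - 0) < e" if "k \<ge> N" for k
      proof -
        have "0 \<le> op_norm X (\<lambda>f x. ?y k i j f x - T f x)" by (rule op_norm_nonneg[OF bop_minus[OF yb[OF ij] T(1)]])
        moreover have "op_norm X (\<lambda>f x. ?y k i j f x - T f x) \<le> e/2" using N that by simp
        ultimately show ?thesis using e by simp
      qed
      then show "\<exists>N. \<forall>k\<ge>N. norm (op_norm X (\<lambda>f x. ?y k i j f x - T f x) - 0) < e" by blast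
    qed
    then show ?thesis using T(1) by blast
  qed
  define P where "P i j T \<longleftrightarrow> T \<in> bounded_operators X \<and> (\<lambda>k. op_norm X (\<lambda>f x. ?y k i j f x - T f x)) \<longlonglongrightarrow> 0" for i j T
  define t where "t i j = (SOME T. P i j T)" for i j
  have t: "P i j (t i j)" if ij: "i < n" "j < n" for i j
    unfolding t_def by (rule someI_ex[of "P i j"]) (use ex[OF ij] in \<open>auto simp: P_def\<close>)
  have tb: "t i j \<in> bounded_operators X" and tl: "(\<lambda>k. op_norm X (\<lambda>f x. ?y k i j f x - t i j f x)) \<longlonglongrightarrow> 0"
    if "i < n" "j < n" for i j using t[OF that] unfolding P_def by blast+
  have pt: "(\<lambda>k. ?y k i j f x) \<longlonglongrightarrow> t i j f x" if "i < n" "j < n" for i j f x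
    by (rule op_norm_tendsto_pointwise[OF yb[OF that] tb[OF that] tl[OF that]])
  show ?thesis
  proof (intro exI[of _ t] allI impI conjI ballI)
    fix i j assume ij: "i < n" "j < n"
    show "t i j \<in> Roe"
    proof (rule roe_closed[OF tb[OF ij]])
      fix e :: real assume "e > 0"
      then obtain k where "norm (op_norm X (\<lambda>f x. ?y k i j f x - t i j f x) - 0) < e"
        using LIMSEQ_D[OF tl[OF ij]] by blast
      then have "op_norm X (\<lambda>f x. t i j f x - ?y k i j f x) \<le> e"
        by (subst op_norm_minus_commute) simp
      then show "\<exists>S\<in>Roe. op_norm X (\<lambda>f x. t i j f x - S f x) \<le> e" using yR[OF ij] by blast
    qed
    show "op_adjoint X (t i j) = t j i"
    proof (rule bop_eqI[OF op_adjoint_bop[OF tb[OF ij]] tb[OF ij(2,1)]])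
      fix x z assume xz: "x \<in> X" "z \<in> X"
      have "(\<lambda>k. cnj (?y k i j (delta x) z)) \<longlonglongrightarrow> cnj (t i j (delta x) z)"
        by (intro tendsto_cnj pt ij)
      moreover have "cnj (?y k i j (delta x) z) = ?y k j i (delta z) x" for k
        using op_adjoint_entry[OF yb[OF ij, of k] xz] y_adj[OF ij, of k] by simp
      ultimately have "(\<lambda>k. ?y k j i (delta z) x) \<longlonglongrightarrow> cnj (t i j (delta x) z)" by simp
      then show "op_adjoint X (t i j) (delta z) x = t j i (delta z) x"
        unfolding op_adjoint_entry[OF tb[OF ij] xz] by (rule LIMSEQ_unique[OF _ pt[OF ij(2,1)]])
    qed
    fix f x assume f: "f \<in> ell2 X"
    \<comment> \<open>The limit of the shifted sequence is computed twice: as that of the sequence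
      itself, and through the recursion.\<close>
    have "(\<lambda>k. ?y (Suc k) i j f x) \<longlonglongrightarrow> t i j f x" by (rule LIMSEQ_Suc[OF pt[OF ij]])
    moreover have "(\<lambda>k. ?y (Suc k) i j f x) \<longlonglongrightarrow> 1/2 * (s i j f x + (\<Sum>l<n. t i l (t l j f) x))"
    proof -
      have "(\<lambda>k. ?y k i l (?y k l j f) x) \<longlonglongrightarrow> t i l (t l j f) x" if l: "l \<in> {..<n}" for l
      proof -
        have l: "l < n" using l by simp
        show ?thesis
          by (rule op_norm_tendsto_comp_pointwise[OF yb[OF ij(1) l] tb[OF ij(1) l] yb[OF l ij(2)]
                tb[OF l ij(2)] tl[OF ij(1) l] tl[OF l ij(2)] y_one[OF ij(1) l] f])
      qed
      then have "(\<lambda>k. \<Sum>l<n. ?y k i l (?y k l j f) x) \<longlonglongrightarrow> (\<Sum>l<n. t i l (t l j f) x)"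
        by (rule tendsto_sum)
      then show ?thesis
        unfolding sqrt_iter.simps o_apply by (rule tendsto_mult_left[OF tendsto_add[OF tendsto_const]])
    qed
    ultimately have "t i j f x = 1/2 * (s i j f x + (\<Sum>l<n. t i l (t l j f) x))" by (rule LIMSEQ_unique)
    then show "2 * t i j f x = s i j f x + (\<Sum>l<n. t i l (t l j f) x)" by (simp add: mult.commute)
  qed
qed

end

section \<open>Positive matrices over the uniform Roe algebra\<close>

lemma ell2_norm_diff_sq:
  assumes f: "f \<in> ell2 X" and g: "g \<in> ell2 X"
  shows "(ell2_norm X (\<lambda>x. f x - complex_of_real t * g x))\<^sup>2 =
    (ell2_norm X f)\<^sup>2 - 2 * t * Re (ell2_inner X f g) + t\<^sup>2 * (ell2_norm X g)\<^sup>2"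
proof -
  let ?h = "\<lambda>x. complex_of_real t * g x"
  have h: "?h \<in> ell2 X" by (rule ell2_smult[OF g])
  have "(ell2_norm X (\<lambda>x. f x - ?h x))\<^sup>2 = Re (ell2_inner X (\<lambda>x. f x - ?h x) (\<lambda>x. f x - ?h x))"
    by (simp add: ell2_inner_self ell2_diff f h)
  also have "\<dots> = Re (ell2_inner X f f) - Re (ell2_inner X f ?h) - Re (ell2_inner X ?h f) + Re (ell2_inner X ?h ?h)"
    by (simp add: ell2_inner_diff_left ell2_inner_diff_right ell2_diff f h)
  also have "Re (ell2_inner X f f) = (ell2_norm X f)\<^sup>2" by (simp add: ell2_inner_self f)
  also have "Re (ell2_inner X ?h ?h) = t\<^sup>2 * (ell2_norm X g)\<^sup>2"
    by (simp add: ell2_inner_self h ell2_norm_smult power_mult_distrib)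
  also have "Re (ell2_inner X f ?h) = t * Re (ell2_inner X f g)" by (simp add: ell2_inner_smult_right)
  also have "Re (ell2_inner X ?h f) = t * Re (ell2_inner X f g)"
    by (subst ell2_inner_commute) (simp add: ell2_inner_smult_right)
  finally show ?thesis by simp
qed

context bg_space
begin

text \<open>
  After scaling, \<open>1 - a\<close> is a self-adjoint contraction, so \<open>a\<close> has a square root in the matrix
  algebra over \<open>A\<close>.
\<close>

lemma roe_mat_pos_rows:
  assumes I: "finite I" and c: "\<And>m j. m \<in> I \<Longrightarrow> j < n \<Longrightarrow> c m j \<in> Roe"
    and a: "\<And>i j. i < n \<Longrightarrow> j < n \<Longrightarrow> a i j = (\<lambda>f x. \<Sum>m\<in>I. op_adjoint X (c m i) (c m j f) x)"
  shows "mat_pos A n a"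
proof -
  note cb = roe_bop[OF c]
  define C where "C = (\<Sum>m\<in>I. \<Sum>j<n. op_norm X (c m j))"
  have C: "op_norm X (c m j) \<le> C" if "m \<in> I" "j < n" for m j
  proof -
    have "op_norm X (c m j) \<le> (\<Sum>j<n. op_norm X (c m j))"
      by (rule member_le_sum) (use that op_norm_nonneg cb in auto)
    also have "\<dots> \<le> C" unfolding C_def
      by (rule member_le_sum[where f="\<lambda>m. \<Sum>j<n. op_norm X (c m j)"]) (use that I op_norm_nonneg cb in \<open>auto intro!: sum_nonneg\<close>)
    finally show ?thesis .
  qed
  have C0: "0 \<le> C" unfolding C_def by (intro sum_nonneg op_norm_nonneg cb) auto
  \<comment> \<open>\<open>L\<close> dominates the squared norm of \<open>c^*\<close> acting on
    columns, as estimated in \<open>W\<close> below; the summand 1 makes it positive.\<close>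
  define L where "L = real n * (C\<^sup>2 * real (card I)) + 1"
  have L: "L > 0" unfolding L_def by (intro add_nonneg_pos) auto
  define t where "t = 1 / L"
  have t: "t > 0" "t * L = 1" using L by (simp_all add: t_def)
  define E where "E i j = (if i = j then (\<lambda>f. if f \<in> ell2 X then f else (\<lambda>x. 0)) else (\<lambda>f x. 0 :: complex))" for i j :: nat
  have ER: "E i j \<in> Roe" for i j unfolding E_def using roe_id roe_0 by simp
  have ac: "op_adjoint X (c m i) \<circ> c m j \<in> Roe" if "m \<in> I" "i < n" "j < n" for m i j
    by (intro roe_comp roe_adjoint c that)
  have a': "a i j = (\<lambda>f x. \<Sum>m\<in>I. (op_adjoint X (c m i) \<circ> c m j) f x)" if "i < n" "j < n" for i j
    by (simp add: a that)
  have aR: "a i j \<in> Roe" if "i < n" "j < n" for i j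
    unfolding a'[OF that] by (rule roe_sum) (rule ac[OF _ that])
  have a_adj: "op_adjoint X (a i j) = a j i" if ij: "i < n" "j < n" for i j
  proof -
    have "op_adjoint X (op_adjoint X (c m i) \<circ> c m j) = op_adjoint X (c m j) \<circ> c m i" if m: "m \<in> I" for m
      using op_adjoint_comp[OF op_adjoint_bop[OF cb[OF m ij(1)]] cb[OF m ij(2)]] m ij by (simp add: op_adjoint_adjoint cb)
    note adj = this
    have "op_adjoint X (\<lambda>f x. \<Sum>m\<in>I. (op_adjoint X (c m i) \<circ> c m j) f x) =
        (\<lambda>f x. \<Sum>m\<in>I. op_adjoint X (op_adjoint X (c m i) \<circ> c m j) f x)"
      by (rule op_adjoint_sum) (rule roe_bop[OF ac[OF _ ij]])
    also have "\<dots> = (\<lambda>f x. \<Sum>m\<in>I. (op_adjoint X (c m j) \<circ> c m i) f x)"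
      by (intro ext sum.cong refl) (simp add: adj del: o_apply)
    finally show ?thesis unfolding a'[OF ij] a'[OF ij(2,1)] .
  qed
  \<comment> \<open>The matrix \<open>1 - t a\<close>; its contractivity is the hypothesis of the
    square root lemma.\<close>
  define s where "s i j = (\<lambda>f x. E i j f x + complex_of_real (- t) * a i j f x)" for i j
  have sR: "s i j \<in> Roe" if "i < n" "j < n" for i j
    unfolding s_def by (intro roe_plus ER roe_scale aR that)
  have s_adj: "op_adjoint X (s i j) = s j i" if "i < n" "j < n" for i j
  proof -
    have "op_adjoint X (E i j) = E j i" unfolding E_def by (simp add: op_adjoint_id op_adjoint_0)
    then show ?thesis unfolding s_def
      using op_adjoint_plus[OF roe_bop[OF ER] bop_scale[OF roe_bop[OF aR[OF that]]], of i j "complex_of_real (-t)"]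
        op_adjoint_scale[OF roe_bop[OF aR[OF that]], of "complex_of_real (-t)"] a_adj[OF that] by simp
  qed
  have "mbound X n 1 s" unfolding mbound_def
  proof (intro allI impI)
    fix u assume "\<forall>j<n. u j \<in> ell2 X"
    then have u: "\<And>j. j < n \<Longrightarrow> u j \<in> ell2 X" by blast
    \<comment> \<open>With \<open>v = c u\<close> and \<open>w = c^* v\<close>, the expansion
      \<open>||u - t w||^2 = ||u||^2 - 2 t ||v||^2 + t^2 ||w||^2\<close> and the bound
      \<open>||w||^2 <= L ||v||^2\<close> leave at most \<open>||u||^2 - t ||v||^2\<close>, as
      \<open>t L = 1\<close>.\<close>
    define v where "v m = (\<lambda>x. \<Sum>j<n. c m j (u j) x)" for m
    define w where "w i = (\<lambda>x. \<Sum>m\<in>I. op_adjoint X (c m i) (v m) x)" for i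
    have v: "v m \<in> ell2 X" if "m \<in> I" for m
      unfolding v_def by (rule ell2_sum) (use bop_ell2[OF cb[OF that] u] in auto)
    have w: "w i \<in> ell2 X" if "i < n" for i
      unfolding w_def by (rule ell2_sum) (use bop_ell2[OF op_adjoint_bop[OF cb[OF _ that]] v] in auto)
    have aw: "mapp n a u i = w i" if i: "i < n" for i
    proof
      fix x
      have "mapp n a u i x = (\<Sum>j<n. \<Sum>m\<in>I. op_adjoint X (c m i) (c m j (u j)) x)"
        unfolding mapp_def by (simp add: a i)
      also have "\<dots> = (\<Sum>m\<in>I. \<Sum>j<n. op_adjoint X (c m i) (c m j (u j)) x)" by (rule sum.swap)
      also have "\<dots> = w i x" unfolding w_def v_def
        by (intro sum.cong refl, subst bop_sum[OF op_adjoint_bop[OF cb]]) (simp_all add: i bop_ell2[OF cb u])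
      finally show "mapp n a u i x = w i x" .
    qed
    have mu: "mapp n s u i = (\<lambda>x. u i x - complex_of_real t * w i x)" if i: "i < n" for i
    proof
      fix x
      have "(\<Sum>j<n. E i j (u j) x) = (\<Sum>j<n. if i = j then u i x else 0)"
        by (intro sum.cong refl) (simp add: E_def u)
      then show "mapp n s u i x = u i x - complex_of_real t * w i x"
        unfolding aw[OF i, symmetric] unfolding mapp_def s_def
        using i by (simp add: sum_subtractf sum_distrib_left)
    qed
    define V where "V = (\<Sum>m\<in>I. (ell2_norm X (v m))\<^sup>2)"
    have inner: "(\<Sum>i<n. Re (ell2_inner X (u i) (w i))) = V"
    proof -
      have "(\<Sum>i<n. ell2_inner X (u i) (w i)) = (\<Sum>i<n. \<Sum>m\<in>I. ell2_inner X (c m i (u i)) (v m))"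
      proof (rule sum.cong[OF refl])
        fix i assume "i \<in> {..<n}"
        then have i: "i < n" by simp
        have "ell2_inner X (u i) (w i) = (\<Sum>m\<in>I. ell2_inner X (u i) (op_adjoint X (c m i) (v m)))"
          unfolding w_def by (rule ell2_inner_sum_right[OF u[OF i]]) (use bop_ell2[OF op_adjoint_bop[OF cb[OF _ i]] v] in auto)
        also have "\<dots> = (\<Sum>m\<in>I. ell2_inner X (c m i (u i)) (v m))"
          by (intro sum.cong refl) (simp add: op_adjoint_inner cb u v i)
        finally show "ell2_inner X (u i) (w i) = (\<Sum>m\<in>I. ell2_inner X (c m i (u i)) (v m))" .
      qed
      also have "\<dots> = (\<Sum>m\<in>I. \<Sum>i<n. ell2_inner X (c m i (u i)) (v m))" by (rule sum.swap)
      also have "\<dots> = (\<Sum>m\<in>I. ell2_inner X (v m) (v m))"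
      proof (rule sum.cong[OF refl])
        fix m assume m: "m \<in> I"
        show "(\<Sum>i<n. ell2_inner X (c m i (u i)) (v m)) = ell2_inner X (v m) (v m)"
        proof -
          have "ell2_inner X (\<lambda>x. \<Sum>j<n. c m j (u j) x) (v m) = (\<Sum>i<n. ell2_inner X (c m i (u i)) (v m))"
            by (rule ell2_inner_sum_left[OF v[OF m]]) (simp add: bop_ell2[OF cb[OF m] u])
          then show ?thesis unfolding v_def[of m, symmetric] by (rule sym)
        qed
      qed
      also have "\<dots> = complex_of_real V" unfolding V_def by (simp add: ell2_inner_self v)
      finally have "Re (\<Sum>i<n. ell2_inner X (u i) (w i)) = Re (complex_of_real V)" by (rule arg_cong)
      then show ?thesis by (simp only: Re_sum Re_complex_of_real)
    qed
    have wn: "(ell2_norm X (w i))\<^sup>2 \<le> C\<^sup>2 * real (card I) * V" if i: "i < n" for i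
    proof -
      have "ell2_norm X (w i) \<le> (\<Sum>m\<in>I. ell2_norm X (op_adjoint X (c m i) (v m)))"
        unfolding w_def by (rule ell2_norm_sum_le) (use bop_ell2[OF op_adjoint_bop[OF cb[OF _ i]] v] in auto)
      also have "\<dots> \<le> (\<Sum>m\<in>I. C * ell2_norm X (v m))"
      proof (rule sum_mono)
        fix m assume m: "m \<in> I"
        have "ell2_norm X (op_adjoint X (c m i) (v m)) \<le> op_norm X (op_adjoint X (c m i)) * ell2_norm X (v m)"
          by (rule op_norm_bound[OF op_adjoint_bop[OF cb[OF m i]] v[OF m]])
        also have "\<dots> \<le> C * ell2_norm X (v m)"
          by (rule mult_right_mono) (use C[OF m i] op_norm_adjoint[OF cb[OF m i]] in auto)
        finally show "ell2_norm X (op_adjoint X (c m i) (v m)) \<le> C * ell2_norm X (v m)" .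
      qed
      finally have "(ell2_norm X (w i))\<^sup>2 \<le> (\<Sum>m\<in>I. C * ell2_norm X (v m))\<^sup>2" by (rule power_mono) simp
      also have "\<dots> \<le> (\<Sum>m\<in>I. (C * ell2_norm X (v m))\<^sup>2) * real (card I)" by (rule sum_squared_le_sum_of_squares)
      also have "\<dots> = C\<^sup>2 * real (card I) * V" by (simp add: V_def power_mult_distrib sum_distrib_left[symmetric])
      finally show ?thesis .
    qed
    have V: "0 \<le> V" by (simp add: V_def sum_nonneg)
    have "(\<Sum>i<n. (ell2_norm X (w i))\<^sup>2) \<le> (\<Sum>i<n. C\<^sup>2 * real (card I) * V)"
      by (rule sum_mono) (simp add: wn)
    also have "\<dots> \<le> L * V" using V by (simp add: L_def distrib_right)
    finally have W: "(\<Sum>i<n. (ell2_norm X (w i))\<^sup>2) \<le> L * V" .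
    have "(cnorm X n (mapp n s u))\<^sup>2 = (\<Sum>i<n. (ell2_norm X (\<lambda>x. u i x - complex_of_real t * w i x))\<^sup>2)"
      unfolding cnorm_sq by (simp add: mu)
    also have "\<dots> = (\<Sum>i<n. (ell2_norm X (u i))\<^sup>2 - 2 * t * Re (ell2_inner X (u i) (w i)) + t\<^sup>2 * (ell2_norm X (w i))\<^sup>2)"
      by (intro sum.cong refl ell2_norm_diff_sq u w) auto
    also have "\<dots> = (cnorm X n u)\<^sup>2 - 2 * t * V + t\<^sup>2 * (\<Sum>i<n. (ell2_norm X (w i))\<^sup>2)"
      unfolding sum.distrib sum_subtractf sum_distrib_left[symmetric] inner cnorm_sq ..
    also have "\<dots> \<le> (cnorm X n u)\<^sup>2 - 2 * t * V + t\<^sup>2 * (L * V)"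
      by (intro add_left_mono mult_left_mono W) simp
    also have "t\<^sup>2 * (L * V) = t * (t * L) * V" by (simp only: power2_eq_square mult.assoc)
    also have "\<dots> = t * V" by (simp only: t(2) mult_1_right)
    also have "(cnorm X n u)\<^sup>2 - 2 * t * V + t * V \<le> (cnorm X n u)\<^sup>2" using t V by simp
    finally have "cnorm X n (mapp n s u) \<le> cnorm X n u" by (rule power2_le_imp_le) simp
    then show "cnorm X n (mapp n s u) \<le> 1 * cnorm X n u" by simp
  qed
  note s_bound = this
  obtain q where Q: "\<forall>i<n. \<forall>j<n. q i j \<in> Roe \<and> op_adjoint X (q i j) = q j i \<and>
      (\<forall>f\<in>ell2 X. \<forall>x. 2 * q i j f x = s i j f x + (\<Sum>l<n. q i l (q l j f) x))"
  proof -
    have "\<exists>t. \<forall>i<n. \<forall>j<n. t i j \<in> Roe \<and> op_adjoint X (t i j) = t j i \<and>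
      (\<forall>f\<in>ell2 X. \<forall>x. 2 * t i j f x = s i j f x + (\<Sum>l<n. t i l (t l j f) x))"
      by (rule roe_matrix_sqrt[OF _ _ s_bound]) (simp_all add: sR s_adj)
    then show ?thesis using that by (elim exE)
  qed
  have q: "q i j \<in> Roe" and q_adj: "op_adjoint X (q i j) = q j i"
    and q_eq: "f \<in> ell2 X \<Longrightarrow> 2 * q i j f x = s i j f x + (\<Sum>l<n. q i l (q l j f) x)"
    if "i < n" "j < n" for i j f x
    using Q that by simp_all
  \<comment> \<open>\<open>g = 1 - q\<close> satisfies \<open>g^2 = 1 - s = t a\<close>.\<close>
  define g where "g i j = (\<lambda>f x. E i j f x - q i j f x)" for i j
  have gR: "g i j \<in> Roe" if "i < n" "j < n" for i j unfolding g_def by (intro roe_minus ER q that)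
  have gsq: "(\<Sum>k<n. g i k (g k j f) x) = complex_of_real t * a i j f x"
    if ij: "i < n" "j < n" and f: "f \<in> ell2 X" for i j f x
  proof -
    have Ef: "E i j f = (if i = j then f else (\<lambda>x. 0))" for i j using f by (simp add: E_def)
    have "g i k (g k j f) x = (if i = k then g k j f x else 0) - ((if k = j then q i j f x else 0) - q i k (q k j f) x)"
      if k: "k < n" for k
    proof -
      have gf: "g k j f \<in> ell2 X" by (rule bop_ell2[OF roe_bop[OF gR[OF k ij(2)]] f])
      have Ek: "E k j f \<in> ell2 X" by (simp add: Ef f)
      have "g i k (g k j f) x = E i k (g k j f) x - q i k (g k j f) x" by (simp add: g_def[of i k])
      also have "q i k (g k j f) x = q i k (E k j f) x - q i k (q k j f) x"
        unfolding g_def by (subst bop_diff[OF roe_bop[OF q[OF ij(1) k]] Ek bop_ell2[OF roe_bop[OF q[OF k ij(2)]] f]]) simp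
      also have "q i k (E k j f) x = (if k = j then q i j f x else 0)"
        using bop_zero[OF roe_bop[OF q[OF ij(1) k]]] by (simp add: Ef)
      also have "E i k (g k j f) x = (if i = k then g k j f x else 0)" by (simp add: E_def gf)
      finally show ?thesis .
    qed
    then have "(\<Sum>k<n. g i k (g k j f) x) =
        (\<Sum>k<n. if i = k then g k j f x else 0) - ((\<Sum>k<n. if k = j then q i j f x else 0) - (\<Sum>k<n. q i k (q k j f) x))"
      by (simp add: sum_subtractf)
    also have "\<dots> = E i j f x - 2 * q i j f x + (\<Sum>k<n. q i k (q k j f) x)"
      using ij by (simp add: g_def)
    also have "\<dots> = complex_of_real t * a i j f x" unfolding q_eq[OF ij f] by (simp add: s_def)
    finally show ?thesis .
  qed
  have g_adj: "op_adjoint X (g i j) = g j i" if "i < n" "j < n" for i j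
  proof -
    have "op_adjoint X (E i j) = E j i" unfolding E_def by (simp add: op_adjoint_id op_adjoint_0)
    moreover have "g i j = (\<lambda>f x. E i j f x + (-1) * q i j f x)" by (simp add: g_def)
    ultimately show ?thesis
      using op_adjoint_plus[OF roe_bop[OF ER] bop_scale[OF roe_bop[OF q[OF that]]], of i j "-1"]
        op_adjoint_scale[OF roe_bop[OF q[OF that]], of "-1"] q_adj[OF that] by (simp add: g_def[of j i])
  qed
  \<comment> \<open>\<open>g\<close> is self-adjoint, so
    \<open>b^* b = L g^2 = L t a = a\<close>.\<close>
  define b where "b i j = (\<lambda>f x. complex_of_real (sqrt L) * g i j f x)" for i j
  have bR: "b i j \<in> Roe" if "i < n" "j < n" for i j unfolding b_def by (intro roe_scale gR that)
  have b_adj: "op_adjoint X (b i j) = b j i" if "i < n" "j < n" for i j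
    unfolding b_def using op_adjoint_scale[OF roe_bop[OF gR[OF that]]] g_adj[OF that] by simp
  have "a i j = (\<Oplus>\<^bsub>A\<^esub>k\<in>{..<n}. star A (b k i) \<otimes>\<^bsub>A\<^esub> b k j)" if ij: "i < n" "j < n" for i j
  proof -
    have "(\<Oplus>\<^bsub>A\<^esub>k\<in>{..<n}. star A (b k i) \<otimes>\<^bsub>A\<^esub> b k j) = (\<lambda>f x. \<Sum>k<n. (op_adjoint X (b k i) \<circ> b k j) f x)"
      unfolding roe_simps by (rule roe_finsum) (auto intro!: roe_comp roe_adjoint bR ij)
    also have "\<dots> = a i j"
    proof (intro ext)
      fix f x
      show "(\<Sum>k<n. (op_adjoint X (b k i) \<circ> b k j) f x) = a i j f x"
      proof (cases "f \<in> ell2 X")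
        case f: True
        have "(op_adjoint X (b k i) \<circ> b k j) f x = complex_of_real L * g i k (g k j f) x" if k: "k < n" for k
        proof -
          have "(op_adjoint X (b k i) \<circ> b k j) f x = b i k (b k j f) x" using b_adj[OF k ij(1)] by simp
          also have "\<dots> = complex_of_real (sqrt L) * (complex_of_real (sqrt L) * g i k (g k j f) x)"
            unfolding b_def
            by (subst bop_smult[OF roe_bop[OF gR[OF ij(1) k]] bop_ell2[OF roe_bop[OF gR[OF k ij(2)]] f]]) simp
          also have "\<dots> = complex_of_real L * g i k (g k j f) x"
            using L by (simp add: mult.assoc[symmetric] of_real_mult[symmetric] del: of_real_mult)
          finally show ?thesis .
        qed
        then have "(\<Sum>k<n. (op_adjoint X (b k i) \<circ> b k j) f x) = complex_of_real L * (\<Sum>k<n. g i k (g k j f) x)"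
          by (simp add: sum_distrib_left del: o_apply)
        also have "\<dots> = complex_of_real (t * L) * a i j f x" unfolding gsq[OF ij f] by simp
        finally show ?thesis using t(2) by simp
      next
        case False
        have "(op_adjoint X (b k i) \<circ> b k j) f = (\<lambda>x. 0)" if "k < n" for k
          by (rule bop_outside[OF roe_bop[OF roe_comp[OF roe_adjoint[OF bR] bR]] False]) (use that ij in auto)
        then show ?thesis using bop_outside[OF roe_bop[OF aR[OF ij]] False] by (simp del: o_apply)
      qed
    qed
    finally show ?thesis by (rule sym)
  qed
  then show ?thesis unfolding mat_pos_def using bR by (intro exI[of _ b]) simp
qed

end

section \<open>Factorisation of positive semidefinite matrices\<close>

text \<open>
  One step of the Cholesky algorithm removes the row and column of the new index; the Schur
  complement respects every block structure of the original matrix.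
\<close>

lemma cholesky_blocks:
  fixes G :: "'i \<Rightarrow> 'i \<Rightarrow> complex"
  assumes "finite S"
    and "\<And>s t. s \<in> S \<Longrightarrow> t \<in> S \<Longrightarrow> G s t = cnj (G t s)"
    and "\<And>z. \<exists>\<rho>\<ge>0. (\<Sum>s\<in>S. \<Sum>t\<in>S. cnj (z s) * G s t * z t) = complex_of_real \<rho>"
    and "\<And>s t. s \<in> S \<Longrightarrow> t \<in> S \<Longrightarrow> G s t \<noteq> 0 \<Longrightarrow> lab s = lab t"
  shows "\<exists>c. (\<forall>s\<in>S. \<forall>t\<in>S. G s t = (\<Sum>r\<in>S. cnj (c r s) * c r t)) \<and>
    (\<forall>s\<in>S. \<forall>t\<in>S. c s t \<noteq> 0 \<longrightarrow> lab s = lab t)"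
  using assms
proof (induction S arbitrary: G rule: finite_induct)
  case empty
  show ?case by simp
next
  case (insert o1 S)
  note herm = insert.prems(1) and psd = insert.prems(2) and blk = insert.prems(3)
  let ?T = "insert o1 S"
  have split: "(\<Sum>s\<in>?T. \<Sum>t\<in>?T. cnj (z s) * G s t * z t) =
      cnj (z o1) * G o1 o1 * z o1 + cnj (z o1) * (\<Sum>t\<in>S. G o1 t * z t) +
      cnj (\<Sum>t\<in>S. G o1 t * z t) * z o1 + (\<Sum>s\<in>S. \<Sum>t\<in>S. cnj (z s) * G s t * z t)" for z
  proof -
    have "cnj (\<Sum>t\<in>S. G o1 t * z t) * z o1 = (\<Sum>s\<in>S. cnj (z s) * G s o1 * z o1)"
      unfolding cnj_sum sum_distrib_right
    proof (rule sum.cong[OF refl])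
      fix s assume "s \<in> S"
      then show "cnj (G o1 s * z s) * z o1 = cnj (z s) * G s o1 * z o1"
        using herm[of s o1] by simp
    qed
    then show ?thesis using insert(1,2) by (simp add: sum.distrib sum_distrib_left mult.assoc)
  qed
  \<comment> \<open>Putting the basis vector of the new index into the form shows that the pivot is
    a nonnegative real.\<close>
  obtain \<gamma> where \<gamma>: "\<gamma> \<ge> 0" "G o1 o1 = complex_of_real \<gamma>"
  proof -
    obtain \<rho> where \<rho>: "\<rho> \<ge> 0" "(\<Sum>s\<in>?T. \<Sum>t\<in>?T. cnj (delta o1 s) * G s t * delta o1 t) = complex_of_real \<rho>"
      using psd by blast
    have z: "(\<Sum>t\<in>S. G o1 t * delta o1 t) = 0" "(\<Sum>s\<in>S. \<Sum>t\<in>S. cnj (delta o1 s) * G s t * delta o1 t) = 0"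
      using insert(2) by (auto intro!: sum.neutral simp: delta_def)
    have "G o1 o1 = complex_of_real \<rho>" using \<rho>(2) unfolding split z by (simp add: delta_def)
    then show ?thesis using \<rho>(1) that by blast
  qed
  \<comment> \<open>A zero pivot forces its row to vanish: otherwise the form takes the values
    \<open>G t t - 2 k |G o1 t|^2\<close>, which become negative for large \<open>k\<close>.\<close>
  have zero: "G o1 t = 0" if t: "t \<in> S" and "\<gamma> = 0" for t
  proof (rule ccontr)
    assume nz: "G o1 t \<noteq> 0"
    have "\<exists>\<rho>\<ge>0. complex_of_real (- 2 * k * (cmod (G o1 t))\<^sup>2) + G t t = complex_of_real \<rho>" for k
    proof -
      define z where "z s = (if s = o1 then - complex_of_real k * G o1 t else if s = t then 1 else 0)" for s
      have ne: "t \<noteq> o1" using t insert(2) by blast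
      have w: "(\<Sum>s\<in>S. G o1 s * z s) = G o1 t"
      proof -
        have "(\<Sum>s\<in>S. G o1 s * z s) = (\<Sum>s\<in>S. if s = t then G o1 t else 0)"
          by (intro sum.cong refl) (use insert(2) in \<open>auto simp: z_def\<close>)
        then show ?thesis using t insert(1) by simp
      qed
      have q: "(\<Sum>s\<in>S. \<Sum>u\<in>S. cnj (z s) * G s u * z u) = G t t"
      proof -
        have "(\<Sum>s\<in>S. \<Sum>u\<in>S. cnj (z s) * G s u * z u) = (\<Sum>s\<in>S. \<Sum>u\<in>S. if u = t then (if s = t then G t t else 0) else 0)"
          by (intro sum.cong refl) (use insert(2) in \<open>auto simp: z_def\<close>)
        then show ?thesis using t insert(1) by simp
      qed
      have "(\<Sum>s\<in>?T. \<Sum>t\<in>?T. cnj (z s) * G s t * z t) = complex_of_real (- 2 * k * (cmod (G o1 t))\<^sup>2) + G t t"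
        unfolding split w q \<gamma>(2) \<open>\<gamma> = 0\<close> using complex_norm_square[of "G o1 t"]
        by (simp add: z_def mult.commute)
      then show ?thesis using psd[of z] by simp
    qed
    note fam = this
    obtain \<rho>0 where r0: "G t t = complex_of_real \<rho>0" using fam[of 0] by auto
    have pos: "0 \<le> - 2 * k * (cmod (G o1 t))\<^sup>2 + \<rho>0" for k
    proof -
      obtain \<rho> where "\<rho> \<ge> 0" "complex_of_real (- 2 * k * (cmod (G o1 t))\<^sup>2) + G t t = complex_of_real \<rho>"
        using fam by blast
      then have "complex_of_real (- 2 * k * (cmod (G o1 t))\<^sup>2 + \<rho>0) = complex_of_real \<rho>"
        unfolding r0 by simp
      then show ?thesis using \<open>\<rho> \<ge> 0\<close> by (simp only: of_real_eq_iff)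
    qed
    \<comment> \<open>For this \<open>k\<close> the value is \<open>- \<rho>0 - 2\<close>, while
      \<open>k = 0\<close> gives \<open>\<rho>0 >= 0\<close>.\<close>
    show False using pos[of "(\<rho>0 + 1) / (cmod (G o1 t))\<^sup>2"] pos[of 0] nz by simp
  qed
  \<comment> \<open>The row of a zero pivot vanishes, so the default value \<open>x / 0 = 0\<close>
    is the right one in every quotient below.\<close>
  have cancel: "G o1 t / complex_of_real \<gamma> * complex_of_real \<gamma> = G o1 t" if "t \<in> S" for t
    using zero[OF that] by (cases "\<gamma> = 0") simp_all
  define G' where "G' s t = G s t - G s o1 * G o1 t / complex_of_real \<gamma>" for s t
  have "\<exists>c. (\<forall>s\<in>S. \<forall>t\<in>S. G' s t = (\<Sum>r\<in>S. cnj (c r s) * c r t)) \<and>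
    (\<forall>s\<in>S. \<forall>t\<in>S. c s t \<noteq> 0 \<longrightarrow> lab s = lab t)"
  proof (rule insert.IH)
    fix s t assume st: "s \<in> S" "t \<in> S"
    have "G s t = cnj (G t s)" "G s o1 = cnj (G o1 s)" "G o1 t = cnj (G t o1)"
      using st by (intro herm; simp)+
    then show "G' s t = cnj (G' t s)" unfolding G'_def by (simp add: mult.commute)
    assume "G' s t \<noteq> 0"
    then have "G s t \<noteq> 0 \<or> G s o1 \<noteq> 0 \<and> G o1 t \<noteq> 0" unfolding G'_def by auto
    then show "lab s = lab t" using blk[of s t] blk[of s o1] blk[of o1 t] st by auto
  next
    fix z :: "'i \<Rightarrow> complex"
    define w where "w = (\<Sum>t\<in>S. G o1 t * z t)"
    \<comment> \<open>Completing the square: with the new coordinate \<open>- w / \<gamma>\<close>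
      the form of \<open>G\<close> takes the value of the form of the Schur complement.\<close>
    define z' where "z' s = (if s = o1 then - w / complex_of_real \<gamma> else z s)" for s
    have z': "z' t = z t" if "t \<in> S" for t using that insert(2) by (auto simp: z'_def)
    have wc: "w / complex_of_real \<gamma> * complex_of_real \<gamma> = w"
      unfolding w_def sum_divide_distrib sum_distrib_right
      by (intro sum.cong refl) (use cancel in \<open>simp add: mult.commute\<close>, metis mult.left_commute times_divide_eq_right)
    have "(\<Sum>s\<in>S. \<Sum>t\<in>S. cnj (z s) * G' s t * z t) =
        (\<Sum>s\<in>S. \<Sum>t\<in>S. cnj (z s) * G s t * z t) - (\<Sum>s\<in>S. cnj (z s) * G s o1 * (w / complex_of_real \<gamma>))"
      unfolding w_def sum_divide_distrib sum_distrib_left sum_subtractf[symmetric] G'_def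
      by (intro sum.cong refl) (simp add: algebra_simps)
    also have "(\<Sum>s\<in>S. cnj (z s) * G s o1 * (w / complex_of_real \<gamma>)) = cnj w * (w / complex_of_real \<gamma>)"
    proof -
      have "cnj w = (\<Sum>s\<in>S. cnj (z s) * G s o1)" unfolding w_def cnj_sum
      proof (rule sum.cong[OF refl])
        fix s assume "s \<in> S"
        then show "cnj (G o1 s * z s) = cnj (z s) * G s o1" using herm[of s o1] by simp
      qed
      then show ?thesis by (simp only: sum_distrib_right)
    qed
    also have "(\<Sum>s\<in>S. \<Sum>t\<in>S. cnj (z s) * G s t * z t) - cnj w * (w / complex_of_real \<gamma>) =
        (\<Sum>s\<in>?T. \<Sum>t\<in>?T. cnj (z' s) * G s t * z' t)"
    proof -
      have a: "(\<Sum>t\<in>S. G o1 t * z' t) = w" unfolding w_def by (intro sum.cong refl) (simp add: z')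
      have b: "(\<Sum>s\<in>S. \<Sum>t\<in>S. cnj (z' s) * G s t * z' t) = (\<Sum>s\<in>S. \<Sum>t\<in>S. cnj (z s) * G s t * z t)"
        by (intro sum.cong refl) (simp add: z')
      have "cnj (z' o1) * G o1 o1 * z' o1 = cnj w * (w / complex_of_real \<gamma>)"
      proof -
        have "cnj (z' o1) * G o1 o1 = - cnj (w / complex_of_real \<gamma> * complex_of_real \<gamma>)"
          by (simp add: z'_def \<gamma>(2))
        then show ?thesis unfolding wc by (simp add: z'_def)
      qed
      then show ?thesis unfolding split a b by (simp add: z'_def)
    qed
    finally show "\<exists>\<rho>\<ge>0. (\<Sum>s\<in>S. \<Sum>t\<in>S. cnj (z s) * G' s t * z t) = complex_of_real \<rho>"
      using psd[of z'] by simp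
  qed
  then obtain c' where c': "\<And>s t. s \<in> S \<Longrightarrow> t \<in> S \<Longrightarrow> G' s t = (\<Sum>r\<in>S. cnj (c' r s) * c' r t)"
    "\<And>s t. s \<in> S \<Longrightarrow> t \<in> S \<Longrightarrow> c' s t \<noteq> 0 \<Longrightarrow> lab s = lab t" by blast
  \<comment> \<open>The new row of the triangular factor; the rows of \<open>c'\<close> are extended
    by 0 in the new column.\<close>
  define c where "c r t = (if r = o1 then G o1 t / complex_of_real (sqrt \<gamma>) else if t = o1 then 0 else c' r t)" for r t
  have sq: "complex_of_real (sqrt \<gamma>) * complex_of_real (sqrt \<gamma>) = complex_of_real \<gamma>"
    using \<gamma>(1) by (simp add: of_real_mult[symmetric] del: of_real_mult)
  have first: "cnj (c o1 s) * c o1 t = cnj (G o1 s) * G o1 t / complex_of_real \<gamma>" for s t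
    by (simp add: c_def sq)
  have cS: "(\<Sum>r\<in>S. cnj (c r s) * c r t) = (if s = o1 \<or> t = o1 then 0 else (\<Sum>r\<in>S. cnj (c' r s) * c' r t))" for s t
    using insert(2) by (auto simp: c_def intro!: sum.neutral sum.cong)
  have G0: "G o1 o1 * G o1 t / complex_of_real \<gamma> = G o1 t" if "t \<in> ?T" for t
    using that cancel[of t] \<gamma>(2) by (auto simp: mult.commute)
  show ?case
  proof (intro exI[of _ c] conjI ballI impI)
    fix s t assume st: "s \<in> ?T" "t \<in> ?T"
    have "(\<Sum>r\<in>?T. cnj (c r s) * c r t) = cnj (G o1 s) * G o1 t / complex_of_real \<gamma> +
        (if s = o1 \<or> t = o1 then 0 else (\<Sum>r\<in>S. cnj (c' r s) * c' r t))"
      using insert(1,2) by (simp add: first cS)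
    also have "\<dots> = G s t"
    proof (cases "s = o1 \<or> t = o1")
      case True
      then show ?thesis
      proof
        assume s: "s = o1"
        then show ?thesis using G0[OF st(2)] \<gamma>(2) by simp
      next
        assume t: "t = o1"
        have "cnj (G o1 o1 * G o1 s / complex_of_real \<gamma>) = cnj (G o1 s)" by (simp only: G0[OF st(1)])
        then show ?thesis using t herm[OF st] \<gamma>(2) by (auto simp: mult.commute split: if_splits)
      qed
    next
      case False
      then have st': "s \<in> S" "t \<in> S" using st by auto
      have "cnj (G o1 s) = G s o1" using herm[of s o1] st by simp
      then show ?thesis using False c'(1)[OF st', symmetric] by (simp add: G'_def)
    qed
    finally show "G s t = (\<Sum>r\<in>?T. cnj (c r s) * c r t)" by (rule sym)
  next
    fix s t assume st: "s \<in> ?T" "t \<in> ?T" and "c s t \<noteq> 0"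
    then show "lab s = lab t"
      using blk[of o1 t] c'(2)[of s t] by (auto simp: c_def split: if_splits)
  qed
qed

text \<open>Deleting the entries between different labels keeps a Gram matrix positive semidefinite:
  the form becomes the sum, over the labels \<open>l\<close> and over \<open>k\<close>, of the
  squared norms of the combinations \<open>u k l\<close> of the vectors with label
  \<open>l\<close>.\<close>

lemma gram_cholesky_blocks:
  fixes v :: "'k \<Rightarrow> 'i \<Rightarrow> 'x \<Rightarrow> complex" and lab :: "'i \<Rightarrow> 'l"
  assumes S: "finite S" and v: "\<And>k s. k \<in> K \<Longrightarrow> s \<in> S \<Longrightarrow> v k s \<in> ell2 X"
    and G: "\<And>s t. s \<in> S \<Longrightarrow> t \<in> S \<Longrightarrow> G s t = (if lab s = lab t then \<Sum>k\<in>K. ell2_inner X (v k s) (v k t) else 0)"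
  shows "\<exists>c. (\<forall>s\<in>S. \<forall>t\<in>S. G s t = (\<Sum>r\<in>S. cnj (c r s) * c r t)) \<and>
    (\<forall>s\<in>S. \<forall>t\<in>S. c s t \<noteq> 0 \<longrightarrow> lab s = lab t)"
proof (rule cholesky_blocks[OF S])
  fix s t assume st: "s \<in> S" "t \<in> S"
  show "G s t = cnj (G t s)"
    using ell2_inner_commute[of X "v _ s" "v _ t"] by (simp add: G st cnj_sum)
  show "lab s = lab t" if "G s t \<noteq> 0" using that by (auto simp: G st split: if_splits)
next
  fix z :: "'i \<Rightarrow> complex"
  define B where "B l = {s\<in>S. lab s = l}" for l
  define u where "u k l = (\<lambda>x. \<Sum>s\<in>B l. z s * v k s x)" for k l
  have u: "u k l \<in> ell2 X" if "k \<in> K" for k l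
    unfolding u_def by (rule ell2_sum) (use v[OF that] in \<open>auto simp: B_def intro: ell2_smult\<close>)
  have uu: "ell2_inner X (u k l) (u k l) = (\<Sum>s\<in>B l. \<Sum>t\<in>B l. cnj (z s) * ell2_inner X (v k s) (v k t) * z t)"
    if k: "k \<in> K" for k l
  proof -
    have vs: "(\<lambda>x. z s * v k s x) \<in> ell2 X" if "s \<in> B l" for s
      using v[OF k] that by (auto simp: B_def intro: ell2_smult)
    have "ell2_inner X (u k l) (u k l) = (\<Sum>s\<in>B l. ell2_inner X (\<lambda>x. z s * v k s x) (u k l))"
      by (subst (1) u_def) (rule ell2_inner_sum_left[OF u[OF k] vs])
    also have "\<dots> = (\<Sum>s\<in>B l. \<Sum>t\<in>B l. ell2_inner X (\<lambda>x. z s * v k s x) (\<lambda>x. z t * v k t x))"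
      by (intro sum.cong refl, subst u_def) (rule ell2_inner_sum_right[OF vs vs])
    also have "\<dots> = (\<Sum>s\<in>B l. \<Sum>t\<in>B l. cnj (z s) * ell2_inner X (v k s) (v k t) * z t)"
      by (simp add: ell2_inner_smult_left ell2_inner_smult_right mult_ac)
    finally show ?thesis .
  qed
  have "(\<Sum>s\<in>S. \<Sum>t\<in>S. cnj (z s) * G s t * z t) =
      (\<Sum>s\<in>S. \<Sum>t\<in>B (lab s). \<Sum>k\<in>K. cnj (z s) * ell2_inner X (v k s) (v k t) * z t)"
  proof (rule sum.cong[OF refl])
    fix s assume s: "s \<in> S"
    have "(\<Sum>t\<in>S. cnj (z s) * G s t * z t) = (\<Sum>t\<in>B (lab s). cnj (z s) * G s t * z t)"
      by (rule sum.mono_neutral_right[OF S]) (auto simp: B_def G s)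
    also have "\<dots> = (\<Sum>t\<in>B (lab s). \<Sum>k\<in>K. cnj (z s) * ell2_inner X (v k s) (v k t) * z t)"
      by (intro sum.cong refl) (auto simp: B_def G s sum_distrib_left sum_distrib_right)
    finally show "(\<Sum>t\<in>S. cnj (z s) * G s t * z t) = (\<Sum>t\<in>B (lab s). \<Sum>k\<in>K. cnj (z s) * ell2_inner X (v k s) (v k t) * z t)" .
  qed
  also have "\<dots> = (\<Sum>l\<in>lab ` S. \<Sum>s\<in>B l. \<Sum>t\<in>B (lab s). \<Sum>k\<in>K. cnj (z s) * ell2_inner X (v k s) (v k t) * z t)"
    unfolding B_def by (rule sum.image_gen[OF S])
  also have "\<dots> = (\<Sum>l\<in>lab ` S. \<Sum>s\<in>B l. \<Sum>t\<in>B l. \<Sum>k\<in>K. cnj (z s) * ell2_inner X (v k s) (v k t) * z t)"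
    by (intro sum.cong refl) (auto simp: B_def)
  also have "\<dots> = (\<Sum>l\<in>lab ` S. \<Sum>k\<in>K. \<Sum>s\<in>B l. \<Sum>t\<in>B l. cnj (z s) * ell2_inner X (v k s) (v k t) * z t)"
    by (intro sum.cong refl) (subst sum.swap[of _ K], subst sum.swap[of _ K], simp)
  also have "\<dots> = (\<Sum>l\<in>lab ` S. \<Sum>k\<in>K. complex_of_real ((ell2_norm X (u k l))\<^sup>2))"
    by (intro sum.cong refl) (simp add: uu[symmetric] ell2_inner_self u)
  also have "\<dots> = complex_of_real (\<Sum>l\<in>lab ` S. \<Sum>k\<in>K. (ell2_norm X (u k l))\<^sup>2)" by simp
  finally show "\<exists>\<rho>\<ge>0. (\<Sum>s\<in>S. \<Sum>t\<in>S. cnj (z s) * G s t * z t) = complex_of_real \<rho>"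
    by (intro exI[of _ "\<Sum>l\<in>lab ` S. \<Sum>k\<in>K. (ell2_norm X (u k l))\<^sup>2"]) (simp add: sum_nonneg)
qed

section \<open>Finite-dimensional algebras of block matrices\<close>

text \<open>The direct sum of full matrix algebras, one for each label occurring in
  \<open>Y\<close>. Entries outside \<open>Y\<close> are 0, so that equal matrices are equal
  functions; natural numbers as indices fit the type fixed in \<open>nuc_triple\<close>.\<close>

definition blk :: "nat set \<Rightarrow> (nat \<Rightarrow> 'l) \<Rightarrow> (nat \<Rightarrow> nat \<Rightarrow> complex) set" where
  "blk Y lab = {m. \<forall>p q. m p q \<noteq> 0 \<longrightarrow> p \<in> Y \<and> q \<in> Y \<and> lab p = lab q}"

text \<open>The norm is that of operators on \<open>ell2 Y\<close>, so the norm axioms transfer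
  along \<open>matrix_operator\<close>, which is a homomorphism for finite \<open>Y\<close>.\<close>

definition blk_alg :: "nat set \<Rightarrow> (nat \<Rightarrow> 'l) \<Rightarrow> (nat \<Rightarrow> nat \<Rightarrow> complex) cstar" where
  "blk_alg Y lab =
     \<lparr>carrier = blk Y lab,
      monoid.mult = (\<lambda>a b p q. \<Sum>r\<in>Y. a p r * b r q),
      one = (\<lambda>p q. if p = q \<and> p \<in> Y then 1 else 0),
      ring.zero = (\<lambda>p q. 0),
      add = (\<lambda>a b p q. a p q + b p q),
      smult = (\<lambda>c a p q. c * a p q),
      star = (\<lambda>a p q. cnj (a q p)),
      nrm = (\<lambda>a. op_norm Y (matrix_operator Y a))\<rparr>"

lemma blk_alg_simps [simp]:
  "carrier (blk_alg Y lab) = blk Y lab"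
  "a \<otimes>\<^bsub>blk_alg Y lab\<^esub> b = (\<lambda>p q. \<Sum>r\<in>Y. a p r * b r q)"
  "a \<oplus>\<^bsub>blk_alg Y lab\<^esub> b = (\<lambda>p q. a p q + b p q)"
  "c \<odot>\<^bsub>blk_alg Y lab\<^esub> a = (\<lambda>p q. c * a p q)"
  "\<zero>\<^bsub>blk_alg Y lab\<^esub> = (\<lambda>p q. 0)"
  "star (blk_alg Y lab) a = (\<lambda>p q. cnj (a q p))"
  "nrm (blk_alg Y lab) a = op_norm Y (matrix_operator Y a)"
  by (simp_all add: blk_alg_def)

lemma blk_outside: "m \<in> blk Y lab \<Longrightarrow> \<not> (p \<in> Y \<and> q \<in> Y \<and> lab p = lab q) \<Longrightarrow> m p q = 0"
  by (auto simp: blk_def)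

lemma blk_plus:
  assumes "a \<in> blk Y lab" "b \<in> blk Y lab"
  shows "(\<lambda>p q. a p q + b p q) \<in> blk Y lab"
  unfolding blk_def
proof (intro CollectI allI impI)
  fix p q assume "a p q + b p q \<noteq> 0"
  then have "a p q \<noteq> 0 \<or> b p q \<noteq> 0" by auto
  then show "p \<in> Y \<and> q \<in> Y \<and> lab p = lab q" using assms by (auto simp: blk_def)
qed

lemma blk_uminus: "a \<in> blk Y lab \<Longrightarrow> (\<lambda>p q. - a p q) \<in> blk Y lab"
  by (auto simp: blk_def)

lemma blk_0: "(\<lambda>p q. 0) \<in> blk Y lab"
  by (simp add: blk_def)

lemma blk_scale: "a \<in> blk Y lab \<Longrightarrow> (\<lambda>p q. c * a p q) \<in> blk Y lab"
  by (auto simp: blk_def)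

lemma blk_star: "a \<in> blk Y lab \<Longrightarrow> (\<lambda>p q. cnj (a q p)) \<in> blk Y lab"
  by (auto simp: blk_def)

lemma blk_mult:
  assumes "a \<in> blk Y lab" "b \<in> blk Y lab"
  shows "(\<lambda>p q. \<Sum>r\<in>Y. a p r * b r q) \<in> blk Y lab"
  unfolding blk_def
proof (intro CollectI allI impI)
  fix p q assume "(\<Sum>r\<in>Y. a p r * b r q) \<noteq> 0"
  then obtain r where "a p r * b r q \<noteq> 0" by (meson sum.neutral)
  then have "a p r \<noteq> 0" "b r q \<noteq> 0" by auto
  then show "p \<in> Y \<and> q \<in> Y \<and> lab p = lab q" using assms by (auto simp: blk_def)
qed

lemma blk_abelian_group: "abelian_group (blk_alg Y lab)"
proof (rule abelian_groupI)
  fix a assume "a \<in> carrier (blk_alg Y lab)"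
  then show "\<exists>b\<in>carrier (blk_alg Y lab). b \<oplus>\<^bsub>blk_alg Y lab\<^esub> a = \<zero>\<^bsub>blk_alg Y lab\<^esub>"
    by (intro bexI[of _ "\<lambda>p q. - a p q"]) (simp_all add: blk_uminus)
qed (simp_all add: blk_plus blk_0 ac_simps)

lemma blk_a_minus:
  assumes "a \<in> blk Y lab" "b \<in> blk Y lab"
  shows "a \<ominus>\<^bsub>blk_alg Y lab\<^esub> b = (\<lambda>p q. a p q - b p q)"
proof -
  interpret abelian_group "blk_alg Y lab" by (rule blk_abelian_group)
  have "\<ominus>\<^bsub>blk_alg Y lab\<^esub> b = (\<lambda>p q. - b p q)"
    by (rule minus_equality) (simp_all add: assms blk_uminus)
  then show ?thesis by (simp add: a_minus_def)
qed

lemma blk_finsum: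
  assumes "finite I" "\<And>i. i \<in> I \<Longrightarrow> f i \<in> blk Y lab"
  shows "finsum (blk_alg Y lab) f I = (\<lambda>p q. \<Sum>i\<in>I. f i p q)"
proof -
  interpret abelian_group "blk_alg Y lab" by (rule blk_abelian_group)
  show ?thesis using assms
    by (induction I rule: finite_induct) (simp_all add: finsum_insert Pi_def)
qed

lemma complex_ring_cring: "cring complex_ring"
proof (rule cringI)
  show "abelian_group complex_ring"
    by (rule abelian_groupI) (auto simp: complex_ring_def intro: exI[of _ "- _"])
  show "comm_monoid complex_ring"
    by (rule comm_monoidI) (auto simp: complex_ring_def)
qed (auto simp: complex_ring_def distrib_right)

lemma blk_module: "Module.module complex_ring (blk_alg Y lab)"
proof (rule Module.moduleI[OF complex_ring_cring blk_abelian_group])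
qed (simp_all add: complex_ring_def blk_scale distrib_left distrib_right mult.assoc)

section \<open>Norm, completeness and dimension of the block matrix algebras\<close>

lemma finite_band:
  assumes "finite Y"
  shows "band Y (card Y) (\<Sum>p\<in>Y. \<Sum>q\<in>Y. cmod (m p q)) m"
proof -
  have "cmod (m p q) \<le> (\<Sum>p\<in>Y. \<Sum>q\<in>Y. cmod (m p q))" if "p \<in> Y" "q \<in> Y" for p q
  proof -
    have "cmod (m p q) \<le> (\<Sum>q\<in>Y. cmod (m p q))" by (rule member_le_sum) (use assms that in auto)
    also have "\<dots> \<le> (\<Sum>p\<in>Y. \<Sum>q\<in>Y. cmod (m p q))"
      by (rule member_le_sum[where f="\<lambda>p. \<Sum>q\<in>Y. cmod (m p q)"]) (use assms that in \<open>auto intro: sum_nonneg\<close>)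
    finally show ?thesis .
  qed
  then show ?thesis unfolding band_def using assms
    by (auto intro!: sum_nonneg card_mono)
qed

lemma finite_matrix_bop: "finite Y \<Longrightarrow> matrix_operator Y m \<in> bounded_operators Y"
  by (rule band_bop[OF finite_band])

lemma finite_matrix_comp:
  assumes "finite Y"
  shows "matrix_operator Y (\<lambda>p q. \<Sum>r\<in>Y. a p r * b r q) = matrix_operator Y a \<circ> matrix_operator Y b"
  by (rule matrix_operator_comp[symmetric, where R="\<lambda>_. Y"]) (simp_all add: finite_matrix_bop assms)

lemma finite_matrix_adjoint:
  assumes "finite Y"
  shows "matrix_operator Y (\<lambda>p q. cnj (a q p)) = op_adjoint Y (matrix_operator Y a)"
  by (rule matrix_operator_adjoint[symmetric]) (simp_all add: finite_matrix_bop assms)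

lemma finite_matrix_plus:
  assumes "finite Y"
  shows "matrix_operator Y (\<lambda>p q. a p q + b p q) = (\<lambda>f x. matrix_operator Y a f x + matrix_operator Y b f x)"
  by (rule matrix_operator_plus) (simp_all add: finite_matrix_bop assms)

lemma finite_matrix_scale:
  assumes "finite Y"
  shows "matrix_operator Y (\<lambda>p q. c * a p q) = (\<lambda>f x. c * matrix_operator Y a f x)"
  by (rule matrix_operator_scale) (simp_all add: finite_matrix_bop assms)

text \<open>Entries are bounded by the norm, and the norm by a multiple of the sum of their moduli.
  So Cauchy sequences converge entrywise, and the entrywise limit is a norm limit.\<close>

lemma blk_complete:
  assumes Y: "finite Y" and s: "range s \<subseteq> blk Y lab"
    and cauchy: "\<forall>e>0. \<exists>N. \<forall>m\<ge>N. \<forall>n\<ge>N. nrm (blk_alg Y lab) (s m \<ominus>\<^bsub>blk_alg Y lab\<^esub> s n) < e"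
  shows "\<exists>x\<in>blk Y lab. (\<lambda>n. nrm (blk_alg Y lab) (s n \<ominus>\<^bsub>blk_alg Y lab\<^esub> x)) \<longlonglongrightarrow> 0"
proof -
  have sb: "s n \<in> blk Y lab" for n using s by auto
  have ent: "cmod (m p q) \<le> op_norm Y (matrix_operator Y m)" if "p \<in> Y" "q \<in> Y" for m p q
    using op_entry_le[OF finite_matrix_bop[OF Y] that, of m] by (simp add: matrix_operator_entry that)
  have "convergent (\<lambda>n. s n p q)" for p q
  proof (cases "p \<in> Y \<and> q \<in> Y")
    case True
    have "Cauchy (\<lambda>n. s n p q)"
    proof (rule metric_CauchyI)
      fix e :: real assume "e > 0"
      then obtain N where N: "\<And>m n. m \<ge> N \<Longrightarrow> n \<ge> N \<Longrightarrow> op_norm Y (matrix_operator Y (\<lambda>p q. s m p q - s n p q)) < e"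
        using cauchy by (simp add: blk_a_minus sb) blast
      have "dist (s m p q) (s n p q) < e" if "m \<ge> N" "n \<ge> N" for m n
        using N[OF that] ent[of p q "\<lambda>p q. s m p q - s n p q"] True by (simp add: dist_norm)
      then show "\<exists>N. \<forall>m\<ge>N. \<forall>n\<ge>N. dist (s m p q) (s n p q) < e" by blast
    qed
    then show ?thesis by (simp add: Cauchy_convergent_iff)
  next
    case False
    then have "s n p q = 0" for n using blk_outside[OF sb] by blast
    then show ?thesis by (simp add: convergent_const)
  qed
  then have lim: "(\<lambda>n. s n p q) \<longlonglongrightarrow> lim (\<lambda>n. s n p q)" for p q by (simp add: convergent_LIMSEQ_iff)
  define x where "x p q = lim (\<lambda>n. s n p q)" for p q
  have x: "x \<in> blk Y lab" unfolding blk_def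
  proof (intro CollectI allI impI)
    fix p q assume "x p q \<noteq> 0"
    show "p \<in> Y \<and> q \<in> Y \<and> lab p = lab q"
    proof (rule ccontr)
      assume "\<not> (p \<in> Y \<and> q \<in> Y \<and> lab p = lab q)"
      then have "s n p q = 0" for n by (rule blk_outside[OF sb])
      then show False using \<open>x p q \<noteq> 0\<close> by (simp add: x_def)
    qed
  qed
  have "(\<lambda>n. op_norm Y (matrix_operator Y (\<lambda>p q. s n p q - x p q))) \<longlonglongrightarrow> 0"
  proof (rule Lim_null_comparison[OF always_eventually[OF allI]])
    show "norm (op_norm Y (matrix_operator Y (\<lambda>p q. s n p q - x p q))) \<le>
        real (card Y) * (\<Sum>p\<in>Y. \<Sum>q\<in>Y. cmod (s n p q - x p q))" for n
      using band_norm[OF finite_band[OF Y], of "\<lambda>p q. s n p q - x p q"]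
        op_norm_nonneg[OF finite_matrix_bop[OF Y], of "\<lambda>p q. s n p q - x p q"] by simp
    have "(\<lambda>n. real (card Y) * (\<Sum>p\<in>Y. \<Sum>q\<in>Y. cmod (s n p q - x p q))) \<longlonglongrightarrow>
        real (card Y) * (\<Sum>p\<in>Y. \<Sum>q\<in>Y. cmod (x p q - x p q))"
      unfolding x_def by (intro tendsto_intros lim)
    then show "(\<lambda>n. real (card Y) * (\<Sum>p\<in>Y. \<Sum>q\<in>Y. cmod (s n p q - x p q))) \<longlonglongrightarrow> 0" by simp
  qed
  then show ?thesis using x by (intro bexI[of _ x]) (simp_all add: blk_a_minus sb)
qed

lemma blk_cstar_algebra:
  assumes Y: "finite Y"
  shows "cstar_algebra (blk_alg Y lab)"
proof (rule cstar_algebra.intro[OF blk_module], rule cstar_algebra_axioms.intro, goal_cases)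
  \<comment> \<open>The case numbers follow the order of the axioms in \<open>cstar_algebra\<close>:
    2 is associativity, 12 to 18 concern the norm and completeness.\<close>
  case (2 a b c)
  have "(\<Sum>r\<in>Y. (\<Sum>s\<in>Y. a p s * b s r) * c r q) = (\<Sum>r\<in>Y. a p r * (\<Sum>s\<in>Y. b r s * c s q))" for p q
    unfolding sum_distrib_left sum_distrib_right mult.assoc by (rule sum.swap)
  then show ?case by simp
next
  case (12 a)
  then show ?case by (simp add: op_norm_nonneg finite_matrix_bop Y)
next
  case (13 a)
  have "a = (\<lambda>p q. 0)" if "matrix_operator Y a = (\<lambda>f x. 0)"
  proof (intro ext)
    fix p q show "a p q = 0"
    proof (cases "p \<in> Y \<and> q \<in> Y")
      case True
      then show ?thesis using matrix_operator_entry[of p Y q a] that by simp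
    next
      case False
      then show ?thesis using blk_outside[of a] 13 by auto
    qed
  qed
  moreover have "matrix_operator Y (\<lambda>p q. 0) = (\<lambda>f x. 0)"
    by (simp add: matrix_operator_def fun_eq_iff)
  ultimately show ?case by (auto simp: op_norm_eq_0 finite_matrix_bop Y)
next
  case (14 a b)
  show ?case using op_norm_plus[OF finite_matrix_bop[OF Y] finite_matrix_bop[OF Y], of a b]
    by (simp add: finite_matrix_plus Y)
next
  case (15 a c)
  show ?case using op_norm_scale[OF finite_matrix_bop[OF Y], of c a] by (simp add: finite_matrix_scale Y)
next
  case (16 a b)
  show ?case using op_norm_comp[OF finite_matrix_bop[OF Y] finite_matrix_bop[OF Y], of a b]
    by (simp add: finite_matrix_comp Y)
next
  case (17 a)
  show ?case using op_norm_cstar[OF finite_matrix_bop[OF Y], of a]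
    by (simp add: finite_matrix_comp finite_matrix_adjoint Y)
next
  case (18 s)
  then show ?case using blk_complete[OF Y, of s lab] by simp
qed (simp_all add: blk_mult blk_star sum_distrib_left sum_distrib_right sum.distrib algebra_simps cnj_sum)

lemma blk_finite_dim:
  assumes Y: "finite Y"
  shows "finite_dim_cstar (blk_alg Y lab)"
proof -
  define E :: "nat \<Rightarrow> nat \<Rightarrow> nat \<Rightarrow> nat \<Rightarrow> complex" where
    "E p q = (\<lambda>p' q'. if p' = p \<and> q' = q then 1 else 0)" for p q
  define P where "P = {(p, q). p \<in> Y \<and> q \<in> Y \<and> lab p = lab q}"
  have P: "finite P" by (rule finite_subset[of _ "Y \<times> Y"]) (use Y in \<open>auto simp: P_def\<close>)
  have inj: "inj_on (case_prod E) P"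
  proof (rule inj_onI)
    fix s t assume "case_prod E s = case_prod E t"
    then have "case_prod E s (fst t) (snd t) = 1" by (simp add: E_def split_beta)
    then show "s = t" by (auto simp: E_def split_beta prod_eq_iff split: if_splits)
  qed
  let ?S = "case_prod E ` P"
  have S: "?S \<subseteq> blk Y lab" by (auto simp: P_def E_def blk_def split: if_splits)
  have "\<exists>c. x = (\<Oplus>\<^bsub>blk_alg Y lab\<^esub>s\<in>?S. c s \<odot>\<^bsub>blk_alg Y lab\<^esub> s)" if x: "x \<in> blk Y lab" for x
  proof -
    \<comment> \<open>The coefficient has to be a function of the matrix unit, not of its index
      pair; the pair is recovered by injectivity of \<open>E\<close>.\<close>
    define c where "c s = (let (p, q) = the_inv_into P (case_prod E) s in x p q)" for s
    have "(\<Oplus>\<^bsub>blk_alg Y lab\<^esub>s\<in>?S. c s \<odot>\<^bsub>blk_alg Y lab\<^esub> s) = (\<lambda>p q. \<Sum>s\<in>?S. c s * s p q)"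
      by (subst blk_finsum[of ?S]) (use P S in \<open>auto intro!: blk_scale\<close>)
    also have "\<dots> = x"
    proof (intro ext)
      fix p q
      have "(\<Sum>s\<in>?S. c s * s p q) = (\<Sum>t\<in>P. c (case_prod E t) * case_prod E t p q)"
        by (simp add: sum.reindex[OF inj])
      also have "\<dots> = (\<Sum>t\<in>P. if t = (p, q) then x p q else 0)"
      proof (rule sum.cong[OF refl])
        fix t assume t: "t \<in> P"
        have "c (case_prod E t) = case_prod x t"
          unfolding c_def the_inv_into_f_f[OF inj t] by (simp add: split_beta)
        then show "c (case_prod E t) * case_prod E t p q = (if t = (p, q) then x p q else 0)"
          by (auto simp: E_def split_beta prod_eq_iff)
      qed
      also have "\<dots> = x p q" using P blk_outside[OF x, of p q] by (auto simp: P_def)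
      finally show "(\<Sum>s\<in>?S. c s * s p q) = x p q" .
    qed
    finally show ?thesis by (intro exI[of _ c]) (rule sym)
  qed
  then show ?thesis unfolding finite_dim_cstar_def
    using blk_cstar_algebra[OF Y] P S by (intro conjI exI[of _ ?S]) simp_all
qed

text \<open>Only the row index is tested; labels determine colours wherever this is used, so the
  column has the same colour.\<close>

definition blk_ideal :: "nat set \<Rightarrow> (nat \<Rightarrow> 'l) \<Rightarrow> (nat \<Rightarrow> nat) \<Rightarrow> nat \<Rightarrow> (nat \<Rightarrow> nat \<Rightarrow> complex) set" where
  "blk_ideal Y lab \<kappa> i = {m \<in> blk Y lab. \<forall>p q. m p q \<noteq> 0 \<longrightarrow> \<kappa> p = i}"

text \<open>Cutting by the colour of the row gives the components. They are unique since an entry in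
  row \<open>p\<close> can only come from the component of colour \<open>\<kappa> p\<close>.\<close>

lemma blk_ideal_decomposition:
  assumes Y: "finite Y" and \<kappa>: "\<And>p q. p \<in> Y \<Longrightarrow> q \<in> Y \<Longrightarrow> lab p = lab q \<Longrightarrow> \<kappa> p = \<kappa> q"
    and \<kappa>n: "\<And>p. p \<in> Y \<Longrightarrow> \<kappa> p \<le> n"
  shows "ideal_decomposition (blk_alg Y lab) n (blk_ideal Y lab \<kappa>)"
  unfolding ideal_decomposition_def
proof (intro conjI allI impI ballI)
  fix i
  interpret Module.module complex_ring "blk_alg Y lab" by (rule blk_module)
  have sub: "submodule (blk_ideal Y lab \<kappa> i) complex_ring (blk_alg Y lab)"
  proof (rule submoduleI)
    fix a assume a: "a \<in> blk_ideal Y lab \<kappa> i"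
    have "\<ominus>\<^bsub>blk_alg Y lab\<^esub> a = (\<lambda>p q. - a p q)"
      by (rule minus_equality) (use a in \<open>auto simp: blk_ideal_def blk_uminus\<close>)
    then show "\<ominus>\<^bsub>blk_alg Y lab\<^esub> a \<in> blk_ideal Y lab \<kappa> i"
      using a by (auto simp: blk_ideal_def blk_uminus)
  next
    fix a b assume "a \<in> blk_ideal Y lab \<kappa> i" "b \<in> blk_ideal Y lab \<kappa> i"
    then show "a \<oplus>\<^bsub>blk_alg Y lab\<^esub> b \<in> blk_ideal Y lab \<kappa> i"
      unfolding blk_ideal_def by (auto simp: blk_plus) (metis add_0)
  qed (auto simp: blk_ideal_def blk_0 blk_scale)
  have mult: "a \<otimes>\<^bsub>blk_alg Y lab\<^esub> x \<in> blk_ideal Y lab \<kappa> i \<and> x \<otimes>\<^bsub>blk_alg Y lab\<^esub> a \<in> blk_ideal Y lab \<kappa> i"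
    if a: "a \<in> blk Y lab" and x: "x \<in> blk_ideal Y lab \<kappa> i" for a x
  proof -
    have xb: "x \<in> blk Y lab" and xi: "\<And>p q. x p q \<noteq> 0 \<Longrightarrow> \<kappa> p = i" using x by (auto simp: blk_ideal_def)
    have "\<kappa> p = i" if "(\<Sum>r\<in>Y. a p r * x r q) \<noteq> 0" for p q
    proof -
      obtain r where "a p r * x r q \<noteq> 0" using \<open>(\<Sum>r\<in>Y. a p r * x r q) \<noteq> 0\<close> by (meson sum.neutral)
      then have "a p r \<noteq> 0" "x r q \<noteq> 0" by auto
      then show ?thesis using xi[of r q] \<kappa>[of p r] blk_outside[OF a, of p r] by auto
    qed
    moreover have "\<kappa> p = i" if "(\<Sum>r\<in>Y. x p r * a r q) \<noteq> 0" for p q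
    proof -
      obtain r where "x p r * a r q \<noteq> 0" using \<open>(\<Sum>r\<in>Y. x p r * a r q) \<noteq> 0\<close> by (meson sum.neutral)
      then show ?thesis using xi[of p r] by auto
    qed
    ultimately show ?thesis using blk_mult[OF a xb] blk_mult[OF xb a] by (simp add: blk_ideal_def) blast
  qed
  show "cstar_ideal (blk_ideal Y lab \<kappa> i) (blk_alg Y lab)"
    unfolding cstar_ideal_def using sub mult by simp
next
  fix x assume "x \<in> carrier (blk_alg Y lab)"
  then have x: "x \<in> blk Y lab" by simp
  let ?I = "blk_ideal Y lab \<kappa>"
  define f where "f = (\<lambda>i\<in>{..n}. \<lambda>p q. if \<kappa> p = i then x p q else 0)"
  have f: "f \<in> (\<Pi>\<^sub>E i\<in>{..n}. ?I i)"
    using x by (auto simp: f_def blk_ideal_def blk_def)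
  have fs: "finsum (blk_alg Y lab) g {..n} = (\<lambda>p q. \<Sum>i\<le>n. g i p q)" if "g \<in> (\<Pi>\<^sub>E i\<in>{..n}. ?I i)" for g
    by (rule blk_finsum) (use that in \<open>auto simp: blk_ideal_def PiE_iff\<close>)
  show "\<exists>!f. f \<in> (\<Pi>\<^sub>E i\<in>{..n}. ?I i) \<and> x = (\<Oplus>\<^bsub>blk_alg Y lab\<^esub>i\<in>{..n}. f i)"
  proof (rule ex1I[of _ f])
    have "x p q = (\<Sum>i\<le>n. f i p q)" for p q
    proof (cases "x p q = 0")
      case True
      then show ?thesis by (auto simp: f_def intro!: sum.neutral[symmetric])
    next
      case False
      then have "\<kappa> p \<le> n" using blk_outside[OF x, of p q] \<kappa>n by auto
      have "(\<Sum>i\<le>n. f i p q) = (\<Sum>i\<le>n. if \<kappa> p = i then x p q else 0)"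
        by (intro sum.cong refl) (simp add: f_def)
      then show ?thesis using \<open>\<kappa> p \<le> n\<close> by simp
    qed
    then show "f \<in> (\<Pi>\<^sub>E i\<in>{..n}. ?I i) \<and> x = (\<Oplus>\<^bsub>blk_alg Y lab\<^esub>i\<in>{..n}. f i)"
      using f fs[OF f] by (simp add: fun_eq_iff)
  next
    fix g assume "g \<in> (\<Pi>\<^sub>E i\<in>{..n}. ?I i) \<and> x = (\<Oplus>\<^bsub>blk_alg Y lab\<^esub>i\<in>{..n}. g i)"
    then have g: "g \<in> (\<Pi>\<^sub>E i\<in>{..n}. ?I i)" and gx: "x = (\<lambda>p q. \<Sum>i\<le>n. g i p q)" using fs by auto
    have gi: "g i p q = 0" if "i \<le> n" "\<kappa> p \<noteq> i" for i p q
      using g that by (auto simp: PiE_iff blk_ideal_def)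
    show "g = f"
    proof (rule PiE_ext[OF g f], intro ext)
      fix i p q assume "i \<in> {..n}"
      then have i: "i \<le> n" by simp
      show "g i p q = f i p q"
      proof (cases "\<kappa> p = i")
        case True
        have "x p q = (\<Sum>j\<le>n. if j = i then g i p q else 0)"
          unfolding gx by (intro sum.cong refl) (use gi True in auto)
        then show ?thesis using i True by (simp add: f_def)
      next
        case False
        then show ?thesis using gi[OF i] i by (simp add: f_def)
      qed
    qed
  qed
qed

section \<open>Coloured partitions of unity from asymptotic dimension\<close>

context bg_space
begin

text \<open>
  With \<open>\<sigma> k x\<close> the set of cover members containing the ball of radius \<open>k s\<close> about \<open>x\<close>, the
  cardinalities of \<open>\<sigma> 0 x \<supseteq> \<dots> \<supseteq> \<sigma> (n + 1) x\<close> lie in \<open>{1..n + 1}\<close>, so two consecutive ones agree.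
  Their common cardinality is the colour of \<open>x\<close> and \<open>\<sigma> k x\<close> its label.
\<close>

lemma coloured_cover:
  assumes asdim: "asdim_le X d n" and s: "s > 0"
  shows "\<exists>(U :: nat \<Rightarrow> 'x set) (L :: nat \<Rightarrow> 'x \<Rightarrow> 'x set set) D.
    (\<forall>x\<in>X. \<exists>i\<le>n. x \<in> U i) \<and> (\<forall>i. U i \<subseteq> X) \<and>
    (\<forall>i. \<forall>x\<in>U i. \<forall>y\<in>U i. d x y \<le> s \<longrightarrow> L i x = L i y) \<and>
    (\<forall>i. \<forall>x\<in>U i. \<forall>y\<in>U i. L i x = L i y \<longrightarrow> d x y \<le> D)"
proof -
  define B where "B x t = {y\<in>X. d x y \<le> t}" for x t
  \<comment> \<open>Index \<open>n + 1\<close> is the last one used, so balls of this radius have to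
    fit into members of the cover; this makes \<open>\<sigma> (Suc n) x\<close> nonempty.\<close>
  define T where "T = real (Suc n) * s"
  have T: "T \<ge> 0" using s by (simp add: T_def)
  have xB: "x \<in> B x t" if "x \<in> X" "t \<ge> 0" for x t using that by (simp add: B_def)
  have cover: "uniform_cover X d ((\<lambda>x. B x T) ` X)"
    unfolding uniform_cover_def
  proof (intro conjI exI[of _ "T + T"] ballI)
    show "\<Union> ((\<lambda>x. B x T) ` X) = X"
    proof
      show "\<Union> ((\<lambda>x. B x T) ` X) \<subseteq> X" by (auto simp: B_def)
      show "X \<subseteq> \<Union> ((\<lambda>x. B x T) ` X)" using xB[OF _ T] by blast
    qed
    fix V y z assume "V \<in> (\<lambda>x. B x T) ` X" and yz: "y \<in> V" "z \<in> V"
    then obtain x where x: "x \<in> X" "y \<in> X" "z \<in> X" "d x y \<le> T" "d x z \<le> T" by (auto simp: B_def)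
    then show "d y z \<le> T + T" using triangle[of y x z] commute[of x y] by simp
  qed
  obtain V where V': "uniform_cover X d V \<and> cover_order_le V n \<and> (\<forall>U\<in>(\<lambda>x. B x T) ` X. \<exists>W\<in>V. U \<subseteq> W)"
    using asdim[unfolded asdim_le_def, rule_format, OF cover] by (elim exE)
  then have V: "uniform_cover X d V" "cover_order_le V n" by simp_all
  have ref: "\<exists>W\<in>V. B x T \<subseteq> W" if "x \<in> X" for x using V' that by simp
  obtain D where "\<forall>W\<in>V. \<forall>x\<in>W. \<forall>y\<in>W. d x y \<le> D"
    using V(1) unfolding uniform_cover_def by (elim conjE exE)
  then have D: "d x y \<le> D" if "W \<in> V" "x \<in> W" "y \<in> W" for W x y using that by simp
  define \<sigma> where "\<sigma> k x = {W\<in>V. B x (real k * s) \<subseteq> W}" for k x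
  have mem: "x \<in> W" if "W \<in> \<sigma> k x" "x \<in> X" for W k x
    using that xB[of x "real k * s"] s by (auto simp: \<sigma>_def)
  \<comment> \<open>All members in \<open>\<sigma> k x\<close> contain \<open>x\<close>, so the
    order of the cover allows at most \<open>n + 1\<close> of them.\<close>
  have fin: "finite (\<sigma> k x) \<and> card (\<sigma> k x) \<le> Suc n" if x: "x \<in> X" for k x
  proof (rule ccontr)
    assume "\<not> (finite (\<sigma> k x) \<and> card (\<sigma> k x) \<le> Suc n)"
    then have "infinite (\<sigma> k x) \<or> n + 2 \<le> card (\<sigma> k x)" by auto
    then obtain W where W: "finite W" "card W = n + 2" "W \<subseteq> \<sigma> k x"
    proof
      assume "infinite (\<sigma> k x)"
      then show ?thesis using infinite_arbitrarily_large[of "\<sigma> k x" "n + 2"] that by blast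
    next
      assume "n + 2 \<le> card (\<sigma> k x)"
      then show ?thesis by (rule obtain_subset_with_card_n) (rule that)
    qed
    have "W \<subseteq> V" using W(3) by (auto simp: \<sigma>_def)
    then have "\<Inter>W = {}" using V(2) W unfolding cover_order_le_def by blast
    moreover have "x \<in> \<Inter>W" using W(3) mem[OF _ x] by blast
    ultimately show False by blast
  qed
  have anti: "\<sigma> k' x \<subseteq> \<sigma> k x" if "k \<le> k'" for k k' x
  proof -
    have "real k * s \<le> real k' * s" using that s by (intro mult_right_mono) auto
    then have "B x (real k * s) \<subseteq> B x (real k' * s)" by (auto simp: B_def)
    then show ?thesis by (auto simp: \<sigma>_def)
  qed
  have ne: "card (\<sigma> (Suc n) x) \<ge> 1" if x: "x \<in> X" for x
  proof -
    have "\<sigma> (Suc n) x \<noteq> {}" using ref[OF x] by (auto simp: \<sigma>_def T_def)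
    then show ?thesis using fin[OF x, of "Suc n"] by (simp add: Suc_le_eq card_gt_0_iff)
  qed
  \<comment> \<open>Without a stable index, \<open>n + 1\<close> strict decreases from at most
    \<open>n + 1\<close> members would leave none at index \<open>n + 1\<close>.\<close>
  have stable: "\<exists>k\<le>n. \<sigma> k x = \<sigma> (Suc k) x" if x: "x \<in> X" for x
  proof (rule ccontr)
    assume no: "\<not> (\<exists>k\<le>n. \<sigma> k x = \<sigma> (Suc k) x)"
    have "k \<le> Suc n \<Longrightarrow> card (\<sigma> k x) + k \<le> Suc n" for k
    proof (induction k)
      case 0
      then show ?case using fin[OF x] by simp
    next
      case (Suc k)
      have "\<sigma> (Suc k) x \<subset> \<sigma> k x" using anti[of k "Suc k" x] no Suc.prems by auto
      then have "card (\<sigma> (Suc k) x) < card (\<sigma> k x)" using fin[OF x] by (intro psubset_card_mono) auto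
      then show ?case using Suc by auto
    qed
    from this[of "Suc n"] show False using ne[OF x] by simp
  qed
  \<comment> \<open>Cardinalities from 1 to \<open>n + 1\<close> become colours from 0 to
    \<open>n\<close>; the sets \<open>U i\<close> may overlap.\<close>
  define P where "P i x k \<longleftrightarrow> k \<le> n \<and> \<sigma> k x = \<sigma> (Suc k) x \<and> card (\<sigma> k x) = Suc i" for i x k
  define U where "U i = {x\<in>X. \<exists>k. P i x k}" for i
  define K where "K i x = (SOME k. P i x k)" for i x
  have K: "P i x (K i x)" if "x \<in> U i" for i x
    unfolding K_def by (rule someI_ex) (use that in \<open>auto simp: U_def\<close>)
  define L where "L i x = \<sigma> (K i x) x" for i x
  \<comment> \<open>Moving the centre by \<open>s\<close> costs one step of the radius, and by
    stability \<open>L i x\<close> is also the set at the next index; therefore it is contained in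
    \<open>L i y\<close>. Both have \<open>Suc i\<close> elements, so they coincide.\<close>
  have sep: "L i x = L i y" if xy: "x \<in> U i" "y \<in> U i" "d x y \<le> s" "K i y \<le> K i x" for i x y
  proof -
    have X: "x \<in> X" "y \<in> X" using xy by (auto simp: U_def)
    let ?k = "K i x"
    have "B y (real ?k * s) \<subseteq> B x (real (Suc ?k) * s)"
    proof
      fix z assume z: "z \<in> B y (real ?k * s)"
      then have "d x z \<le> s + real ?k * s" using triangle[of x y z] X xy(3) by (auto simp: B_def)
      then show "z \<in> B x (real (Suc ?k) * s)" using z by (auto simp: B_def algebra_simps)
    qed
    then have "\<sigma> (Suc ?k) x \<subseteq> \<sigma> ?k y" by (auto simp: \<sigma>_def)
    also have "\<dots> \<subseteq> \<sigma> (K i y) y" by (rule anti[OF xy(4)])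
    finally have sub: "L i x \<subseteq> L i y" using K[OF xy(1)] by (simp add: L_def P_def)
    show ?thesis
      by (rule card_subset_eq[OF _ sub]) (use K[OF xy(1)] K[OF xy(2)] fin[OF X(2)] in \<open>auto simp: L_def P_def\<close>)
  qed
  have cov: "\<forall>x\<in>X. \<exists>i\<le>n. x \<in> U i"
  proof
    fix x assume x: "x \<in> X"
    obtain k where k: "k \<le> n" "\<sigma> k x = \<sigma> (Suc k) x" using stable[OF x] by blast
    have "card (\<sigma> (Suc n) x) \<le> card (\<sigma> k x)"
      by (rule card_mono[OF conjunct1[OF fin[OF x]] anti]) (use k(1) in simp)
    then have "1 \<le> card (\<sigma> k x)" using ne[OF x] by simp
    then have "P (card (\<sigma> k x) - 1) x k" using k by (simp add: P_def)
    moreover have "card (\<sigma> k x) - 1 \<le> n" using conjunct2[OF fin[OF x, of k]] by arith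
    ultimately show "\<exists>i\<le>n. x \<in> U i" using x unfolding U_def by blast
  qed
  have sep': "L i x = L i y" if "x \<in> U i" "y \<in> U i" "d x y \<le> s" for i x y
    using sep[of x i y] sep[of y i x] that commute[of x y] by (cases "K i y \<le> K i x") auto
  \<comment> \<open>A label has \<open>Suc i\<close> members, so at least one, and any of them
    contains both points.\<close>
  have bd: "d x y \<le> D" if xy: "x \<in> U i" "y \<in> U i" "L i x = L i y" for i x y
  proof -
    have X: "x \<in> X" "y \<in> X" using xy by (auto simp: U_def)
    have "card (L i x) = Suc i" using K[OF xy(1)] unfolding P_def L_def by blast
    then obtain W where W: "W \<in> L i x" by fastforce
    have "x \<in> W" by (rule mem[OF _ X(1)]) (use W in \<open>simp add: L_def\<close>)
    moreover have "y \<in> W"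
      by (rule mem[of W "K i y", OF _ X(2)]) (use W in \<open>simp add: xy(3) L_def[of i y, symmetric]\<close>)
    ultimately show ?thesis using D W by (auto simp: L_def \<sigma>_def)
  qed
  have "\<forall>i. U i \<subseteq> X" by (auto simp: U_def)
  then show ?thesis
    by (intro exI[of _ U] exI[of _ L] exI[of _ D] conjI cov) (simp_all add: sep' bd)
qed

text \<open>The share \<open>p i x\<close> of the thresholds \<open>t < m\<close> for which
  \<open>x\<close> lies within \<open>t * R\<close> of \<open>U i\<close> is a discretised distance
  function: it equals 1 on \<open>U i\<close>, vanishes farther away than \<open>m * R\<close>, and
  moves by at most \<open>1 / m\<close> over a distance \<open>R\<close>. Dividing by the Euclidean
  norm \<open>S x\<close> makes the squares sum to 1. Labels are carried over from nearby points of
  \<open>U i\<close>.\<close>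

lemma coloured_partition:
  assumes asdim: "asdim_le X d n" and R: "R > 0" and \<epsilon>: "\<epsilon> > 0"
  shows "\<exists>(h :: nat \<Rightarrow> 'x \<Rightarrow> real) (lb :: nat \<Rightarrow> 'x \<Rightarrow> 'x set set) D.
    (\<forall>i x. 0 \<le> h i x) \<and> (\<forall>x\<in>X. (\<Sum>i\<le>n. (h i x)\<^sup>2) = 1) \<and>
    (\<forall>x\<in>X. \<forall>y\<in>X. d x y \<le> R \<longrightarrow> \<bar>1 - (\<Sum>i\<le>n. h i x * h i y)\<bar> \<le> \<epsilon>) \<and>
    (\<forall>i\<le>n. \<forall>x\<in>X. \<forall>y\<in>X. h i x > 0 \<longrightarrow> h i y > 0 \<longrightarrow> d x y \<le> R \<longrightarrow> lb i x = lb i y) \<and>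
    (\<forall>i\<le>n. \<forall>x\<in>X. \<forall>y\<in>X. h i x > 0 \<longrightarrow> h i y > 0 \<longrightarrow> lb i x = lb i y \<longrightarrow> d x y \<le> D)"
proof -
  \<comment> \<open>The error of the normalised functions turns out to be at most half the sum of
    \<open>n + 1\<close> squares \<open>(1 / m)^2\<close>.\<close>
  obtain m :: nat where m: "m > 0" "real (Suc n) / (2 * (real m)\<^sup>2) \<le> \<epsilon>"
  proof -
    obtain m :: nat where m: "real m > real (Suc n) / \<epsilon> + 1" using reals_Archimedean2 by blast
    have c: "0 \<le> real (Suc n) / \<epsilon>" using \<epsilon> by simp
    have m1: "real m \<ge> 1" using m c by linarith
    have "real (Suc n) \<le> \<epsilon> * real m" using m \<epsilon> by (simp add: field_simps)
    also have "\<dots> \<le> \<epsilon> * (2 * (real m)\<^sup>2)"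
      using \<epsilon> m1 by (intro mult_left_mono) (auto simp: power2_eq_square)
    finally have "real (Suc n) / (2 * (real m)\<^sup>2) \<le> \<epsilon>"
      using m1 by (subst pos_divide_le_eq) auto
    moreover have "m > 0" using m1 by (cases m) auto
    ultimately show ?thesis using that by blast
  qed
  \<comment> \<open>Two points at distance at most \<open>R\<close>, each within
    \<open>m * R\<close> of \<open>U i\<close>, have companions in \<open>U i\<close> at distance at
    most \<open>s\<close>.\<close>
  define s where "s = (2 * real m + 1) * R"
  have s: "s > 0" unfolding s_def using R by simp
  obtain U :: "nat \<Rightarrow> 'x set" and L :: "nat \<Rightarrow> 'x \<Rightarrow> 'x set set" and D
    where cover: "(\<forall>x\<in>X. \<exists>i\<le>n. x \<in> U i) \<and> (\<forall>i. U i \<subseteq> X) \<and>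
      (\<forall>i. \<forall>x\<in>U i. \<forall>y\<in>U i. d x y \<le> s \<longrightarrow> L i x = L i y) \<and>
      (\<forall>i. \<forall>x\<in>U i. \<forall>y\<in>U i. L i x = L i y \<longrightarrow> d x y \<le> D)"
    using coloured_cover[OF asdim s] by (elim exE)
  have cov: "\<exists>i\<le>n. x \<in> U i" if "x \<in> X" for x using cover that by simp
  have UX: "U i \<subseteq> X" for i using cover by simp
  have sep: "L i x = L i y" if "x \<in> U i" "y \<in> U i" "d x y \<le> s" for i x y using cover that by simp
  have bd: "d x y \<le> D" if "x \<in> U i" "y \<in> U i" "L i x = L i y" for i x y using cover that by simp
  define N where "N i t x \<longleftrightarrow> (\<exists>u\<in>U i. d x u \<le> real t * R)" for i t x
  define p where "p i x = real (card {t. t < m \<and> N i t x}) / real m" for i x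
  have p0: "0 \<le> p i x" for i x by (simp add: p_def)
  have p1: "p i x = 1" if "x \<in> U i" for i x
  proof -
    have "N i t x" for t unfolding N_def using that UX[of i] R by (intro bexI[of _ x]) auto
    then show ?thesis using m(1) by (simp add: p_def)
  qed
  \<comment> \<open>If \<open>x\<close> is within \<open>t * R\<close> of \<open>U i\<close>, then
    \<open>y\<close> is within \<open>(t + 1) * R\<close>; the shift loses only the threshold
    \<open>m - 1\<close>.\<close>
  have step: "card {t. t < m \<and> N i t x} \<le> card {t. t < m \<and> N i t y} + 1"
    if xy: "x \<in> X" "y \<in> X" "d x y \<le> R" for i x y
  proof -
    have sub: "Suc ` {t. Suc t < m \<and> N i t x} \<subseteq> {t. t < m \<and> N i t y}"
    proof (clarsimp)
      fix t assume "N i t x"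
      then obtain u where u: "u \<in> U i" "d x u \<le> real t * R" by (auto simp: N_def)
      have "d y u \<le> R + real t * R" using triangle[of y x u] u UX xy commute[of x y] by fastforce
      then show "N i (Suc t) y" unfolding N_def using u(1) by (auto simp: algebra_simps)
    qed
    have fin: "finite {t. Suc t < m \<and> N i t x}" by (rule finite_subset[of _ "{..<m}"]) auto
    have "{t. t < m \<and> N i t x} \<subseteq> insert (m - 1) {t. Suc t < m \<and> N i t x}" by auto
    then have "card {t. t < m \<and> N i t x} \<le> card (insert (m - 1) {t. Suc t < m \<and> N i t x})"
      by (rule card_mono[rotated]) (simp add: fin)
    also have "\<dots> \<le> card {t. Suc t < m \<and> N i t x} + 1" by (simp add: card_insert_if fin)
    also have "card {t. Suc t < m \<and> N i t x} = card (Suc ` {t. Suc t < m \<and> N i t x})"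
      by (simp add: card_image)
    also have "\<dots> \<le> card {t. t < m \<and> N i t y}" by (rule card_mono[OF _ sub]) auto
    finally show ?thesis by simp
  qed
  have lip: "\<bar>p i x - p i y\<bar> \<le> 1 / real m" if xy: "x \<in> X" "y \<in> X" "d x y \<le> R" for i x y
  proof -
    have "real (card {t. t < m \<and> N i t x}) \<le> real (card {t. t < m \<and> N i t y}) + 1"
      using step[OF xy, of i] by linarith
    moreover have "real (card {t. t < m \<and> N i t y}) \<le> real (card {t. t < m \<and> N i t x}) + 1"
      using step[OF xy(2,1), of i] xy(3) commute[of x y] by simp
    ultimately have "\<bar>real (card {t. t < m \<and> N i t x}) - real (card {t. t < m \<and> N i t y})\<bar> / real m \<le> 1 / real m"
      by (intro divide_right_mono) auto
    then show ?thesis unfolding p_def diff_divide_distrib[symmetric] abs_divide by simp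
  qed
  define S where "S x = L2_set (\<lambda>i. p i x) {..n}" for x
  have S2: "(S x)\<^sup>2 = (\<Sum>i\<le>n. (p i x)\<^sup>2)" for x by (simp add: S_def L2_set_def sum_nonneg)
  have S1: "S x \<ge> 1" if x: "x \<in> X" for x
  proof -
    obtain i where i: "i \<le> n" "x \<in> U i" using cov[OF x] by blast
    have "p i x \<le> S x" unfolding S_def by (rule member_le_L2_set) (use i in auto)
    then show ?thesis using p1[OF i(2)] by simp
  qed
  define h where "h i x = p i x / S x" for i x
  have Snn: "0 \<le> S x" for x by (simp add: S_def L2_set_nonneg)
  have h0: "0 \<le> h i x" for i x unfolding h_def using p0 Snn by simp
  have pos: "\<exists>u. u \<in> U i \<and> d x u \<le> real m * R" if "h i x > 0" for i x
  proof -
    have "{t. t < m \<and> N i t x} \<noteq> {}"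
    proof
      assume "{t. t < m \<and> N i t x} = {}"
      then have "h i x = 0" unfolding h_def p_def by simp
      then show False using that by simp
    qed
    then obtain t u where t: "t < m" "u \<in> U i" "d x u \<le> real t * R" by (auto simp: N_def)
    have "real t * R \<le> real m * R" using t R by (intro mult_right_mono) auto
    then show ?thesis using t by (intro exI[of _ u]) auto
  qed
  define u where "u i x = (SOME u. u \<in> U i \<and> d x u \<le> real m * R)" for i x
  have u: "u i x \<in> U i" "d x (u i x) \<le> real m * R" "u i x \<in> X" if "h i x > 0" for i x
    using someI_ex[OF pos[OF that]] UX[of i] unfolding u_def by auto
  define lb where "lb i x = L i (u i x)" for i x
  have "(\<Sum>i\<le>n. (h i x)\<^sup>2) = 1" if x: "x \<in> X" for x
    using S1[OF x] by (simp add: h_def power_divide sum_divide_distrib[symmetric] S2[symmetric])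
  note unit = this
  have near: "\<bar>1 - (\<Sum>i\<le>n. h i x * h i y)\<bar> \<le> \<epsilon>" if xy: "x \<in> X" "y \<in> X" "d x y \<le> R" for x y
  proof -
    let ?a = "S x" and ?b = "S y"
    define c where "c = (\<Sum>i\<le>n. p i x * p i y)"
    define q where "q = c / (?a * ?b)"
    have a: "?a \<ge> 1" and b: "?b \<ge> 1" using S1 xy by auto
    have ab: "?a * ?b \<ge> 1" using mult_mono[OF a b] a by simp
    have "c \<le> (\<Sum>i\<le>n. \<bar>p i x\<bar> * \<bar>p i y\<bar>)" unfolding c_def using p0 by simp
    also have "\<dots> \<le> ?a * ?b" unfolding S_def by (rule L2_set_mult_ineq)
    finally have c: "c \<le> ?a * ?b" .
    have q1: "q \<le> 1" unfolding q_def using c ab by (subst pos_divide_le_eq) auto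
    have "?a * ?b \<noteq> 0" using ab by linarith
    then have cq: "c = q * (?a * ?b)" unfolding q_def by (rule nonzero_divide_eq_eq[THEN iffD1]) (rule refl)
    have sum: "(\<Sum>i\<le>n. h i x * h i y) = q"
      by (simp add: h_def q_def c_def sum_divide_distrib)
    \<comment> \<open>With \<open>a = S x\<close> and \<open>b = S y\<close>, the squared distance
      of the vectors of values of \<open>p\<close> is \<open>(a - b)^2 + 2 a b (1 - q)\<close>;
      since \<open>a b >= 1\<close> and \<open>q <= 1\<close>, it dominates
      \<open>2 (1 - q)\<close>.\<close>
    have "(\<Sum>i\<le>n. (p i x - p i y)\<^sup>2) = ?a\<^sup>2 + ?b\<^sup>2 - 2 * c"
      unfolding S2 c_def by (simp add: power2_diff sum.distrib sum_subtractf sum_distrib_left mult.assoc)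
    also have "\<dots> = (?a - ?b)\<^sup>2 + 2 * (?a * ?b - 1) * (1 - q) + 2 * (1 - q)"
      unfolding cq by (simp add: power2_eq_square algebra_simps)
    finally have "2 * (1 - q) \<le> (\<Sum>i\<le>n. (p i x - p i y)\<^sup>2)" using ab q1 by simp
    also have "\<dots> \<le> (\<Sum>i\<le>n. (1 / real m)\<^sup>2)"
    proof (rule sum_mono)
      fix i show "(p i x - p i y)\<^sup>2 \<le> (1 / real m)\<^sup>2"
        using power_mono[OF lip[OF xy, of i], of 2] by simp
    qed
    also have "\<dots> = real (Suc n) * (1 / real m)\<^sup>2" by simp
    also have "\<dots> = 2 * (real (Suc n) / (2 * (real m)\<^sup>2))"
      using m(1) by (simp add: power_divide field_simps del: of_nat_Suc)
    finally have "1 - q \<le> real (Suc n) / (2 * (real m)\<^sup>2)" by (rule mult_left_le_imp_le) simp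
    then have "1 - q \<le> \<epsilon>" using m(2) by (rule order_trans)
    then show ?thesis unfolding sum using q1 by simp
  qed
  have same: "lb i x = lb i y" if xy: "x \<in> X" "y \<in> X" "h i x > 0" "h i y > 0" "d x y \<le> R" for i x y
  proof -
    note ux = u[OF xy(3)] and uy = u[OF xy(4)]
    have "d (u i x) (u i y) \<le> d (u i x) x + d x (u i y)" by (rule triangle[OF ux(3) xy(1) uy(3)])
    also have "d x (u i y) \<le> d x y + d y (u i y)" by (rule triangle[OF xy(1,2) uy(3)])
    finally have "d (u i x) (u i y) \<le> s"
      using ux(2) uy(2) xy(5) commute[of "u i x" x] unfolding s_def by (simp add: algebra_simps)
    then show ?thesis unfolding lb_def by (rule sep[OF ux(1) uy(1)])
  qed
  have diam: "d x y \<le> D + 2 * (real m * R)" if xy: "x \<in> X" "y \<in> X" "h i x > 0" "h i y > 0" "lb i x = lb i y" for i x y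
  proof -
    note ux = u[OF xy(3)] and uy = u[OF xy(4)]
    have "d x y \<le> d x (u i x) + d (u i x) y" by (rule triangle[OF xy(1) ux(3) xy(2)])
    also have "d (u i x) y \<le> d (u i x) (u i y) + d (u i y) y" by (rule triangle[OF ux(3) uy(3) xy(2)])
    finally show ?thesis
      using ux(2) uy(2) bd[OF ux(1) uy(1)] xy(5) commute[of "u i y" y] unfolding lb_def by simp
  qed
  show ?thesis
    by (intro exI[of _ h] exI[of _ lb] exI[of _ "D + 2 * (real m * R)"] conjI)
       (simp_all add: h0 unit near same diam)
qed

end

section \<open>Finitely many types of blocks\<close>

text \<open>
  Blocks of bounded size carry matrices with bounded entries; after rounding the entries only
  finitely many types remain, and \<open>t\<close> maps each block onto a representative of its type.
\<close>

lemma finite_types: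
  fixes lb :: "'x \<Rightarrow> 'l" and \<beta> :: "'a \<Rightarrow> 'x \<Rightarrow> 'x \<Rightarrow> complex"
  assumes G: "finite G" and \<eta>: "\<eta> > 0"
    and fin: "\<And>x. x \<in> S \<Longrightarrow> finite {y\<in>S. lb y = lb x}" "\<And>x. x \<in> S \<Longrightarrow> card {y\<in>S. lb y = lb x} \<le> K"
    and bd: "\<And>a x y. a \<in> G \<Longrightarrow> x \<in> S \<Longrightarrow> y \<in> S \<Longrightarrow> lb x = lb y \<Longrightarrow> cmod (\<beta> a x y) \<le> M"
  shows "\<exists>t. (\<forall>x\<in>S. t x \<in> S) \<and> finite (t ` S) \<and>
    (\<forall>x\<in>S. \<forall>y\<in>S. lb x = lb y \<longrightarrow> lb (t x) = lb (t y) \<and> (t x = t y \<longrightarrow> x = y) \<and>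
      (\<forall>a\<in>G. cmod (\<beta> a x y - \<beta> a (t x) (t y)) \<le> \<eta>)) \<and>
    (\<forall>x\<in>S. \<forall>z\<in>S. lb z = lb (t x) \<longrightarrow> (\<exists>y\<in>S. lb y = lb x \<and> t y = z))"
proof -
  define B where "B c = {x\<in>S. lb x = c}" for c
  define k where "k c = card (B c)" for c
  have Bfin: "finite (B c)" "k c \<le> K" if c: "c \<in> lb ` S" for c
    using c fin unfolding B_def k_def by auto
  \<comment> \<open>Enumerating each block puts the matrices on blocks of equal size over the same
    index set.\<close>
  define e where "e c = (SOME e. bij_betw e {0..<k c} (B c))" for c
  have e: "bij_betw (e c) {0..<k c} (B c)" if "c \<in> lb ` S" for c
    unfolding e_def k_def
    by (rule someI_ex[of "\<lambda>e. bij_betw e {0..<card (B c)} (B c)"])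
       (rule ex_bij_betw_nat_finite[OF Bfin(1)[OF that]])
  \<comment> \<open>A grid of mesh \<open>\<eta> / 2\<close>: numbers in the same cell differ by at
    most \<open>\<eta> / 2\<close> in real and imaginary part, hence by at most \<eta> in
    modulus.\<close>
  define quant where "quant z = (\<lfloor>Re z / (\<eta>/2)\<rfloor>, \<lfloor>Im z / (\<eta>/2)\<rfloor>)" for z
  have floor: "\<bar>x - y\<bar> \<le> \<eta>/2" if "\<lfloor>x / (\<eta>/2)\<rfloor> = \<lfloor>y / (\<eta>/2)\<rfloor>" for x y :: real
  proof -
    have "\<bar>u - v\<bar> \<le> 1" if "\<lfloor>u\<rfloor> = \<lfloor>v\<rfloor>" for u v :: real using that by linarith
    from this[OF that] have "\<bar>x / (\<eta>/2) - y / (\<eta>/2)\<bar> \<le> 1" .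
    then have "\<bar>(x - y) / (\<eta>/2)\<bar> \<le> 1" by (simp only: diff_divide_distrib)
    moreover have half: "0 < \<eta>/2" using \<eta> by simp
    ultimately have "\<bar>x - y\<bar> / (\<eta>/2) \<le> 1" by (simp only: abs_divide abs_of_pos)
    then show ?thesis using half by (simp only: pos_divide_le_eq mult_1)
  qed
  have quant_close: "cmod (z - z') \<le> \<eta>" if "quant z = quant z'" for z z'
    using cmod_le[of "z - z'"] floor[of "Re z" "Re z'"] floor[of "Im z" "Im z'"] that by (simp add: quant_def)
  define J where "J = \<lceil>M / (\<eta>/2)\<rceil> + 1"
  have bound: "\<lfloor>x / (\<eta>/2)\<rfloor> \<in> {-J..J}" if "\<bar>x\<bar> \<le> M" for x :: real
  proof -
    have half: "0 < \<eta>/2" using \<eta> by simp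
    have "\<bar>x\<bar> / (\<eta>/2) \<le> M / (\<eta>/2)" by (rule divide_right_mono[OF that]) (use half in simp)
    then have "\<bar>x / (\<eta>/2)\<bar> \<le> M / (\<eta>/2)" using half by (simp only: abs_divide abs_of_pos)
    moreover have "\<lfloor>u\<rfloor> \<in> {- (\<lceil>v\<rceil> + 1)..\<lceil>v\<rceil> + 1}" if "\<bar>u\<bar> \<le> v" for u v :: real
      using that unfolding atLeastAtMost_iff by linarith
    ultimately show ?thesis unfolding J_def by blast
  qed
  have quant_bound: "quant z \<in> {-J..J} \<times> {-J..J}" if "cmod z \<le> M" for z
    unfolding quant_def
    by (intro SigmaI bound order_trans[OF abs_Re_le_cmod that] order_trans[OF abs_Im_le_cmod that])
  \<comment> \<open>The type of a block: its size together with the rounded entries for all elements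
    of \<open>G\<close>. Restricting the function to its domain places the types in a finite
    set.\<close>
  define ty where "ty c = (k c, \<lambda>(a, p, q)\<in>G \<times> {0..<k c} \<times> {0..<k c}. quant (\<beta> a (e c p) (e c q)))" for c
  have "ty ` lb ` S \<subseteq> (SIGMA j:{..K}. (G \<times> {0..<j} \<times> {0..<j}) \<rightarrow>\<^sub>E ({-J..J} \<times> {-J..J}))"
  proof
    fix \<tau> assume "\<tau> \<in> ty ` lb ` S"
    then obtain c where c: "c \<in> lb ` S" "\<tau> = ty c" by blast
    have "(\<lambda>(a, p, q)\<in>G \<times> {0..<k c} \<times> {0..<k c}. quant (\<beta> a (e c p) (e c q))) \<in>
        (G \<times> {0..<k c} \<times> {0..<k c}) \<rightarrow>\<^sub>E ({-J..J} \<times> {-J..J})"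
    proof (rule restrict_PiE_iff[THEN iffD2], rule ballI)
      fix s assume "s \<in> G \<times> {0..<k c} \<times> {0..<k c}"
      then obtain a p q where s: "s = (a, p, q)" "a \<in> G" "p \<in> {0..<k c}" "q \<in> {0..<k c}" by auto
      have "e c p \<in> B c" "e c q \<in> B c" using bij_betwE[OF e[OF c(1)]] s by blast+
      then have "cmod (\<beta> a (e c p) (e c q)) \<le> M" by (intro bd s(2)) (auto simp: B_def)
      then show "(case s of (a, p, q) \<Rightarrow> quant (\<beta> a (e c p) (e c q))) \<in> {-J..J} \<times> {-J..J}"
        unfolding s(1) prod.case by (rule quant_bound)
    qed
    then show "\<tau> \<in> (SIGMA j:{..K}. (G \<times> {0..<j} \<times> {0..<j}) \<rightarrow>\<^sub>E ({-J..J} \<times> {-J..J}))"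
      unfolding c(2) ty_def using Bfin(2)[OF c(1)] by (intro SigmaI) auto
  qed
  then have tyfin: "finite (ty ` lb ` S)"
    by (rule finite_subset) (intro finite_SigmaI finite_PiE finite_cartesian_product; simp add: G)
  define rep where "rep \<tau> = (SOME c. c \<in> lb ` S \<and> ty c = \<tau>)" for \<tau>
  define \<rho> where "\<rho> c = rep (ty c)" for c
  have \<rho>: "\<rho> c \<in> lb ` S" "ty (\<rho> c) = ty c" if "c \<in> lb ` S" for c
  proof -
    have "\<rho> c \<in> lb ` S \<and> ty (\<rho> c) = ty c"
      unfolding \<rho>_def rep_def by (rule someI[of "\<lambda>c'. c' \<in> lb ` S \<and> ty c' = ty c" c]) (simp add: that)
    then show "\<rho> c \<in> lb ` S" "ty (\<rho> c) = ty c" by simp_all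
  qed
  have k\<rho>: "k (\<rho> c) = k c" if "c \<in> lb ` S" for c using \<rho>(2)[OF that] by (simp add: ty_def)
  define pos where "pos x = inv_into {0..<k (lb x)} (e (lb x)) x" for x
  have pos: "pos x \<in> {0..<k (lb x)}" "e (lb x) (pos x) = x" if "x \<in> S" for x
  proof -
    have c: "lb x \<in> lb ` S" using that by simp
    have im: "x \<in> e (lb x) ` {0..<k (lb x)}" using bij_betw_imp_surj_on[OF e[OF c]] that by (simp add: B_def)
    show "pos x \<in> {0..<k (lb x)}" "e (lb x) (pos x) = x" unfolding pos_def by (rule inv_into_into[OF im], rule f_inv_into_f[OF im])
  qed
  \<comment> \<open>\<open>t\<close> keeps the position of a point in the enumeration, so it is
    injective on each block and onto the representative one.\<close>
  define t where "t x = e (\<rho> (lb x)) (pos x)" for x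
  have tB: "t x \<in> B (\<rho> (lb x))" if x: "x \<in> S" for x
  proof -
    have c: "lb x \<in> lb ` S" using x by simp
    show ?thesis using bij_betwE[OF e[OF \<rho>(1)[OF c]]] pos(1)[OF x] k\<rho>[OF c] by (simp add: t_def)
  qed
  have A: "\<forall>x\<in>S. t x \<in> S" using tB by (auto simp: B_def)
  have lbt: "lb (t x) = \<rho> (lb x)" if "x \<in> S" for x using tB[OF that] by (simp add: B_def)
  have "t ` S \<subseteq> (\<Union>c\<in>rep ` ty ` lb ` S. B c)" using tB by (auto simp: \<rho>_def)
  moreover have "finite (\<Union>c\<in>rep ` ty ` lb ` S. B c)"
  proof (rule finite_UN_I)
    show "finite (rep ` ty ` lb ` S)" by (rule finite_imageI[OF tyfin])
    fix c assume "c \<in> rep ` ty ` lb ` S"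
    then have "c \<in> lb ` S" using \<rho>(1) by (auto simp: \<rho>_def)
    then show "finite (B c)" by (rule Bfin(1))
  qed
  ultimately have tfin: "finite (t ` S)" by (rule finite_subset)
  have C: "lb (t x) = lb (t y) \<and> (t x = t y \<longrightarrow> x = y) \<and> (\<forall>a\<in>G. cmod (\<beta> a x y - \<beta> a (t x) (t y)) \<le> \<eta>)"
    if x: "x \<in> S" and y: "y \<in> S" and xy: "lb x = lb y" for x y
  proof (intro conjI impI ballI)
    let ?c = "lb x"
    have c: "?c \<in> lb ` S" using x by simp
    note px = pos[OF x] and py = pos[OF y, folded xy]
    have ty': "t y = e (\<rho> ?c) (pos y)" by (simp add: t_def xy)
    show "lb (t x) = lb (t y)" by (simp only: lbt[OF x] lbt[OF y] xy)
    show "x = y" if "t x = t y"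
    proof -
      have "e (\<rho> ?c) (pos x) = e (\<rho> ?c) (pos y)" using that unfolding t_def[of x] ty' .
      moreover have "pos x \<in> {0..<k (\<rho> ?c)}" "pos y \<in> {0..<k (\<rho> ?c)}"
        unfolding k\<rho>[OF c] by (rule px(1), rule py(1))
      ultimately have "pos x = pos y" by (rule inj_onD[OF bij_betw_imp_inj_on[OF e[OF \<rho>(1)[OF c]]]])
      then show ?thesis using px(2) py(2) by metis
    qed
    fix a assume a: "a \<in> G"
    have mem: "(a, pos x, pos y) \<in> G \<times> {0..<k ?c} \<times> {0..<k ?c}" using a px(1) py(1) by simp
    have "snd (ty (\<rho> ?c)) (a, pos x, pos y) = snd (ty ?c) (a, pos x, pos y)" by (simp only: \<rho>(2)[OF c])
    then have "quant (\<beta> a (t x) (t y)) = quant (\<beta> a x y)"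
      unfolding ty_def snd_conv k\<rho>[OF c] restrict_apply'[OF mem] prod.case px(2) py(2)
      by (simp only: t_def[of x] ty')
    then show "cmod (\<beta> a x y - \<beta> a (t x) (t y)) \<le> \<eta>" by (intro quant_close) (rule sym)
  qed
  have E: "\<exists>y\<in>S. lb y = lb x \<and> t y = z" if x: "x \<in> S" and z: "z \<in> S" and eq: "lb z = lb (t x)" for x z
  proof -
    let ?c = "lb x"
    have c: "?c \<in> lb ` S" using x by simp
    have zc: "lb z = \<rho> ?c" using eq lbt[OF x] by simp
    let ?y = "e ?c (pos z)"
    have pz: "pos z \<in> {0..<k ?c}" "e (\<rho> ?c) (pos z) = z" using pos[OF z] k\<rho>[OF c] unfolding zc by simp_all
    have y: "?y \<in> B ?c" using bij_betwE[OF e[OF c]] pz(1) by blast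
    then have y': "?y \<in> S" "lb ?y = ?c" by (simp_all add: B_def)
    have "pos ?y = pos z" unfolding pos_def[of ?y] y'(2)
      by (rule inv_into_f_f[OF bij_betw_imp_inj_on[OF e[OF c]] pz(1)])
    then have "t ?y = z" by (simp add: t_def y'(2) pz(2))
    with y' show ?thesis by blast
  qed
  have C': "\<forall>x\<in>S. \<forall>y\<in>S. lb x = lb y \<longrightarrow> lb (t x) = lb (t y) \<and> (t x = t y \<longrightarrow> x = y) \<and>
      (\<forall>a\<in>G. cmod (\<beta> a x y - \<beta> a (t x) (t y)) \<le> \<eta>)"
    by (intro ballI impI) (rule C)
  have E': "\<forall>x\<in>S. \<forall>z\<in>S. lb z = lb (t x) \<longrightarrow> (\<exists>y\<in>S. lb y = lb x \<and> t y = z)"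
    by (intro ballI impI) (rule E)
  show ?thesis by (intro exI[of _ t] conjI A tfin C' E')
qed

text \<open>Blocks are mutually orthogonal, so a common bound for the blocks bounds the whole
  operator. With the block estimates stated as finite sums, they can be supplied by operators on
  other spaces.\<close>

lemma block_norm_le:
  fixes lb :: "'x \<Rightarrow> 'l"
  assumes T: "matrix_operator X \<beta> \<in> bounded_operators X" and C: "0 \<le> C" and SX: "S \<subseteq> X"
    and zero: "\<And>x y. x \<in> X \<Longrightarrow> y \<in> X \<Longrightarrow> \<not> (x \<in> S \<and> y \<in> S \<and> lb x = lb y) \<Longrightarrow> \<beta> x y = 0"
    and fin: "\<And>c. finite {x\<in>S. lb x = c}"
    and block: "\<And>c f. (\<Sum>x\<in>{x\<in>S. lb x = c}. (cmod (\<Sum>y\<in>{x\<in>S. lb x = c}. \<beta> x y * f y))\<^sup>2) \<le>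
        C\<^sup>2 * (\<Sum>y\<in>{x\<in>S. lb x = c}. (cmod (f y))\<^sup>2)"
  shows "op_norm X (matrix_operator X \<beta>) \<le> C"
proof (rule op_norm_le[OF _ C])
  fix f assume f: "f \<in> ell2 X"
  let ?T = "matrix_operator X \<beta>"
  define B where "B c = {x\<in>S. lb x = c}" for c
  have Tx: "?T f x = (\<Sum>y\<in>B (lb x). \<beta> x y * f y)" if x: "x \<in> S" for x
    by (rule matrix_operator_finite_row[OF f]) (use x SX fin zero in \<open>auto simp: B_def\<close>)
  have T0: "?T f x = 0" if "x \<in> X" "x \<notin> S" for x
    using matrix_operator_finite_row[OF f that(1), of "{}" \<beta>] zero that by auto
  show "ell2_norm X (?T f) \<le> C * ell2_norm X f"
  proof (rule ell2_fatou(2))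
    fix x assume "x \<notin> X" then show "?T f x = 0" by (rule ell2_outside[OF bop_ell2[OF T f]])
  next
    show "0 \<le> C * ell2_norm X f" using C by simp
    fix Z assume Z: "finite Z" "Z \<subseteq> X"
    \<comment> \<open>\<open>W\<close> is the finite union of the whole blocks that meet
      \<open>Z\<close>.\<close>
    define W where "W = (\<Union>x\<in>Z \<inter> S. B (lb x))"
    have W: "finite W" "W \<subseteq> S" unfolding W_def using Z(1) fin by (auto simp: B_def)
    have WB: "{x\<in>W. lb x = c} = B c" if "c \<in> lb ` W" for c
      using that by (auto simp: W_def B_def)
    have "(\<Sum>x\<in>Z. (cmod (?T f x))\<^sup>2) = (\<Sum>x\<in>Z \<inter> S. (cmod (?T f x))\<^sup>2)"
      by (rule sum.mono_neutral_right) (use Z T0 in auto)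
    also have "\<dots> \<le> (\<Sum>x\<in>W. (cmod (?T f x))\<^sup>2)"
      by (rule sum_mono2[OF W(1)]) (auto simp: W_def B_def)
    also have "\<dots> = (\<Sum>c\<in>lb ` W. \<Sum>x\<in>{x\<in>W. lb x = c}. (cmod (?T f x))\<^sup>2)"
      by (rule sum.image_gen[OF W(1)])
    also have "\<dots> = (\<Sum>c\<in>lb ` W. \<Sum>x\<in>B c. (cmod (\<Sum>y\<in>B c. \<beta> x y * f y))\<^sup>2)"
    proof (rule sum.cong[OF refl])
      fix c assume c: "c \<in> lb ` W"
      show "(\<Sum>x\<in>{x\<in>W. lb x = c}. (cmod (?T f x))\<^sup>2) = (\<Sum>x\<in>B c. (cmod (\<Sum>y\<in>B c. \<beta> x y * f y))\<^sup>2)"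
        unfolding WB[OF c] by (rule sum.cong[OF refl]) (auto simp: Tx B_def)
    qed
    also have "\<dots> \<le> (\<Sum>c\<in>lb ` W. C\<^sup>2 * (\<Sum>y\<in>B c. (cmod (f y))\<^sup>2))"
      unfolding B_def by (rule sum_mono) (rule block)
    also have "\<dots> = C\<^sup>2 * (\<Sum>c\<in>lb ` W. \<Sum>y\<in>{x\<in>W. lb x = c}. (cmod (f y))\<^sup>2)"
      by (simp add: sum_distrib_left WB)
    also have "\<dots> = C\<^sup>2 * (\<Sum>y\<in>W. (cmod (f y))\<^sup>2)" by (simp only: sum.image_gen[OF W(1), of _ lb, symmetric])
    also have "\<dots> \<le> C\<^sup>2 * (ell2_norm X f)\<^sup>2"
      by (rule mult_left_mono[OF ell2_finite_sum_le[OF f W(1)]]) (use W SX in auto)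
    finally show "(\<Sum>x\<in>Z. (cmod (?T f x))\<^sup>2) \<le> (C * ell2_norm X f)\<^sup>2" by (simp add: power_mult_distrib)
  qed
qed

text \<open>The matrix is \<open>V^* T V\<close> for the map \<open>V\<close> sending the basis
  vector of \<open>p\<close> to \<open>w p\<close> times that of \<open>\<xi> p\<close>;
  \<open>V\<close> is a contraction since \<xi> is injective on \<open>J\<close> and the weights lie
  between 0 and 1. In the proof \<open>g = V f\<close>.\<close>

lemma compression_norm_le:
  fixes w :: "nat \<Rightarrow> real"
  assumes T: "T \<in> bounded_operators X" and J: "finite J" and \<xi>: "inj_on \<xi> J" "\<xi> ` J \<subseteq> X"
    and w: "\<And>p. p \<in> J \<Longrightarrow> 0 \<le> w p" "\<And>p. p \<in> J \<Longrightarrow> w p \<le> 1"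
  shows "(\<Sum>p\<in>J. (cmod (\<Sum>q\<in>J. complex_of_real (w p) * complex_of_real (w q) * T (delta (\<xi> q)) (\<xi> p) * f q))\<^sup>2)
    \<le> (op_norm X T)\<^sup>2 * (\<Sum>q\<in>J. (cmod (f q))\<^sup>2)"
proof -
  define g where "g = (\<lambda>x. \<Sum>q\<in>J. (complex_of_real (w q) * f q) * delta (\<xi> q) x)"
  have dX: "delta (\<xi> q) \<in> ell2 X" if "q \<in> J" for q using \<xi>(2) that by auto
  have g: "g \<in> ell2 X" unfolding g_def by (intro ell2_sum ell2_smult dX)
  have Tg: "T g = (\<lambda>x. \<Sum>q\<in>J. (complex_of_real (w q) * f q) * T (delta (\<xi> q)) x)"
    unfolding g_def by (subst bop_sum[OF T ell2_smult[OF dX]]) (simp_all add: bop_smult[OF T dX])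
  have gx: "g (\<xi> q) = complex_of_real (w q) * f q" if q: "q \<in> J" for q
  proof -
    have "g (\<xi> q) = (\<Sum>r\<in>J. if r = q then complex_of_real (w q) * f q else 0)"
      unfolding g_def by (intro sum.cong refl) (use inj_onD[OF \<xi>(1)] q in \<open>auto simp: delta_def\<close>)
    then show ?thesis using J q by simp
  qed
  have g0: "g x = 0" if "x \<notin> \<xi> ` J" for x
    unfolding g_def by (rule sum.neutral) (use that in \<open>auto simp: delta_def\<close>)
  have wn: "(cmod (complex_of_real (w p) * z))\<^sup>2 \<le> (cmod z)\<^sup>2" if "p \<in> J" for p z
  proof -
    have "cmod (complex_of_real (w p) * z) \<le> 1 * cmod z"
      unfolding norm_mult by (rule mult_right_mono) (use w[OF that] in auto)
    then show ?thesis by (intro power_mono) simp_all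
  qed
  have "(\<Sum>p\<in>J. (cmod (\<Sum>q\<in>J. complex_of_real (w p) * complex_of_real (w q) * T (delta (\<xi> q)) (\<xi> p) * f q))\<^sup>2)
      = (\<Sum>p\<in>J. (cmod (complex_of_real (w p) * T g (\<xi> p)))\<^sup>2)"
    unfolding Tg by (simp add: sum_distrib_left mult_ac)
  also have "\<dots> \<le> (\<Sum>p\<in>J. (cmod (T g (\<xi> p)))\<^sup>2)" by (rule sum_mono) (rule wn)
  also have "\<dots> = (\<Sum>x\<in>\<xi> ` J. (cmod (T g x))\<^sup>2)" by (simp add: sum.reindex[OF \<xi>(1)])
  also have "\<dots> \<le> (ell2_norm X (T g))\<^sup>2"
    by (rule ell2_finite_sum_le[OF bop_ell2[OF T g]]) (use J \<xi> in auto)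
  also have "\<dots> \<le> (op_norm X T * ell2_norm X g)\<^sup>2" by (rule power_mono[OF op_norm_bound[OF T g]]) simp
  also have "\<dots> = (op_norm X T)\<^sup>2 * (\<Sum>x\<in>\<xi> ` J. (cmod (g x))\<^sup>2)"
    unfolding power_mult_distrib by (subst ell2_finite_support(2)[of "\<xi> ` J"]) (use J \<xi> g0 in auto)
  also have "(\<Sum>x\<in>\<xi> ` J. (cmod (g x))\<^sup>2) = (\<Sum>q\<in>J. (cmod (complex_of_real (w q) * f q))\<^sup>2)"
    by (simp add: sum.reindex[OF \<xi>(1)] gx)
  also have "(op_norm X T)\<^sup>2 * \<dots> \<le> (op_norm X T)\<^sup>2 * (\<Sum>q\<in>J. (cmod (f q))\<^sup>2)"
    by (intro mult_left_mono sum_mono wn) auto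
  finally show ?thesis .
qed

section \<open>The completely positive approximations\<close>

text \<open>
  \<open>t i\<close> maps the support of the \<open>i\<close>-th weight function into finitely many representative blocks;
  \<open>enc\<close> numbers the points of the latter.
\<close>

locale block_system = bg_space X d for X :: "'x set" and d :: "'x \<Rightarrow> 'x \<Rightarrow> real" +
  fixes n :: nat and h :: "nat \<Rightarrow> 'x \<Rightarrow> real" and lb :: "nat \<Rightarrow> 'x \<Rightarrow> 'l" and D :: real
    and t :: "nat \<Rightarrow> 'x \<Rightarrow> 'x" and enc :: "nat \<times> 'x \<Rightarrow> nat" and S :: "nat \<Rightarrow> 'x set"
  assumes S_def: "\<And>i. S i = {x\<in>X. h i x > 0}"
    and h_le_1: "\<And>i x. i \<le> n \<Longrightarrow> x \<in> X \<Longrightarrow> h i x \<le> 1"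
    and diam: "\<And>i x y. i \<le> n \<Longrightarrow> x \<in> S i \<Longrightarrow> y \<in> S i \<Longrightarrow> lb i x = lb i y \<Longrightarrow> d x y \<le> D"
    and t_S: "\<And>i x. i \<le> n \<Longrightarrow> x \<in> S i \<Longrightarrow> t i x \<in> S i"
    and t_fin: "\<And>i. i \<le> n \<Longrightarrow> finite (t i ` S i)"
    and t_lb: "\<And>i x y. i \<le> n \<Longrightarrow> x \<in> S i \<Longrightarrow> y \<in> S i \<Longrightarrow> lb i x = lb i y \<Longrightarrow> lb i (t i x) = lb i (t i y)"
    and t_inj: "\<And>i x y. i \<le> n \<Longrightarrow> x \<in> S i \<Longrightarrow> y \<in> S i \<Longrightarrow> lb i x = lb i y \<Longrightarrow> t i x = t i y \<Longrightarrow> x = y"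
    and t_surj: "\<And>i x z. i \<le> n \<Longrightarrow> x \<in> S i \<Longrightarrow> z \<in> S i \<Longrightarrow> lb i z = lb i (t i x) \<Longrightarrow>
        \<exists>y\<in>S i. lb i y = lb i x \<and> t i y = z"
    and enc_inj: "inj_on enc (SIGMA i:{..n}. t i ` S i)"
begin

text \<open>Pairs with the colour, because one point may represent blocks of several colours and
  then needs several indices.\<close>

definition P where "P = (SIGMA i:{..n}. t i ` S i)"
definition Y where "Y = enc ` P"
definition dec where "dec = the_inv_into P enc"
definition \<kappa> where "\<kappa> p = fst (dec p)"
definition \<xi> where "\<xi> p = snd (dec p)"
text \<open>With the colour as part of the label, blocks of different colours stay apart even where
  \<open>lb\<close> takes equal values.\<close>

definition lab where "lab p = (\<kappa> p, lb (\<kappa> p) (\<xi> p))"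
definition \<eta> where "\<eta> i x = enc (i, t i x)"
definition w where "w p = h (\<kappa> p) (\<xi> p)"

abbreviation F where "F \<equiv> blk_alg Y lab"
abbreviation FI where "FI \<equiv> blk_ideal Y lab \<kappa>"

lemma Y_finite: "finite Y"
  unfolding Y_def P_def by (rule finite_imageI, rule finite_SigmaI) (simp_all add: t_fin)

lemma dec_enc: "s \<in> P \<Longrightarrow> dec (enc s) = s"
  unfolding dec_def by (rule the_inv_into_f_f) (simp_all add: P_def enc_inj)

lemma dec_in: "p \<in> Y \<Longrightarrow> dec p \<in> P \<and> enc (dec p) = p"
  unfolding Y_def using dec_enc by auto

lemma Y_colour_support: "p \<in> Y \<Longrightarrow> \<kappa> p \<le> n" "p \<in> Y \<Longrightarrow> \<xi> p \<in> S (\<kappa> p)"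
  using dec_in[of p] t_S unfolding \<kappa>_def \<xi>_def P_def by auto

lemma S_subset: "S i \<subseteq> X"
  by (auto simp: S_def)

lemma Y_X: "p \<in> Y \<Longrightarrow> \<xi> p \<in> X"
  using Y_colour_support(2) S_subset by blast

lemma Y_inj: "p \<in> Y \<Longrightarrow> q \<in> Y \<Longrightarrow> \<kappa> p = \<kappa> q \<Longrightarrow> \<xi> p = \<xi> q \<Longrightarrow> p = q"
  using dec_in[of p] dec_in[of q] unfolding \<kappa>_def \<xi>_def by (metis prod_eqI)

lemma eta:
  assumes "i \<le> n" "x \<in> S i"
  shows "\<eta> i x \<in> Y" "\<kappa> (\<eta> i x) = i" "\<xi> (\<eta> i x) = t i x" "lab (\<eta> i x) = (i, lb i (t i x))"
proof -
  have "(i, t i x) \<in> P" using assms by (auto simp: P_def)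
  then show "\<eta> i x \<in> Y" "\<kappa> (\<eta> i x) = i" "\<xi> (\<eta> i x) = t i x" "lab (\<eta> i x) = (i, lb i (t i x))"
    by (simp_all add: \<eta>_def Y_def \<kappa>_def \<xi>_def lab_def dec_enc)
qed

text \<open>\<open>t\<close> is injective on blocks and hits the whole representative block, so
  entire blocks are matched. This is what makes copying matrices multiplicative.\<close>

lemma eta_bij:
  assumes i: "i \<le> n" and x: "x \<in> S i"
  shows "bij_betw (\<eta> i) {y\<in>S i. lb i y = lb i x} {q\<in>Y. lab q = lab (\<eta> i x)}"
proof (rule bij_betwI')
  fix y z assume y: "y \<in> {y\<in>S i. lb i y = lb i x}" and z: "z \<in> {y\<in>S i. lb i y = lb i x}"
  show "\<eta> i y = \<eta> i z \<longleftrightarrow> y = z"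
  proof
    assume "\<eta> i y = \<eta> i z"
    then have "t i y = t i z" using eta(3)[OF i, of y] eta(3)[OF i, of z] y z by auto
    then show "y = z" using t_inj[OF i, of y z] y z by auto
  qed simp
next
  fix y assume "y \<in> {y\<in>S i. lb i y = lb i x}"
  then show "\<eta> i y \<in> {q\<in>Y. lab q = lab (\<eta> i x)}"
    using eta[OF i, of y] eta[OF i x] t_lb[OF i, of y x] x by auto
next
  fix q assume q: "q \<in> {q\<in>Y. lab q = lab (\<eta> i x)}"
  then have qY: "q \<in> Y" "\<kappa> q = i" "lb i (\<xi> q) = lb i (t i x)"
    using eta[OF i x] by (auto simp: lab_def)
  have "\<xi> q \<in> S i" using Y_colour_support(2)[OF qY(1)] qY(2) by simp
  then obtain y where y: "y \<in> S i" "lb i y = lb i x" "t i y = \<xi> q"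
    using t_surj[OF i x _ qY(3)] by blast
  have "q = \<eta> i y"
    by (rule Y_inj[OF qY(1) eta(1)[OF i y(1)]]) (simp_all add: eta[OF i y(1)] qY(2) y(3))
  then show "\<exists>y\<in>{y\<in>S i. lb i y = lb i x}. q = \<eta> i y" using y by blast
qed

text \<open>Each nonempty block is matched with a subset of the finite set \<open>Y\<close>.\<close>

lemma block_finite:
  assumes i: "i \<le> n"
  shows "finite {y\<in>S i. lb i y = c}"
proof (cases "\<exists>x\<in>S i. lb i x = c")
  case True
  then obtain x where x: "x \<in> S i" "lb i x = c" by blast
  have "finite {q\<in>Y. lab q = lab (\<eta> i x)}" using Y_finite by simp
  then show ?thesis using bij_betw_finite[OF eta_bij[OF i x(1)]] x(2) by simp
next
  case False
  then have e: "{y\<in>S i. lb i y = c} = {}" by blast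
  show ?thesis unfolding e by simp
qed

subsection \<open>The outgoing maps\<close>

definition ker where
  "ker i m x y = (if x \<in> S i \<and> y \<in> S i \<and> lb i x = lb i y then m (\<eta> i x) (\<eta> i y) else (0::complex))"

definition phi where "phi i m = matrix_operator X (ker i m)"

definition Phi where "Phi m = (\<lambda>f x. \<Sum>i\<le>n. phi i m f x)"

text \<open>Blocks have diameter at most \<open>D\<close>, and all copies use the same finitely many
  entries of \<open>m\<close>, so even infinitely many copies make up a bounded matrix of finite
  propagation. This places the outgoing maps in the uniform Roe algebra.\<close>

lemma ker_fp: "i \<le> n \<Longrightarrow> ker i m \<in> finite_propagation X d"
proof (rule fp_I)
  assume i: "i \<le> n"
  show "0 \<le> (\<Sum>p\<in>Y. \<Sum>q\<in>Y. cmod (m p q))" by (intro sum_nonneg) simp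
  fix x y
  show "cmod (ker i m x y) \<le> (\<Sum>p\<in>Y. \<Sum>q\<in>Y. cmod (m p q))"
    using finite_band[OF Y_finite, of m] eta(1)[OF i, of x] eta(1)[OF i, of y]
    by (auto simp: ker_def band_def intro!: sum_nonneg)
  show "ker i m x y = 0" if "d x y > D"
    using diam[OF i, of x y] that by (auto simp: ker_def)
qed

lemma phi_bop: "i \<le> n \<Longrightarrow> phi i m \<in> bounded_operators X"
  unfolding phi_def by (rule fp_bop[OF ker_fp])

lemma phi_roe: "i \<le> n \<Longrightarrow> phi i m \<in> Roe"
  unfolding phi_def by (rule fp_roe[OF ker_fp])

lemma Phi_roe: "Phi m \<in> Roe"
  unfolding Phi_def by (rule roe_sum) (simp add: phi_roe)

lemma phi_plus: "i \<le> n \<Longrightarrow> phi i (\<lambda>p q. a p q + b p q) = (\<lambda>f x. phi i a f x + phi i b f x)"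
  unfolding phi_def by (rule matrix_operator_plus) (simp_all add: fp_bop[OF ker_fp] ker_def)

lemma phi_scale: "i \<le> n \<Longrightarrow> phi i (\<lambda>p q. c * a p q) = (\<lambda>f x. c * phi i a f x)"
  unfolding phi_def by (rule matrix_operator_scale) (simp_all add: fp_bop[OF ker_fp] ker_def)

lemma phi_0: "i \<le> n \<Longrightarrow> phi i (\<lambda>p q. 0) = (\<lambda>f x. 0)"
  using phi_scale[of i 0 "\<lambda>p q. 0"] by simp

lemma phi_sum:
  assumes i: "i \<le> n" and K: "finite K"
  shows "phi i (\<lambda>p q. \<Sum>k\<in>K. a k p q) = (\<lambda>f x. \<Sum>k\<in>K. phi i (a k) f x)"
  using K by (induction K rule: finite_induct) (simp_all add: phi_0[OF i] phi_plus[OF i])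

lemma phi_adjoint: "i \<le> n \<Longrightarrow> op_adjoint X (phi i a) = phi i (\<lambda>p q. cnj (a q p))"
  unfolding phi_def by (rule matrix_operator_adjoint) (auto simp: fp_bop[OF ker_fp] ker_def)

text \<open>Summation over a block is carried by \<open>eta_bij\<close> to summation over its
  representative block; beyond that block the row of \<open>a\<close> vanishes because
  \<open>a\<close> respects the labels.\<close>

lemma phi_mult:
  assumes i: "i \<le> n" and a: "a \<in> blk Y lab"
  shows "phi i (\<lambda>p q. \<Sum>r\<in>Y. a p r * b r q) = phi i a \<circ> phi i b"
proof -
  let ?R = "\<lambda>x. {y\<in>S i. lb i y = lb i x}"
  have "ker i (\<lambda>p q. \<Sum>r\<in>Y. a p r * b r q) x y = (\<Sum>z\<in>?R x. ker i a x z * ker i b z y)" for x y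
  proof (cases "x \<in> S i \<and> y \<in> S i \<and> lb i x = lb i y")
    case True
    then have x: "x \<in> S i" and y: "y \<in> S i" and xy: "lb i x = lb i y" by simp_all
    have "(\<Sum>z\<in>?R x. ker i a x z * ker i b z y) = (\<Sum>z\<in>?R x. a (\<eta> i x) (\<eta> i z) * b (\<eta> i z) (\<eta> i y))"
      by (rule sum.cong[OF refl]) (use x y xy in \<open>auto simp: ker_def\<close>)
    also have "\<dots> = (\<Sum>r\<in>{q\<in>Y. lab q = lab (\<eta> i x)}. a (\<eta> i x) r * b r (\<eta> i y))"
      by (rule sum.reindex_bij_betw[OF eta_bij[OF i x]])
    also have "\<dots> = (\<Sum>r\<in>Y. a (\<eta> i x) r * b r (\<eta> i y))"
      by (rule sum.mono_neutral_left[OF Y_finite]) (use a in \<open>auto simp: blk_def\<close>)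
    finally show ?thesis using True by (simp add: ker_def)
  next
    case False
    then have "ker i a x z * ker i b z y = 0" for z by (auto simp: ker_def)
    then show ?thesis using False by (auto simp: ker_def)
  qed
  note k = this
  show ?thesis unfolding phi_def
    by (rule matrix_operator_comp[symmetric, where R="?R"])
       (use S_subset in \<open>auto simp: fp_bop[OF ker_fp] i block_finite[OF i] k ker_def[of i a]\<close>)
qed

text \<open>Each block of the image is a copy of a diagonal block of \<open>m\<close>, whose norm
  does not exceed that of \<open>m\<close>.\<close>

lemma phi_norm_le:
  assumes i: "i \<le> n"
  shows "op_norm X (phi i m) \<le> op_norm Y (matrix_operator Y m)"
  unfolding phi_def
proof (rule block_norm_le[OF fp_bop[OF ker_fp[OF i]] _ S_subset, where lb="lb i"])
  let ?M = "matrix_operator Y m"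
  have M: "?M \<in> bounded_operators Y" by (rule finite_matrix_bop[OF Y_finite])
  show "0 \<le> op_norm Y ?M" by (rule op_norm_nonneg[OF M])
  show "finite {x\<in>S i. lb i x = c}" for c by (rule block_finite[OF i])
  show "ker i m x y = 0" if "\<not> (x \<in> S i \<and> y \<in> S i \<and> lb i x = lb i y)" for x y
    using that unfolding ker_def by (rule if_not_P)
  fix c :: 'l and f :: "'x \<Rightarrow> complex"
  let ?B = "{x\<in>S i. lb i x = c}"
  show "(\<Sum>x\<in>?B. (cmod (\<Sum>y\<in>?B. ker i m x y * f y))\<^sup>2) \<le> (op_norm Y ?M)\<^sup>2 * (\<Sum>y\<in>?B. (cmod (f y))\<^sup>2)"
  proof (cases "?B = {}")
    case True
    then show ?thesis by (simp only:) simp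
  next
    case False
    then obtain x0 where x0: "x0 \<in> S i" "lb i x0 = c" by blast
    let ?J = "{q\<in>Y. lab q = lab (\<eta> i x0)}"
    have bij: "bij_betw (\<eta> i) ?B ?J" using eta_bij[OF i x0(1)] x0(2) by simp
    \<comment> \<open>\<open>g\<close> is \<open>f\<close> transported to the representative block
      and extended by 0.\<close>
    define g where "g q = (if q \<in> ?J then f (inv_into ?B (\<eta> i) q) else 0)" for q
    have g\<eta>: "g (\<eta> i y) = f y" if "y \<in> ?B" for y
      using bij_betwE[OF bij] that inv_into_f_f[OF bij_betw_imp_inj_on[OF bij] that] by (simp add: g_def)
    have gJ: "g q = 0" if "q \<notin> ?J" for q unfolding g_def using that by (rule if_not_P)
    have J: "finite ?J" "?J \<subseteq> Y" using Y_finite by auto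
    have g: "g \<in> ell2 Y" "(ell2_norm Y g)\<^sup>2 = (\<Sum>q\<in>?J. (cmod (g q))\<^sup>2)"
      by (rule ell2_finite_support[OF J gJ], assumption)+
    have Mg: "?M g p = (\<Sum>q\<in>?J. m p q * g q)" if p: "p \<in> Y" for p
    proof -
      have "?M g p = (\<Sum>q\<in>Y. m p q * g q)"
        by (rule matrix_operator_finite_row[OF g(1) p Y_finite]) auto
      also have "\<dots> = (\<Sum>q\<in>?J. m p q * g q)"
        by (rule sum.mono_neutral_right[OF Y_finite J(2)]) (use gJ in auto)
      finally show ?thesis .
    qed
    have row: "(\<Sum>y\<in>?B. ker i m x y * f y) = ?M g (\<eta> i x)" if x: "x \<in> ?B" for x
    proof -
      have "(\<Sum>y\<in>?B. ker i m x y * f y) = (\<Sum>y\<in>?B. m (\<eta> i x) (\<eta> i y) * g (\<eta> i y))"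
        by (rule sum.cong[OF refl]) (use x g\<eta> in \<open>simp add: ker_def\<close>)
      also have "\<dots> = (\<Sum>q\<in>?J. m (\<eta> i x) q * g q)" by (rule sum.reindex_bij_betw[OF bij])
      also have "\<dots> = ?M g (\<eta> i x)" by (rule Mg[symmetric]) (use eta(1)[OF i] x in blast)
      finally show ?thesis .
    qed
    have "(\<Sum>x\<in>?B. (cmod (\<Sum>y\<in>?B. ker i m x y * f y))\<^sup>2) = (\<Sum>x\<in>?B. (cmod (?M g (\<eta> i x)))\<^sup>2)"
      by (rule sum.cong[OF refl]) (simp only: row)
    also have "\<dots> = (\<Sum>p\<in>?J. (cmod (?M g p))\<^sup>2)" by (rule sum.reindex_bij_betw[OF bij])
    also have "\<dots> \<le> (ell2_norm Y (?M g))\<^sup>2" by (rule ell2_finite_sum_le[OF bop_ell2[OF M g(1)] J])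
    also have "\<dots> \<le> (op_norm Y ?M * ell2_norm Y g)\<^sup>2" by (rule power_mono[OF op_norm_bound[OF M g(1)]]) simp
    also have "\<dots> = (op_norm Y ?M)\<^sup>2 * (\<Sum>q\<in>?J. (cmod (g q))\<^sup>2)" by (simp only: power_mult_distrib g(2))
    also have "(\<Sum>q\<in>?J. (cmod (g q))\<^sup>2) = (\<Sum>y\<in>?B. (cmod (g (\<eta> i y)))\<^sup>2)"
      by (rule sum.reindex_bij_betw[OF bij, symmetric])
    also have "\<dots> = (\<Sum>y\<in>?B. (cmod (f y))\<^sup>2)" by (rule sum.cong[OF refl]) (simp only: g\<eta>)
    finally show ?thesis .
  qed
qed

text \<open>\<open>\<eta> i x\<close> has colour \<open>i\<close>, and the rows of that colour
  vanish in a matrix of another colour.\<close>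

lemma phi_ideal:
  assumes i: "i \<le> n" and m: "m \<in> FI j" and ne: "i \<noteq> j"
  shows "phi i m = (\<lambda>f x. 0)"
proof -
  have "m (\<eta> i x) q = 0" if "x \<in> S i" for x q
    using m ne eta(2)[OF i that] by (auto simp: blk_ideal_def)
  then have "ker i m = ker i (\<lambda>p q. 0)" by (auto simp: ker_def fun_eq_iff)
  then have "phi i m = phi i (\<lambda>p q. 0)" by (simp only: phi_def)
  then show ?thesis by (simp only: phi_0[OF i])
qed

lemma Phi_ideal:
  assumes j: "j \<le> n" and m: "m \<in> FI j"
  shows "Phi m = phi j m"
proof (intro ext)
  fix f x
  have "Phi m f x = (\<Sum>i\<le>n. if i = j then phi j m f x else 0)"
    unfolding Phi_def by (rule sum.cong[OF refl]) (auto simp: phi_ideal[OF _ m])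
  then show "Phi m f x = phi j m f x" using j by simp
qed

lemma Phi_plus: "Phi (\<lambda>p q. a p q + b p q) = (\<lambda>f x. Phi a f x + Phi b f x)"
  unfolding Phi_def by (simp add: phi_plus sum.distrib)

lemma Phi_scale: "Phi (\<lambda>p q. c * a p q) = (\<lambda>f x. c * Phi a f x)"
  unfolding Phi_def by (simp add: phi_scale sum_distrib_left)

text \<open>Images of different colours overlap, so they are added by the triangle inequality. The
  factor \<open>n + 1\<close> reappears in \<open>Phi_psi_approx\<close>.\<close>

lemma Phi_norm_le: "op_norm X (Phi m) \<le> real (Suc n) * op_norm Y (matrix_operator Y m)"
proof -
  have "op_norm X (Phi m) \<le> (\<Sum>i\<le>n. op_norm X (phi i m))"
    unfolding Phi_def by (rule op_norm_sum) (simp add: phi_bop)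
  also have "\<dots> \<le> (\<Sum>i\<le>n. op_norm Y (matrix_operator Y m))" by (rule sum_mono) (simp add: phi_norm_le)
  finally show ?thesis by simp
qed

lemma Phi_linear: "linear_map F A Phi"
  unfolding linear_map_def by (simp add: Phi_roe Phi_plus Phi_scale)

text \<open>Each \<open>phi l\<close> respects products and adjoints, so the image of
  \<open>b^* b\<close> is a sum of squares of rows indexed by the colours and by \<open>k\<close>.
  These are \<open>n + 1\<close> times as many rows as \<open>mat_pos\<close> admits;
  \<open>roe_mat_pos_rows\<close> brings them back to \<open>N\<close>.\<close>

lemma Phi_cp: "cp_map F A Phi"
  unfolding cp_map_def
proof (intro conjI allI impI Phi_linear)
  fix N a assume "mat_pos F N a"
  then obtain b where b: "\<forall>i<N. \<forall>j<N. b i j \<in> carrier F"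
    "\<forall>i<N. \<forall>j<N. a i j = (\<Oplus>\<^bsub>F\<^esub>k\<in>{..<N}. star F (b k i) \<otimes>\<^bsub>F\<^esub> b k j)"
    unfolding mat_pos_def by blast
  have bb: "b i j \<in> blk Y lab" if "i < N" "j < N" for i j using b(1) that by simp
  have a: "a i j = (\<lambda>p q. \<Sum>k<N. \<Sum>r\<in>Y. cnj (b k i r p) * b k j r q)" if ij: "i < N" "j < N" for i j
  proof -
    have "a i j = (\<Oplus>\<^bsub>F\<^esub>k\<in>{..<N}. star F (b k i) \<otimes>\<^bsub>F\<^esub> b k j)" using b(2) ij by blast
    also have "\<dots> = (\<lambda>p q. \<Sum>k<N. (star F (b k i) \<otimes>\<^bsub>F\<^esub> b k j) p q)"
      by (rule blk_finsum) (use ij in \<open>auto intro!: blk_mult blk_star bb\<close>)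
    finally show ?thesis by simp
  qed
  show "mat_pos A N (\<lambda>i j. Phi (a i j))"
  proof (rule roe_mat_pos_rows[where I="{..n} \<times> {..<N}" and c="\<lambda>(i, k) j. phi i (b k j)"])
    show "(case m of (i, k) \<Rightarrow> \<lambda>j. phi i (b k j)) j \<in> Roe" if "m \<in> {..n} \<times> {..<N}" for m j
      using that by (auto simp: phi_roe)
  next
    fix i j assume ij: "i < N" "j < N"
    have "phi l (a i j) = (\<lambda>f x. \<Sum>k<N. op_adjoint X (phi l (b k i)) (phi l (b k j) f) x)" if l: "l \<le> n" for l
    proof -
      have "phi l (a i j) = (\<lambda>f x. \<Sum>k<N. phi l (\<lambda>p q. \<Sum>r\<in>Y. cnj (b k i r p) * b k j r q) f x)"
        unfolding a[OF ij] by (rule phi_sum[OF l]) simp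
      also have "\<dots> = (\<lambda>f x. \<Sum>k<N. op_adjoint X (phi l (b k i)) (phi l (b k j) f) x)"
      proof (intro ext sum.cong refl)
        fix f x k assume k: "k \<in> {..<N}"
        have "phi l (\<lambda>p q. \<Sum>r\<in>Y. cnj (b k i r p) * b k j r q) = phi l (\<lambda>p q. cnj (b k i q p)) \<circ> phi l (b k j)"
          by (rule phi_mult[OF l blk_star]) (use k ij bb in simp)
        then show "phi l (\<lambda>p q. \<Sum>r\<in>Y. cnj (b k i r p) * b k j r q) f x = op_adjoint X (phi l (b k i)) (phi l (b k j) f) x"
          by (simp add: phi_adjoint[OF l])
      qed
      finally show ?thesis .
    qed
    note l = this
    show "Phi (a i j) = (\<lambda>f x. \<Sum>m\<in>{..n} \<times> {..<N}.
        op_adjoint X ((case m of (i, k) \<Rightarrow> \<lambda>j. phi i (b k j)) i) ((case m of (i, k) \<Rightarrow> \<lambda>j. phi i (b k j)) j f) x)"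
    proof (intro ext)
      fix f x
      have "Phi (a i j) f x = (\<Sum>l\<le>n. \<Sum>k<N. op_adjoint X (phi l (b k i)) (phi l (b k j) f) x)"
        unfolding Phi_def by (rule sum.cong[OF refl]) (simp add: l)
      also have "\<dots> = (\<Sum>(l, k)\<in>{..n} \<times> {..<N}. op_adjoint X (phi l (b k i)) (phi l (b k j) f) x)"
        by (rule sum.cartesian_product)
      also have "\<dots> = (\<Sum>m\<in>{..n} \<times> {..<N}.
        op_adjoint X ((case m of (i, k) \<Rightarrow> \<lambda>j. phi i (b k j)) i) ((case m of (i, k) \<Rightarrow> \<lambda>j. phi i (b k j)) j f) x)"
        by (rule sum.cong[OF refl]) (simp add: split_beta)
      finally show "Phi (a i j) f x = (\<Sum>m\<in>{..n} \<times> {..<N}.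
        op_adjoint X ((case m of (i, k) \<Rightarrow> \<lambda>j. phi i (b k j)) i) ((case m of (i, k) \<Rightarrow> \<lambda>j. phi i (b k j)) j f) x)" .
    qed
  qed simp
qed

lemma FI_sub: "FI i \<subseteq> blk Y lab"
  by (auto simp: blk_ideal_def)



lemma FI_contractive: "i \<le> n \<Longrightarrow> contractive (F\<lparr>carrier := FI i\<rparr>) A Phi"
  unfolding contractive_def by (simp add: Phi_ideal phi_norm_le)

text \<open>On a single colour \<open>Phi\<close> is multiplicative, so products equal to 0 stay
  0.\<close>

lemma FI_order_zero:
  assumes i: "i \<le> n"
  shows "order_zero (F\<lparr>carrier := FI i\<rparr>) A Phi"
  unfolding order_zero_def
proof (intro ballI impI)
  let ?G = "F\<lparr>carrier := FI i\<rparr>"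
  \<comment> \<open>A positive element is \<open>b^* b\<close> with \<open>b\<close> in the ideal,
    hence lies in the ideal itself: a nonzero entry in row \<open>p\<close> requires some nonzero
    \<open>b r p\<close>, and then \<open>r\<close> and \<open>p\<close> have the same
    label.\<close>
  have pc: "a \<in> FI i" if "a \<in> pos_cone ?G" for a
  proof -
    obtain b where b: "b \<in> FI i" "a = (\<lambda>p q. \<Sum>r\<in>Y. cnj (b r p) * b r q)"
    proof -
      obtain b where "b \<in> carrier ?G" "a = star ?G b \<otimes>\<^bsub>?G\<^esub> b"
        using \<open>a \<in> pos_cone ?G\<close> unfolding pos_cone_def by blast
      then show ?thesis by (intro that[of b]) simp_all
    qed
    have "a \<in> blk Y lab" unfolding b(2)
      by (rule blk_mult[OF blk_star]) (use b FI_sub in auto)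
    moreover have "\<kappa> p = i" if nz: "a p q \<noteq> 0" for p q
    proof -
      have "\<exists>r\<in>Y. cnj (b r p) * b r q \<noteq> 0"
        using nz unfolding b(2) by (meson sum.neutral)
      then obtain r where "b r p \<noteq> 0" by auto
      then have "\<kappa> r = i" "lab r = lab p" using b(1) by (auto simp: blk_ideal_def blk_def)
      then show ?thesis by (simp add: lab_def)
    qed
    ultimately show ?thesis by (auto simp: blk_ideal_def)
  qed
  fix a b assume ab: "a \<in> pos_cone ?G" "b \<in> pos_cone ?G" and 0: "a \<otimes>\<^bsub>?G\<^esub> b = \<zero>\<^bsub>?G\<^esub>"
  have "phi i a \<circ> phi i b = phi i (\<lambda>p q. \<Sum>r\<in>Y. a p r * b r q)"
    by (rule phi_mult[OF i, symmetric]) (use pc[OF ab(1)] FI_sub in blast)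
  also have "(\<lambda>p q. \<Sum>r\<in>Y. a p r * b r q) = (\<lambda>p q. 0)" using 0 by simp
  finally have "phi i a \<circ> phi i b = (\<lambda>f x. 0)" by (simp only: phi_0[OF i])
  then show "Phi a \<otimes>\<^bsub>A\<^esub> Phi b = \<zero>\<^bsub>A\<^esub>"
    unfolding roe_simps Phi_ideal[OF i pc[OF ab(1)]] Phi_ideal[OF i pc[OF ab(2)]] .
qed

end

context block_system
begin

lemma FI_ideal:
  assumes i: "i \<le> n"
  shows "cstar_ideal (FI i) F"
proof -
  have "ideal_decomposition F n FI"
    by (rule blk_ideal_decomposition[OF Y_finite]) (auto simp: lab_def Y_colour_support)
  then show ?thesis unfolding ideal_decomposition_def using i by simp
qed

text \<open>\<open>finsum\<close> depends on the carrier of its record, so sums formed in the ideal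
  have to be compared with sums formed in \<open>F\<close>.\<close>

lemma FI_finsum:
  assumes K: "finite K" and f: "\<And>k. k \<in> K \<Longrightarrow> f k \<in> FI i"
  shows "finsum (F\<lparr>carrier := FI i\<rparr>) f K = finsum F f K"
proof -
  let ?G = "F\<lparr>carrier := FI i\<rparr>"
  have plus: "(\<lambda>p q. a p q + b p q) \<in> FI i" if a: "a \<in> FI i" and b: "b \<in> FI i" for a b
  proof -
    have "\<kappa> p = i" if "a p q + b p q \<noteq> 0" for p q
    proof -
      have "a p q \<noteq> 0 \<or> b p q \<noteq> 0" using that by auto
      then show ?thesis using a b by (auto simp: blk_ideal_def)
    qed
    then show ?thesis using a b by (simp add: blk_ideal_def blk_plus) blast
  qed
  have zero: "(\<lambda>p q. 0) \<in> FI i" and uminus: "a \<in> FI i \<Longrightarrow> (\<lambda>p q. - a p q) \<in> FI i" for a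
    by (simp_all add: blk_ideal_def blk_0 blk_uminus)
  have "abelian_group ?G"
  proof (rule abelian_groupI)
    fix a assume "a \<in> carrier ?G"
    then show "\<exists>b\<in>carrier ?G. b \<oplus>\<^bsub>?G\<^esub> a = \<zero>\<^bsub>?G\<^esub>"
      by (intro bexI[of _ "\<lambda>p q. - a p q"]) (simp_all add: uminus)
  qed (simp_all add: plus zero ac_simps)
  then interpret G: abelian_group ?G .
  have "finsum ?G f K = (\<lambda>p q. \<Sum>k\<in>K. f k p q)" using K f
    by (induction K rule: finite_induct) (simp_all add: G.finsum_insert Pi_def)
  also have "\<dots> = finsum F f K" by (rule blk_finsum[symmetric, OF K]) (use f FI_sub in blast)
  finally show ?thesis .
qed

text \<open>A factor with entries in the ideal is also a factor over \<open>F\<close>, so positivity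
  over the ideal implies positivity over \<open>F\<close>, where \<open>Phi_cp\<close>
  applies.\<close>

lemma FI_cp: "i \<le> n \<Longrightarrow> cp_map (F\<lparr>carrier := FI i\<rparr>) A Phi"
  unfolding cp_map_def
proof (intro conjI allI impI)
  assume i: "i \<le> n"
  let ?G = "F\<lparr>carrier := FI i\<rparr>"
  show "linear_map ?G A Phi"
    unfolding linear_map_def by (simp add: Phi_roe Phi_plus Phi_scale)
  fix N a assume "mat_pos ?G N a"
  then obtain b where b: "\<forall>i<N. \<forall>j<N. b i j \<in> carrier ?G"
    "\<forall>i<N. \<forall>j<N. a i j = (\<Oplus>\<^bsub>?G\<^esub>k\<in>{..<N}. star ?G (b k i) \<otimes>\<^bsub>?G\<^esub> b k j)"
    unfolding mat_pos_def by blast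
  have bI: "b k l \<in> FI i" if "k < N" "l < N" for k l using b(1) that by simp
  have "mat_pos F N a"
    unfolding mat_pos_def
  proof (intro exI[of _ b] conjI allI impI)
    show "b k l \<in> carrier F" if "k < N" "l < N" for k l using bI[OF that] FI_sub by auto
    fix k l assume kl: "k < N" "l < N"
    have mem: "star ?G (b m k) \<otimes>\<^bsub>?G\<^esub> b m l \<in> FI i" if "m < N" for m
    proof -
      have "\<forall>a\<in>blk Y lab. \<forall>x\<in>FI i. (\<lambda>p q. \<Sum>r\<in>Y. a p r * x r q) \<in> FI i"
        using FI_ideal[OF i] unfolding cstar_ideal_def by simp
      moreover have "(\<lambda>p q. cnj (b m k q p)) \<in> blk Y lab"
        by (rule blk_star) (use bI[OF that kl(1)] FI_sub in blast)
      ultimately show ?thesis using bI[OF that kl(2)] by simp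
    qed
    have "a k l = (\<Oplus>\<^bsub>?G\<^esub>m\<in>{..<N}. star ?G (b m k) \<otimes>\<^bsub>?G\<^esub> b m l)" using b(2) kl by blast
    also have "\<dots> = (\<Oplus>\<^bsub>F\<^esub>m\<in>{..<N}. star F (b m k) \<otimes>\<^bsub>F\<^esub> b m l)"
    proof -
      have "(\<Oplus>\<^bsub>?G\<^esub>m\<in>{..<N}. star ?G (b m k) \<otimes>\<^bsub>?G\<^esub> b m l) = (\<Oplus>\<^bsub>F\<^esub>m\<in>{..<N}. star ?G (b m k) \<otimes>\<^bsub>?G\<^esub> b m l)"
        by (rule FI_finsum) (simp_all only: finite_lessThan lessThan_iff mem)
      then show ?thesis by simp
    qed
    finally show "a k l = (\<Oplus>\<^bsub>F\<^esub>m\<in>{..<N}. star F (b m k) \<otimes>\<^bsub>F\<^esub> b m l)" .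
  qed
  then show "mat_pos A N (\<lambda>i j. Phi (a i j))" using Phi_cp unfolding cp_map_def by blast
qed

subsection \<open>The incoming map\<close>

text \<open>The block diagonal part of \<open>V^* T V\<close>, where \<open>V\<close> sends the
  basis vector of \<open>p\<close> to \<open>w p\<close> times that of \<open>\<xi> p\<close>. The
  weights are the values of \<open>h\<close> at the representative points.\<close>

definition psi :: "(('x \<Rightarrow> complex) \<Rightarrow> 'x \<Rightarrow> complex) \<Rightarrow> nat \<Rightarrow> nat \<Rightarrow> complex" where
  "psi T p q = (if p \<in> Y \<and> q \<in> Y \<and> lab p = lab q
     then complex_of_real (w p) * complex_of_real (w q) * T (delta (\<xi> q)) (\<xi> p) else 0)"

lemma psi_blk: "psi T \<in> blk Y lab"
  by (auto simp: blk_def psi_def)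

lemma psi_linear: "linear_map A F psi"
  unfolding linear_map_def
  by (auto simp: psi_blk psi_def fun_eq_iff distrib_left)

lemma w_bounds: "p \<in> Y \<Longrightarrow> 0 \<le> w p" "p \<in> Y \<Longrightarrow> w p \<le> 1"
  using Y_colour_support[of p] h_le_1[of "\<kappa> p" "\<xi> p"] by (auto simp: w_def S_def less_imp_le)

text \<open>Block by block this is a compression by a contraction: \<xi> may repeat points across
  colours but is injective where the label is constant.\<close>

lemma psi_norm_le:
  assumes T: "T \<in> bounded_operators X"
  shows "op_norm Y (matrix_operator Y (psi T)) \<le> op_norm X T"
proof (rule block_norm_le[OF finite_matrix_bop[OF Y_finite] op_norm_nonneg[OF T] subset_refl, where lb=lab])
  show "psi T p q = 0" if "\<not> (p \<in> Y \<and> q \<in> Y \<and> lab p = lab q)" for p q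
    unfolding psi_def using that by (rule if_not_P)
  show "finite {p\<in>Y. lab p = c}" for c using Y_finite by simp
  fix c and f :: "nat \<Rightarrow> complex"
  let ?J = "{p\<in>Y. lab p = c}"
  have inj: "inj_on \<xi> ?J"
  proof (rule inj_onI)
    fix p q assume pq: "p \<in> ?J" "q \<in> ?J" "\<xi> p = \<xi> q"
    then have "\<kappa> p = \<kappa> q" by (auto simp: lab_def)
    then show "p = q" using Y_inj[of p q] pq by simp
  qed
  have "(\<Sum>p\<in>?J. (cmod (\<Sum>q\<in>?J. psi T p q * f q))\<^sup>2) =
      (\<Sum>p\<in>?J. (cmod (\<Sum>q\<in>?J. complex_of_real (w p) * complex_of_real (w q) * T (delta (\<xi> q)) (\<xi> p) * f q))\<^sup>2)"
    by (intro sum.cong refl arg_cong[where f="\<lambda>z. (cmod z)\<^sup>2"]) (auto simp: psi_def)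
  also have "\<dots> \<le> (op_norm X T)\<^sup>2 * (\<Sum>q\<in>?J. (cmod (f q))\<^sup>2)"
    by (rule compression_norm_le[OF T _ inj]) (use Y_finite Y_X w_bounds in auto)
  finally show "(\<Sum>p\<in>?J. (cmod (\<Sum>q\<in>?J. psi T p q * f q))\<^sup>2) \<le> (op_norm X T)\<^sup>2 * (\<Sum>q\<in>?J. (cmod (f q))\<^sup>2)" .
qed

lemma psi_contractive: "contractive A F psi"
  unfolding contractive_def by (simp add: psi_norm_le roe_bop)

text \<open>The entries of \<open>psi (a i j)\<close> are sums over \<open>k\<close> of inner
  products of the vectors \<open>b k i (delta (\<xi> p))\<close>, scaled by the weights: a Gram
  matrix over the indices \<open>(i, p)\<close> with the entries between different labels deleted.
  Its Cholesky factor respects labels and has the same index set, so it can be read as an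
  \<open>N\<close> by \<open>N\<close> matrix over \<open>F\<close>.\<close>

lemma psi_cp: "cp_map A F psi"
  unfolding cp_map_def
proof (intro conjI allI impI psi_linear)
  fix N a assume "mat_pos A N a"
  then obtain b where b: "\<forall>i<N. \<forall>j<N. b i j \<in> carrier A"
    "\<forall>i<N. \<forall>j<N. a i j = (\<Oplus>\<^bsub>A\<^esub>k\<in>{..<N}. star A (b k i) \<otimes>\<^bsub>A\<^esub> b k j)"
    unfolding mat_pos_def by blast
  have bR: "b i j \<in> Roe" if "i < N" "j < N" for i j using b(1) that by simp
  note bb = roe_bop[OF bR]
  have a: "a i j = (\<lambda>f x. \<Sum>k<N. op_adjoint X (b k i) (b k j f) x)" if ij: "i < N" "j < N" for i j
  proof -
    have "a i j = (\<Oplus>\<^bsub>A\<^esub>k\<in>{..<N}. star A (b k i) \<otimes>\<^bsub>A\<^esub> b k j)" using b(2) ij by blast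
    also have "\<dots> = (\<lambda>f x. \<Sum>k<N. (star A (b k i) \<otimes>\<^bsub>A\<^esub> b k j) f x)"
      by (rule roe_finsum) (use ij in \<open>auto intro!: roe_comp roe_adjoint bR\<close>)
    finally show ?thesis by simp
  qed
  define S0 where "S0 = {..<N} \<times> Y"
  have S0: "finite S0" by (simp add: S0_def Y_finite)
  define v where "v k s = (\<lambda>x. complex_of_real (w (snd s)) * b k (fst s) (delta (\<xi> (snd s))) x)" for k s
  have v: "v k s \<in> ell2 X" if "k \<in> {..<N}" "s \<in> S0" for k s
    unfolding v_def by (rule ell2_smult[OF bop_ell2[OF bb]]) (use that Y_X in \<open>auto simp: S0_def\<close>)
  have gram: "psi (a (fst s) (fst s')) (snd s) (snd s') =
      (if lab (snd s) = lab (snd s') then \<Sum>k\<in>{..<N}. ell2_inner X (v k s) (v k s') else 0)"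
    if s: "s \<in> S0" and s': "s' \<in> S0" for s s'
  proof -
    obtain i p j q where ip: "s = (i, p)" "s' = (j, q)" by (cases s, cases s') auto
    then have mem: "i < N" "p \<in> Y" "j < N" "q \<in> Y" using s s' by (auto simp: S0_def)
    have "op_adjoint X (b k i) (b k j (delta (\<xi> q))) (\<xi> p) =
        ell2_inner X (b k i (delta (\<xi> p))) (b k j (delta (\<xi> q)))" if k: "k < N" for k
      using op_adjoint_inner[OF bb[OF k mem(1)] delta_ell2[OF Y_X[OF mem(2)]] bop_ell2[OF bb[OF k mem(3)] delta_ell2[OF Y_X[OF mem(4)]]]]
      by (simp add: inner_delta_left[OF Y_X[OF mem(2)]])
    then have "a i j (delta (\<xi> q)) (\<xi> p) = (\<Sum>k<N. ell2_inner X (b k i (delta (\<xi> p))) (b k j (delta (\<xi> q))))"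
      by (simp add: a mem)
    then show ?thesis
      by (simp add: ip psi_def mem v_def ell2_inner_smult_left ell2_inner_smult_right sum_distrib_left mult.assoc)
  qed
  obtain c where c: "(\<forall>s\<in>S0. \<forall>s'\<in>S0. psi (a (fst s) (fst s')) (snd s) (snd s') = (\<Sum>r\<in>S0. cnj (c r s) * c r s')) \<and>
    (\<forall>s\<in>S0. \<forall>s'\<in>S0. c s s' \<noteq> 0 \<longrightarrow> lab (snd s) = lab (snd s'))"
  proof -
    have "\<exists>c. (\<forall>s\<in>S0. \<forall>s'\<in>S0. psi (a (fst s) (fst s')) (snd s) (snd s') = (\<Sum>r\<in>S0. cnj (c r s) * c r s')) \<and>
      (\<forall>s\<in>S0. \<forall>s'\<in>S0. c s s' \<noteq> 0 \<longrightarrow> lab (snd s) = lab (snd s'))"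
      by (rule gram_cholesky_blocks[where X=X and K="{..<N}" and v=v and lab="\<lambda>s. lab (snd s)", OF S0 v gram])
    then show ?thesis using that by (elim exE)
  qed
  define b' where "b' k j = (\<lambda>r q. if r \<in> Y \<and> q \<in> Y then c (k, r) (j, q) else 0)" for k j
  have b': "b' k j \<in> blk Y lab" if "k < N" "j < N" for k j
    using c that by (auto simp: blk_def b'_def S0_def)
  show "mat_pos F N (\<lambda>i j. psi (a i j))"
    unfolding mat_pos_def
  proof (intro exI[of _ b'] conjI allI impI)
    show "b' k j \<in> carrier F" if "k < N" "j < N" for k j using b'[OF that] by simp
    fix i j assume ij: "i < N" "j < N"
    have "(\<Oplus>\<^bsub>F\<^esub>k\<in>{..<N}. star F (b' k i) \<otimes>\<^bsub>F\<^esub> b' k j) = (\<lambda>p q. \<Sum>k<N. (star F (b' k i) \<otimes>\<^bsub>F\<^esub> b' k j) p q)"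
      by (rule blk_finsum) (use ij in \<open>auto intro!: blk_mult blk_star b'\<close>)
    also have "\<dots> = psi (a i j)"
    proof (intro ext)
      fix p q
      show "(\<Sum>k<N. (star F (b' k i) \<otimes>\<^bsub>F\<^esub> b' k j) p q) = psi (a i j) p q"
      proof (cases "p \<in> Y \<and> q \<in> Y")
        case True
        then have pq: "(i, p) \<in> S0" "(j, q) \<in> S0" using ij by (auto simp: S0_def)
        have "(\<Sum>k<N. (star F (b' k i) \<otimes>\<^bsub>F\<^esub> b' k j) p q) = (\<Sum>k<N. \<Sum>r\<in>Y. cnj (c (k, r) (i, p)) * c (k, r) (j, q))"
          using True by (simp add: b'_def)
        also have "\<dots> = (\<Sum>s\<in>S0. cnj (c s (i, p)) * c s (j, q))"
          unfolding S0_def sum.cartesian_product by (simp add: split_beta)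
        also have "\<dots> = psi (a i j) p q"
          using conjunct1[OF c, rule_format, OF pq] by simp
        finally show ?thesis .
      next
        case False
        then show ?thesis by (auto simp: b'_def psi_def intro!: sum.neutral)
      qed
    qed
    finally show "psi (a i j) = (\<Oplus>\<^bsub>F\<^esub>k\<in>{..<N}. star F (b' k i) \<otimes>\<^bsub>F\<^esub> b' k j)" by (rule sym)
  qed
qed

lemma psi_Phi_nuc_triple: "nuc_triple A n F psi Phi"
  unfolding nuc_triple_def
proof (intro conjI exI[of _ FI] allI impI)
  show "ideal_decomposition F n FI"
    by (rule blk_ideal_decomposition[OF Y_finite]) (auto simp: lab_def Y_colour_support)
qed (simp_all add: blk_finite_dim Y_finite psi_cp Phi_cp psi_contractive FI_cp FI_contractive FI_order_zero)

end

section \<open>Accuracy of the approximation\<close>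

context block_system
begin

lemma Phi_minus: "Phi (\<lambda>p q. a p q - b p q) = (\<lambda>f x. Phi a f x - Phi b f x)"
  using Phi_plus[of a "\<lambda>p q. (-1) * b p q"] Phi_scale[of "-1" b] by simp

lemma psi_minus: "psi (\<lambda>f x. a f x - b f x) = (\<lambda>p q. psi a p q - psi b p q)"
  by (auto simp: psi_def fun_eq_iff right_diff_distrib)

text \<open>The difference is the sum of two band matrices. \<open>\<beta>1\<close> compares each
  block with its representative: entries at most \<delta> per colour, propagation at most
  \<open>D\<close>. \<open>\<beta>2\<close> arises because the products \<open>h i x * h i y\<close>
  only nearly sum to 1: entries at most \<open>\<epsilon> * M\<close>, propagation at most
  \<open>R\<close>. \<open>band_norm\<close> turns both into norm bounds.\<close>

lemma Phi_psi_close: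
  fixes \<alpha> :: "'x \<Rightarrow> 'x \<Rightarrow> complex"
  assumes M: "0 \<le> M" "\<And>x y. x \<in> X \<Longrightarrow> y \<in> X \<Longrightarrow> cmod (\<alpha> x y) \<le> M"
    and R: "\<And>x y. x \<in> X \<Longrightarrow> y \<in> X \<Longrightarrow> d x y > R \<Longrightarrow> \<alpha> x y = 0"
    and NR: "\<And>x. x \<in> X \<Longrightarrow> finite {y\<in>X. d x y \<le> R}" "\<And>x. x \<in> X \<Longrightarrow> card {y\<in>X. d x y \<le> R} \<le> NR"
    and ND: "\<And>x. x \<in> X \<Longrightarrow> finite {y\<in>X. d x y \<le> D}" "\<And>x. x \<in> X \<Longrightarrow> card {y\<in>X. d x y \<le> D} \<le> ND"
    and h0: "\<And>i x. 0 \<le> h i x" and \<epsilon>: "0 \<le> \<epsilon>" and \<delta>: "0 \<le> \<delta>"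
    and near: "\<And>x y. x \<in> X \<Longrightarrow> y \<in> X \<Longrightarrow> d x y \<le> R \<Longrightarrow> \<bar>1 - (\<Sum>i\<le>n. h i x * h i y)\<bar> \<le> \<epsilon>"
    and same: "\<And>i x y. i \<le> n \<Longrightarrow> x \<in> S i \<Longrightarrow> y \<in> S i \<Longrightarrow> d x y \<le> R \<Longrightarrow> lb i x = lb i y"
    and types: "\<And>i x y. i \<le> n \<Longrightarrow> x \<in> S i \<Longrightarrow> y \<in> S i \<Longrightarrow> lb i x = lb i y \<Longrightarrow>
        cmod (complex_of_real (h i x * h i y) * \<alpha> x y -
          complex_of_real (h i (t i x) * h i (t i y)) * \<alpha> (t i x) (t i y)) \<le> \<delta>"
  shows "op_norm X (\<lambda>f x. Phi (psi (matrix_operator X \<alpha>)) f x - matrix_operator X \<alpha> f x) \<le>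
    real ND * (real (Suc n) * \<delta>) + real NR * (\<epsilon> * M)"
proof -
  let ?b = "matrix_operator X \<alpha>"
  define c where "c i x y \<longleftrightarrow> x \<in> S i \<and> y \<in> S i \<and> lb i x = lb i y" for i x y
  define \<beta>1 where "\<beta>1 x y = (\<Sum>i\<le>n. if c i x y then
      complex_of_real (h i (t i x) * h i (t i y)) * \<alpha> (t i x) (t i y) - complex_of_real (h i x * h i y) * \<alpha> x y else 0)" for x y
  define \<beta>2 where "\<beta>2 x y = complex_of_real ((\<Sum>i\<le>n. if c i x y then h i x * h i y else 0) - 1) * \<alpha> x y" for x y
  have \<alpha>: "\<alpha> \<in> finite_propagation X d" by (rule fp_I[OF M R])
  note b = fp_bop[OF \<alpha>]
  have band1: "band X ND (real (Suc n) * \<delta>) \<beta>1"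
  proof (rule band_of_propagation[OF _ _ _ ND])
    show "0 \<le> real (Suc n) * \<delta>" using \<delta> by simp
    fix x y
    have "cmod (\<beta>1 x y) \<le> (\<Sum>i\<le>n. \<delta>)" unfolding \<beta>1_def
    proof (rule sum_norm_le)
      fix i assume i: "i \<in> {..n}"
      show "cmod (if c i x y then complex_of_real (h i (t i x) * h i (t i y)) * \<alpha> (t i x) (t i y) -
          complex_of_real (h i x * h i y) * \<alpha> x y else 0) \<le> \<delta>"
        using types[of i x y] i \<delta> by (auto simp: c_def norm_minus_commute)
    qed
    then show "cmod (\<beta>1 x y) \<le> real (Suc n) * \<delta>" by simp
    assume "d x y > D"
    then have "\<not> c i x y" if "i \<le> n" for i using diam[OF that, of x y] by (auto simp: c_def)
    then show "\<beta>1 x y = 0" unfolding \<beta>1_def by (intro sum.neutral) simp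
  qed
  have band2: "band X NR (\<epsilon> * M) \<beta>2"
  proof (rule band_of_propagation[OF _ _ _ NR])
    show "0 \<le> \<epsilon> * M" using \<epsilon> M by simp
    fix x y assume xy: "x \<in> X" "y \<in> X"
    show "\<beta>2 x y = 0" if "d x y > R" using R[OF xy that] by (simp add: \<beta>2_def)
    show "cmod (\<beta>2 x y) \<le> \<epsilon> * M"
    proof (cases "d x y \<le> R")
      case True
      \<comment> \<open>Points within \<open>R\<close> of each other in the support of one colour
        share a block, so the condition \<open>c i x y\<close> deletes only products that are
        0.\<close>
      have "(if c i x y then h i x * h i y else 0) = h i x * h i y" if i: "i \<le> n" for i
      proof (cases "h i x > 0 \<and> h i y > 0")
        case pos: True
        then have "x \<in> S i" "y \<in> S i" using xy by (simp_all add: S_def)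
        then show ?thesis using same[OF i _ _ True] by (simp add: c_def)
      next
        case False
        then have "h i x = 0 \<or> h i y = 0" using h0[of i x] h0[of i y] by linarith
        then show ?thesis by auto
      qed
      then have "(\<Sum>i\<le>n. if c i x y then h i x * h i y else 0) = (\<Sum>i\<le>n. h i x * h i y)" by simp
      then have "\<bar>(\<Sum>i\<le>n. if c i x y then h i x * h i y else 0) - 1\<bar> \<le> \<epsilon>"
        using near[OF xy True] by (simp only: abs_minus_commute)
      then show ?thesis unfolding \<beta>2_def norm_mult norm_of_real
        by (rule mult_mono[OF _ M(2)[OF xy] \<epsilon>]) simp
    next
      case False
      then have "\<beta>2 x y = 0" using R[OF xy] by (simp add: \<beta>2_def)
      then show ?thesis using \<epsilon> M by simp
    qed
  qed
  have eq: "(\<lambda>f x. Phi (psi ?b) f x - ?b f x) = (\<lambda>f x. matrix_operator X \<beta>1 f x + matrix_operator X \<beta>2 f x)"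
  proof (rule bop_eqI[OF bop_minus[OF roe_bop[OF Phi_roe] b] bop_plus[OF band_bop[OF band1] band_bop[OF band2]]])
    fix x y assume xy: "x \<in> X" "y \<in> X"
    have k: "ker i (psi ?b) x y = (if c i x y then complex_of_real (h i (t i x) * h i (t i y)) * \<alpha> (t i x) (t i y) else 0)"
      if i: "i \<le> n" for i
    proof (cases "c i x y")
      case True
      then have S: "x \<in> S i" "y \<in> S i" and l: "lb i x = lb i y" by (auto simp: c_def)
      note ex = eta[OF i S(1)] and ey = eta[OF i S(2)]
      have tX: "t i x \<in> X" "t i y \<in> X" using t_S[OF i] S S_subset by blast+
      have lab: "lab (\<eta> i x) = lab (\<eta> i y)" using ex(4) ey(4) t_lb[OF i S l] by simp
      have "psi ?b (\<eta> i x) (\<eta> i y) = complex_of_real (h i (t i x)) * complex_of_real (h i (t i y)) * ?b (delta (t i y)) (t i x)"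
        using lab by (simp add: psi_def ex(1-3) ey(1-3) w_def)
      then show ?thesis using True by (simp add: ker_def c_def matrix_operator_entry[OF tX])
    next
      case False
      then have "ker i (psi ?b) x y = 0" unfolding ker_def c_def by (rule if_not_P)
      then show ?thesis using False by simp
    qed
    have "Phi (psi ?b) (delta y) x = (\<Sum>i\<le>n. ker i (psi ?b) x y)"
      unfolding Phi_def phi_def by (simp add: matrix_operator_entry[OF xy])
    also have "\<dots> = (\<Sum>i\<le>n. if c i x y then complex_of_real (h i (t i x) * h i (t i y)) * \<alpha> (t i x) (t i y) else 0)"
      by (rule sum.cong[OF refl]) (rule k, simp)
    also have "\<dots> = \<beta>1 x y + complex_of_real (\<Sum>i\<le>n. if c i x y then h i x * h i y else 0) * \<alpha> x y"
      unfolding \<beta>1_def of_real_sum sum_distrib_right sum.distrib[symmetric]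
      by (rule sum.cong[OF refl]) simp
    also have "\<dots> = \<beta>1 x y + \<beta>2 x y + \<alpha> x y" by (simp add: \<beta>2_def left_diff_distrib)
    finally show "Phi (psi ?b) (delta y) x - ?b (delta y) x =
        matrix_operator X \<beta>1 (delta y) x + matrix_operator X \<beta>2 (delta y) x"
      by (simp add: matrix_operator_entry[OF xy])
  qed
  show ?thesis unfolding eq
    by (rule order_trans[OF op_norm_plus[OF band_bop[OF band1] band_bop[OF band2]]
          add_mono[OF band_norm[OF band1] band_norm[OF band2]]])
qed

text \<open>The factor \<open>n + 4\<close> collects \<open>n + 1\<close> from the norm of
  \<open>Phi\<close> on the image of \<open>a - b\<close>, 2 from the hypothesis on
  \<open>b\<close>, and 1 from the return from \<open>b\<close> to \<open>a\<close>.\<close>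

lemma Phi_psi_approx:
  assumes a: "a \<in> Roe" and b: "b \<in> Roe" and ab: "op_norm X (\<lambda>f x. a f x - b f x) < e"
    and close: "op_norm X (\<lambda>f x. Phi (psi b) f x - b f x) \<le> 2 * e"
  shows "op_norm X (\<lambda>f x. Phi (psi a) f x - a f x) < real (n + 4) * e"
proof -
  let ?D = "\<lambda>f x. a f x - b f x"
  have D: "?D \<in> bounded_operators X" by (rule bop_minus[OF roe_bop[OF a] roe_bop[OF b]])
  have P: "Phi (psi ?D) = (\<lambda>f x. Phi (psi a) f x - Phi (psi b) f x)" unfolding psi_minus Phi_minus ..
  have "op_norm X (Phi (psi ?D)) \<le> real (Suc n) * op_norm Y (matrix_operator Y (psi ?D))" by (rule Phi_norm_le)
  also have "\<dots> \<le> real (Suc n) * e"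
    by (intro mult_left_mono order_trans[OF psi_norm_le[OF D]]) (use ab in auto)
  finally have 1: "op_norm X (Phi (psi ?D)) \<le> real (Suc n) * e" .
  let ?E = "\<lambda>f x. Phi (psi b) f x - b f x" and ?D' = "\<lambda>f x. b f x - a f x"
  have E: "?E \<in> bounded_operators X" by (rule bop_minus[OF roe_bop[OF Phi_roe] roe_bop[OF b]])
  have D': "?D' \<in> bounded_operators X" by (rule bop_minus[OF roe_bop[OF b] roe_bop[OF a]])
  have "(\<lambda>f x. Phi (psi a) f x - a f x) = (\<lambda>f x. Phi (psi ?D) f x + (?E f x + ?D' f x))"
    unfolding P by simp
  then have "op_norm X (\<lambda>f x. Phi (psi a) f x - a f x) \<le> op_norm X (Phi (psi ?D)) + op_norm X (\<lambda>f x. ?E f x + ?D' f x)"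
    using op_norm_plus[OF roe_bop[OF Phi_roe] bop_plus[OF E D']] by (simp only:)
  also have "\<dots> \<le> op_norm X (Phi (psi ?D)) + (op_norm X ?E + op_norm X ?D')"
    by (intro add_left_mono op_norm_plus E D')
  also have "\<dots> < real (Suc n) * e + (2 * e + e)"
    using 1 close ab op_norm_minus_commute[of X b a] by linarith
  also have "\<dots> = real (n + 4) * e" by (simp add: algebra_simps)
  finally show ?thesis .
qed

end

section \<open>Choice of the constants and construction of the net\<close>

context bg_space
begin

text \<open>One partition has to serve all of \<open>G\<close>, which requires a common propagation
  and a common bound; both are maxima over the finite set.\<close>

lemma finite_common_bounds:
  assumes "finite G" "\<And>a. a \<in> G \<Longrightarrow> \<alpha> a \<in> finite_propagation X d"
  shows "\<exists>M R. 0 \<le> M \<and> 0 < R \<and> (\<forall>a\<in>G. \<forall>x\<in>X. \<forall>y\<in>X. cmod (\<alpha> a x y) \<le> M \<and> (d x y > R \<longrightarrow> \<alpha> a x y = 0))"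
  using assms
proof (induction G rule: finite_induct)
  case empty
  show ?case by (intro exI[of _ 0] exI[of _ 1]) simp
next
  case (insert a G)
  obtain M R where 1: "0 \<le> M \<and> 0 < R \<and> (\<forall>a\<in>G. \<forall>x\<in>X. \<forall>y\<in>X. cmod (\<alpha> a x y) \<le> M \<and> (d x y > R \<longrightarrow> \<alpha> a x y = 0))"
    using insert by auto
  obtain M' R' where 2: "0 \<le> M'" "0 < R'" "\<And>x y. x \<in> X \<Longrightarrow> y \<in> X \<Longrightarrow> cmod (\<alpha> a x y) \<le> M'"
    "\<And>x y. x \<in> X \<Longrightarrow> y \<in> X \<Longrightarrow> d x y > R' \<Longrightarrow> \<alpha> a x y = 0"
    using fp_E[OF insert.prems[of a]] by blast
  show ?case
    by (intro exI[of _ "max M M'"] exI[of _ "max R R'"]) (use 1 2 in \<open>auto simp: le_max_iff_disj\<close>)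
qed

text \<open>The order of the choices is forced: approximants of finite propagation fix
  \<open>M\<close> and \<open>R\<close>; the size of balls of radius \<open>R\<close> fixes
  \<epsilon>; the partition for \<open>R\<close> and \<epsilon> produces the block diameter
  \<open>D\<close>; the size of balls of radius \<open>D\<close> fixes the rounding error \<delta>,
  and only then can the types be chosen.\<close>

lemma approximating_triple:
  assumes asdim: "asdim_le X d n" and G: "finite G" "G \<subseteq> Roe" and e: "e > 0"
  shows "\<exists>(F :: (nat \<Rightarrow> nat \<Rightarrow> complex) cstar) \<psi> \<phi>.
    nuc_triple A n F \<psi> \<phi> \<and> (\<forall>a\<in>G. op_norm X (\<lambda>f x. \<phi> (\<psi> a) f x - a f x) < e)"
proof -
  \<comment> \<open>The denominator is the factor of \<open>Phi_psi_approx\<close>.\<close>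
  define e' where "e' = e / real (n + 4)"
  have e': "e' > 0" using e by (simp add: e'_def)
  define \<alpha> where "\<alpha> a = (SOME \<alpha>. \<alpha> \<in> finite_propagation X d \<and> op_norm X (\<lambda>f x. a f x - matrix_operator X \<alpha> f x) < e')" for a
  have \<alpha>: "\<alpha> a \<in> finite_propagation X d \<and> op_norm X (\<lambda>f x. a f x - matrix_operator X (\<alpha> a) f x) < e'" if "a \<in> G" for a
    unfolding \<alpha>_def
  proof (rule someI_ex[of "\<lambda>\<alpha>. \<alpha> \<in> finite_propagation X d \<and> op_norm X (\<lambda>f x. a f x - matrix_operator X \<alpha> f x) < e'"])
    show "\<exists>\<alpha>. \<alpha> \<in> finite_propagation X d \<and> op_norm X (\<lambda>f x. a f x - matrix_operator X \<alpha> f x) < e'"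
      using roe_approx[of a e'] G that e' by blast
  qed
  obtain M R where MR: "0 \<le> M \<and> 0 < R \<and> (\<forall>a\<in>G. \<forall>x\<in>X. \<forall>y\<in>X. cmod (\<alpha> a x y) \<le> M \<and> (d x y > R \<longrightarrow> \<alpha> a x y = 0))"
    using finite_common_bounds[OF G(1), of \<alpha>] \<alpha> by auto
  then have M: "0 \<le> M" and R: "0 < R" by simp_all
  have \<alpha>M: "cmod (\<alpha> a x y) \<le> M" if "a \<in> G" "x \<in> X" "y \<in> X" for a x y using MR that by simp
  have \<alpha>R: "\<alpha> a x y = 0" if "a \<in> G" "x \<in> X" "y \<in> X" "d x y > R" for a x y using MR that by simp
  obtain NR where NR: "\<And>x. x \<in> X \<Longrightarrow> finite {y\<in>X. d x y \<le> R}" "\<And>x. x \<in> X \<Longrightarrow> card {y\<in>X. d x y \<le> R} \<le> NR"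
    using ball_bound[of R] by blast
  define \<epsilon> where "\<epsilon> = e' / (real NR * M + 1)"
  have NRM: "0 \<le> real NR * M" using M by simp
  have \<epsilon>: "\<epsilon> > 0" unfolding \<epsilon>_def using e' NRM by (intro divide_pos_pos) linarith+
  obtain h :: "nat \<Rightarrow> 'x \<Rightarrow> real" and lb :: "nat \<Rightarrow> 'x \<Rightarrow> 'x set set" and D where part:
    "(\<forall>i x. 0 \<le> h i x) \<and> (\<forall>x\<in>X. (\<Sum>i\<le>n. (h i x)\<^sup>2) = 1) \<and>
    (\<forall>x\<in>X. \<forall>y\<in>X. d x y \<le> R \<longrightarrow> \<bar>1 - (\<Sum>i\<le>n. h i x * h i y)\<bar> \<le> \<epsilon>) \<and>
    (\<forall>i\<le>n. \<forall>x\<in>X. \<forall>y\<in>X. h i x > 0 \<longrightarrow> h i y > 0 \<longrightarrow> d x y \<le> R \<longrightarrow> lb i x = lb i y) \<and>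
    (\<forall>i\<le>n. \<forall>x\<in>X. \<forall>y\<in>X. h i x > 0 \<longrightarrow> h i y > 0 \<longrightarrow> lb i x = lb i y \<longrightarrow> d x y \<le> D)"
    using coloured_partition[OF asdim R \<epsilon>] by (elim exE)
  then have h0: "\<And>i x. 0 \<le> h i x" by simp
  have unit: "(\<Sum>i\<le>n. (h i x)\<^sup>2) = 1" if "x \<in> X" for x using part that by simp
  have near: "\<bar>1 - (\<Sum>i\<le>n. h i x * h i y)\<bar> \<le> \<epsilon>" if "x \<in> X" "y \<in> X" "d x y \<le> R" for x y using part that by simp
  define S where "S i = {x\<in>X. h i x > 0}" for i
  have same: "lb i x = lb i y" if "i \<le> n" "x \<in> S i" "y \<in> S i" "d x y \<le> R" for i x y
    using part that by (simp add: S_def)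
  have diam: "d x y \<le> D" if "i \<le> n" "x \<in> S i" "y \<in> S i" "lb i x = lb i y" for i x y
    using part that by (simp add: S_def)
  have h1: "h i x \<le> 1" if "i \<le> n" "x \<in> X" for i x
  proof -
    have "(h i x)\<^sup>2 \<le> (\<Sum>i\<le>n. (h i x)\<^sup>2)" by (rule member_le_sum) (use that in auto)
    then have "(h i x)\<^sup>2 \<le> 1\<^sup>2" using unit[OF that(2)] by simp
    then show ?thesis by (rule power2_le_imp_le) simp
  qed
  obtain ND where ND: "\<And>x. x \<in> X \<Longrightarrow> finite {y\<in>X. d x y \<le> D}" "\<And>x. x \<in> X \<Longrightarrow> card {y\<in>X. d x y \<le> D} \<le> ND"
    using ball_bound[of D] by blast
  define \<delta> where "\<delta> = e' / (real ND * real (Suc n) + 1)"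
  have \<delta>: "\<delta> > 0" unfolding \<delta>_def using e' by (intro divide_pos_pos add_nonneg_pos mult_nonneg_nonneg) auto
  \<comment> \<open>The entries after cutting with \<open>h i\<close> on both sides: the weights are
    matched between a block and its representative together with the operator.\<close>
  define \<beta> where "\<beta> i a x y = complex_of_real (h i x) * complex_of_real (h i y) * \<alpha> a x y" for i a x y
  define ok where "ok i t \<longleftrightarrow> (\<forall>x\<in>S i. t x \<in> S i) \<and> finite (t ` S i) \<and>
    (\<forall>x\<in>S i. \<forall>y\<in>S i. lb i x = lb i y \<longrightarrow> lb i (t x) = lb i (t y) \<and> (t x = t y \<longrightarrow> x = y) \<and>
      (\<forall>a\<in>G. cmod (\<beta> i a x y - \<beta> i a (t x) (t y)) \<le> \<delta>)) \<and>
    (\<forall>x\<in>S i. \<forall>z\<in>S i. lb i z = lb i (t x) \<longrightarrow> (\<exists>y\<in>S i. lb i y = lb i x \<and> t y = z))" for i t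
  have ex: "\<exists>t. ok i t" if i: "i \<le> n" for i
    unfolding ok_def
  proof (rule finite_types[OF G(1) \<delta>])
    fix x assume x: "x \<in> S i"
    have sub: "{y\<in>S i. lb i y = lb i x} \<subseteq> {y\<in>X. d x y \<le> D}"
      using diam[OF i x] by (auto simp: S_def)
    have xX: "x \<in> X" using x by (simp add: S_def)
    show "finite {y\<in>S i. lb i y = lb i x}" by (rule finite_subset[OF sub ND(1)[OF xX]])
    show "card {y\<in>S i. lb i y = lb i x} \<le> ND" by (rule order_trans[OF card_mono[OF ND(1)[OF xX] sub] ND(2)[OF xX]])
  next
    fix a x y assume a: "a \<in> G" and x: "x \<in> S i" and y: "y \<in> S i"
    have xy: "x \<in> X" "y \<in> X" using x y by (simp_all add: S_def)
    have "h i x * h i y * cmod (\<alpha> a x y) \<le> 1 * 1 * M"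
      by (intro mult_mono h1 \<alpha>M a i xy h0 mult_nonneg_nonneg) auto
    then show "cmod (\<beta> i a x y) \<le> M" by (simp add: \<beta>_def norm_mult h0)
  qed
  define t where "t i = (SOME t. ok i t)" for i
  have t: "ok i (t i)" if "i \<le> n" for i unfolding t_def by (rule someI_ex[OF ex[OF that]])
  have tfin: "finite (SIGMA i:{..n}. t i ` S i)" by (rule finite_SigmaI) (use t in \<open>auto simp: ok_def\<close>)
  obtain enc :: "nat \<times> 'x \<Rightarrow> nat" where enc: "inj_on enc (SIGMA i:{..n}. t i ` S i)"
    using finite_imp_inj_to_nat_seg[OF tfin] by blast
  interpret B: block_system X d n h lb D t enc S
  proof
    show "S i = {x\<in>X. h i x > 0}" for i by (rule S_def)
    show "h i x \<le> 1" if "i \<le> n" "x \<in> X" for i x by (rule h1[OF that])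
    show "d x y \<le> D" if "i \<le> n" "x \<in> S i" "y \<in> S i" "lb i x = lb i y" for i x y by (rule diam[OF that])
    show "t i x \<in> S i" if "i \<le> n" "x \<in> S i" for i x using t[OF that(1)] that by (simp add: ok_def)
    show "finite (t i ` S i)" if "i \<le> n" for i using t[OF that] by (simp add: ok_def)
    show "lb i (t i x) = lb i (t i y)" if "i \<le> n" "x \<in> S i" "y \<in> S i" "lb i x = lb i y" for i x y
      using t[OF that(1)] that unfolding ok_def by blast
    show "x = y" if "i \<le> n" "x \<in> S i" "y \<in> S i" "lb i x = lb i y" "t i x = t i y" for i x y
      using t[OF that(1)] that unfolding ok_def by blast
    show "\<exists>y\<in>S i. lb i y = lb i x \<and> t i y = z" if "i \<le> n" "x \<in> S i" "z \<in> S i" "lb i z = lb i (t i x)" for i x z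
      using t[OF that(1)] that unfolding ok_def by blast
  qed (rule enc)
  have "op_norm X (\<lambda>f x. B.Phi (B.psi a) f x - a f x) < e" if a: "a \<in> G" for a
  proof -
    let ?b = "matrix_operator X (\<alpha> a)"
    have "op_norm X (\<lambda>f x. B.Phi (B.psi ?b) f x - ?b f x) \<le> real ND * (real (Suc n) * \<delta>) + real NR * (\<epsilon> * M)"
    proof (rule B.Phi_psi_close[OF M \<alpha>M[OF a] \<alpha>R[OF a] NR ND h0 less_imp_le[OF \<epsilon>] less_imp_le[OF \<delta>] near same])
      fix i x y assume "i \<le> n" "x \<in> S i" "y \<in> S i" "lb i x = lb i y"
      then have "cmod (\<beta> i a x y - \<beta> i a (t i x) (t i y)) \<le> \<delta>" using t[of i] a unfolding ok_def by blast
      then show "cmod (complex_of_real (h i x * h i y) * \<alpha> a x y -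
          complex_of_real (h i (t i x) * h i (t i y)) * \<alpha> a (t i x) (t i y)) \<le> \<delta>"
        by (simp add: \<beta>_def)
    qed
    \<comment> \<open>The definitions of \<delta> and \<epsilon> make either contribution at most
      \<open>e'\<close>.\<close>
    also have "\<dots> \<le> e' + e'"
    proof (rule add_mono)
      have "real ND * (real (Suc n) * \<delta>) \<le> (real ND * real (Suc n) + 1) * \<delta>" using \<delta> by (simp add: algebra_simps)
      also have "\<dots> = e'" unfolding \<delta>_def
        by (rule nonzero_mult_div_cancel_left[of "real ND * real (Suc n) + 1" e', folded times_divide_eq_right])
           (use mult_nonneg_nonneg[of "real ND" "real (Suc n)"] in linarith)
      finally show "real ND * (real (Suc n) * \<delta>) \<le> e'" .
      have "real NR * (\<epsilon> * M) \<le> (real NR * M + 1) * \<epsilon>" using \<epsilon> by (simp add: algebra_simps)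
      also have "\<dots> = e'" unfolding \<epsilon>_def using NRM by simp
      finally show "real NR * (\<epsilon> * M) \<le> e'" .
    qed
    finally have close: "op_norm X (\<lambda>f x. B.Phi (B.psi ?b) f x - ?b f x) \<le> 2 * e'" by simp
    have "op_norm X (\<lambda>f x. B.Phi (B.psi a) f x - a f x) < real (n + 4) * e'"
      by (rule B.Phi_psi_approx[OF _ fp_roe _ close]) (use \<alpha>[OF a] a G in auto)
    also have "\<dots> = e" by (simp add: e'_def)
    finally show ?thesis .
  qed
  then show ?thesis using B.psi_Phi_nuc_triple by blast
qed

text \<open>At the index \<open>(G, k)\<close> the triple is accurate up to
  \<open>1 / (k + 1)\<close> on \<open>G\<close>. Under inclusion of sets and increase of
  \<open>k\<close>, later indices are at least as accurate on \<open>G\<close>, which is the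
  required uniform convergence.\<close>

lemma nuc_dim_le_of_asdim_le:
  assumes "asdim_le X d n"
  shows "nuc_dim_le A n"
proof -
  define L where "L = {(G, k :: nat). finite G \<and> G \<subseteq> Roe}"
  define R :: "_ \<Rightarrow> _ \<Rightarrow> bool" where "R l l' \<longleftrightarrow> fst l \<subseteq> fst l' \<and> snd l \<le> snd l'"
    for l l' :: "(('x \<Rightarrow> complex) \<Rightarrow> 'x \<Rightarrow> complex) set \<times> nat"
  define good where "good l x \<longleftrightarrow> nuc_triple A n (fst x) (fst (snd x)) (snd (snd x)) \<and>
      (\<forall>a\<in>fst l. op_norm X (\<lambda>f y. snd (snd x) (fst (snd x) a) f y - a f y) < 1 / real (Suc (snd l)))"
    for l and x :: "(nat \<Rightarrow> nat \<Rightarrow> complex) cstar \<times> _ \<times> _"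
  have "\<exists>x. good l x" if "l \<in> L" for l
  proof -
    have l: "finite (fst l)" "fst l \<subseteq> Roe" using that by (auto simp: L_def)
    obtain F :: "(nat \<Rightarrow> nat \<Rightarrow> complex) cstar" and \<psi> \<phi> where "nuc_triple A n F \<psi> \<phi> \<and>
        (\<forall>a\<in>fst l. op_norm X (\<lambda>f x. \<phi> (\<psi> a) f x - a f x) < 1 / real (Suc (snd l)))"
      using approximating_triple[OF assms l, of "1 / real (Suc (snd l))"] by auto
    then show ?thesis by (intro exI[of _ "(F, \<psi>, \<phi>)"]) (simp add: good_def)
  qed
  note ex = this
  define T where "T l = (SOME x. good l x)" for l
  have T: "good l (T l)" if "l \<in> L" for l unfolding T_def by (rule someI_ex[OF ex[OF that]])
  have dir: "directed_by L R"
    unfolding directed_by_def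
  proof (intro conjI ballI)
    show "L \<noteq> {}" by (auto simp: L_def)
    show "reflp_on L R" by (auto simp: R_def intro: reflp_onI)
    show "transp_on L R" by (rule transp_onI) (auto simp: R_def)
    fix l l' assume "l \<in> L" "l' \<in> L"
    then show "\<exists>z\<in>L. R l z \<and> R l' z"
      by (intro bexI[of _ "(fst l \<union> fst l', max (snd l) (snd l'))"]) (auto simp: L_def R_def)
  qed
  have conv: "\<exists>l0\<in>L. \<forall>l\<in>L. R l0 l \<longrightarrow> (\<forall>a\<in>G. nrm A (snd (snd (T l)) (fst (snd (T l)) a) \<ominus>\<^bsub>A\<^esub> a) < e)"
    if G: "finite G" "G \<subseteq> carrier A" and e: "e > 0" for G e
  proof -
    obtain k :: nat where k: "1 / real (Suc k) < e" using nat_approx_posE[OF e] by blast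
    have "nrm A (snd (snd (T l)) (fst (snd (T l)) a) \<ominus>\<^bsub>A\<^esub> a) < e"
      if l: "l \<in> L" and Rl: "R (G, k) l" and a: "a \<in> G" for l a
    proof -
      have g: "good l (T l)" by (rule T[OF l])
      have aR: "a \<in> Roe" using a G(2) by auto
      have "linear_map A (fst (T l)) (fst (snd (T l)))" "linear_map (fst (T l)) A (snd (snd (T l)))"
        using g unfolding good_def nuc_triple_def cp_map_def by blast+
      then have "snd (snd (T l)) (fst (snd (T l)) a) \<in> Roe"
        using aR unfolding linear_map_def by (simp add: Pi_iff)
      then have "nrm A (snd (snd (T l)) (fst (snd (T l)) a) \<ominus>\<^bsub>A\<^esub> a) =
          op_norm X (\<lambda>f y. snd (snd (T l)) (fst (snd (T l)) a) f y - a f y)"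
        by (simp add: roe_a_minus aR)
      also have "\<dots> < 1 / real (Suc (snd l))"
        using g a Rl unfolding good_def R_def by auto
      also have "\<dots> \<le> 1 / real (Suc k)" using Rl by (intro divide_left_mono) (auto simp: R_def)
      finally show ?thesis using k by simp
    qed
    moreover have "(G, k) \<in> L" using G by (simp add: L_def)
    ultimately show ?thesis by blast
  qed
  show ?thesis unfolding nuc_dim_le_def
  proof (intro exI[of _ L] exI[of _ R] exI[of _ "\<lambda>l. fst (T l)"] exI[of _ "\<lambda>l. fst (snd (T l))"]
      exI[of _ "\<lambda>l. snd (snd (T l))"] conjI ballI allI impI dir)
    show "nuc_triple A n (fst (T l)) (fst (snd (T l))) (snd (snd (T l)))" if "l \<in> L" for l
      using T[OF that] unfolding good_def by blast
  qed (use conv in blast)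
qed

end

theorem theorem8p5:
  fixes X :: "'x set" and d :: "'x \<Rightarrow> 'x \<Rightarrow> real"
  assumes "Metric_space X d"
    and "Metric_space.mtopology X d = discrete_topology X"
    and "bounded_geometry X d"
  shows "nuc_dim (uniform_roe_algebra X d) \<le> asdim X d"
proof -
  interpret Metric_space X d by (rule assms(1))
  interpret bg_space X d by unfold_locales (rule assms(3))
  \<comment> \<open>Every \<open>n\<close> admissible for \<open>asdim\<close> is admissible for
    \<open>nuc_dim\<close>, and the infimum over the larger set is the smaller one. If
    \<open>asdim\<close> is infinite, its set is empty and the infimum is the top element.\<close>
  show ?thesis unfolding nuc_dim_def asdim_def
    by (rule Inf_superset_mono) (use nuc_dim_le_of_asdim_le in blast)
qed

end
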